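(* Let $d\ge 1$ and let $A$ be a $d\times d$ real matrix that is expanding, i.e. there exists $q>1$ such that $\|A\boldsymbol x\|_2\ge q\|\boldsymbol x\|_2$ for all $\boldsymbol x\in\mathbf R^d$. Let $f:\mathbf R^d\to\mathbf R$ be a measurable function, square integrable on $[0,1)^d$, satisfying $$f(\boldsymbol x+\boldsymbol e_i)=f(\boldsymbol x)\quad(i=1,\dots,d),\qquad \int_{[0,1)^d}f(\boldsymbol x)\,d\boldsymbol x=0,$$ and $$\sum_{m=1}^\infty\|f-f_{2^m}\|_{L^2[0,1)^d}<\infty .$$ Then for every bounded measurable set $\Gamma\subset\mathbf R^d$, $$\lim_{N\to\infty}\int_\Gamma\left(\frac1{\sqrt N}\sum_{k=1}^N f(A^k\boldsymbol x)\right)^2d\boldsymbol x=\operatorname{Leb}(\Gamma)\,\sigma^2(f),$$ and $$\lim_{N\to\infty}\operatorname{Leb}\left\{\boldsymbol x\in\Gamma\;\middle|\;\frac1{\sqrt N}\sum_{k=1}^N f(A^k\boldsymbol x)\le t\right\}=\operatorname{Leb}(\Gamma)\,\Phi_{\sigma^2(f)}(t)$$ for every real $t\ne 0$. If $\sigma^2(f)>0$, then the last equality holds also for $t=0$.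
   Context: $\mathbf R^d$ is the space of real column vectors, $\widehat{\mathbf R}^d$ the space of real row vectors, and $\mathbf Z^d$ is regarded as a subset of $\widehat{\mathbf R}^d$. $\boldsymbol e_1,\dots,\boldsymbol e_d$ is the canonical basis of $\mathbf R^d$, $\|\cdot\|_2$ is the Euclidean norm, and $\operatorname{Leb}$ is Lebesgue measure on $\mathbf R^d$. For $f$ periodic as in the claim, the Fourier coefficients are $\widehat f(\boldsymbol\xi)=\int_{[0,1)^d}f(\boldsymbol x)\exp(-2\pi\sqrt{-1}\,\boldsymbol\xi\boldsymbol x)\,d\boldsymbol x$, $\boldsymbol\xi\in\mathbf Z^d$ (so $\widehat f(\boldsymbol 0)=0$). For $a>0$ put $R_a=\{\boldsymbol\xi=(\xi_1,\dots,\xi_d)\in\mathbf Z^d\setminus\{\boldsymbol 0\}\mid |\xi_1|,\dots,|\xi_d|\le a\}$ and $$f_a(\boldsymbol x)=\sum_{\boldsymbol\xi\in R_a}\widehat f(\boldsymbol\xi)\exp(2\pi\sqrt{-1}\,\boldsymbol\xi\boldsymbol x).$$ The limiting variance is $$\sigma^2(f)=\sum_{l\ge0}(2-\delta_{0,l})\sum_{\boldsymbol\xi,\boldsymbol\xi'\in\mathbf Z^d}\widehat f(\boldsymbol\xi)\widehat f(\boldsymbol\xi')\,\mathbf 1(\boldsymbol\xi+\boldsymbol\xi'A^l=\boldsymbol 0),$$ where $\delta_{0,l}$ is the Kronecker delta and $\mathbf 1(\cdot)$ equals $1$ if the condition holds and $0$ otherwise; under the hypotheses of the claim this series converges absolutely.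 $\Phi_{\sigma^2}$ is the distribution function of the normal distribution $N(0,\sigma^2)$ with mean $0$ and variance $\sigma^2$; $N(0,0)$ is the point mass at $0$. *)

theory Defs
  imports "HOL-Probability.Probability"
begin

definition expanding :: "real^'d^'d \<Rightarrow> bool" where
  "expanding A \<longleftrightarrow> (\<exists>q>1. \<forall>x. norm (A *v x) \<ge> q * norm x)"

text \<open>
  The library's \<open>^\<close> on \<^typ>\<open>real^'d^'d\<close> would be the entrywise power (multiplication of
  vectors is componentwise), so matrix powers are defined from \<open>**\<close>.
\<close>

primrec matrix_power :: "real^'d^'d \<Rightarrow> nat \<Rightarrow> real^'d^'d" where
  "matrix_power A 0 = mat 1"
| "matrix_power A (Suc k) = A ** matrix_power A k"

definition unit_cube :: "(real^'d) set" where
  "unit_cube = {x. \<forall>i. 0 \<le> x $ i \<and> x $ i < 1}"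

text \<open>
  Row vectors have the same type \<^typ>\<open>real^'d\<close> as column vectors: the product of a row
  \<open>\<xi>\<close> with a column \<open>x\<close> is \<open>\<xi> \<bullet> x\<close>, and the product of a row \<open>\<xi>\<close> with a matrix \<open>A\<close> is
  \<open>\<xi> v* A\<close>.
\<close>

definition int_vectors :: "(real^'d) set" where
  "int_vectors = {\<xi>. \<forall>i. \<xi> $ i \<in> \<int>}"

definition fourier_coeff :: "(real^'d \<Rightarrow> real) \<Rightarrow> real^'d \<Rightarrow> complex" where
  "fourier_coeff f \<xi> =
     (LINT x:unit_cube|lebesgue.
        complex_of_real (f x) * exp (- 2 * complex_of_real pi * \<i> * complex_of_real (\<xi> \<bullet> x)))"

definition freq_box :: "real \<Rightarrow> (real^'d) set" where
  "freq_box a = {\<xi> \<in> int_vectors - {0}. \<forall>i. \<bar>\<xi> $ i\<bar> \<le> a}"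

definition fourier_partial_sum :: "(real^'d \<Rightarrow> real) \<Rightarrow> real \<Rightarrow> real^'d \<Rightarrow> complex" where
  "fourier_partial_sum f a x =
     (\<Sum>\<xi>\<in>freq_box a.
        fourier_coeff f \<xi> * exp (2 * complex_of_real pi * \<i> * complex_of_real (\<xi> \<bullet> x)))"

definition L2_norm_cube :: "(real^'d \<Rightarrow> complex) \<Rightarrow> real" where
  "L2_norm_cube g = sqrt (LINT x:unit_cube|lebesgue. (cmod (g x))\<^sup>2)"

text \<open>
  For real-valued \<open>f\<close> the coefficients at \<open>\<xi>\<close> and \<open>-\<xi>\<close> are complex conjugates, so the sum
  below is real; \<^const>\<open>Re\<close> only adjusts its type.
\<close>

definition limiting_variance :: "real^'d^'d \<Rightarrow> (real^'d \<Rightarrow> real) \<Rightarrow> real" where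
  "limiting_variance A f =
     Re (\<Sum>\<^sub>\<infinity>l\<in>(UNIV::nat set). (2 - of_bool (l = 0)) *
           (\<Sum>\<^sub>\<infinity>(\<xi>, \<xi>')\<in>int_vectors \<times> int_vectors.
              fourier_coeff f \<xi> * fourier_coeff f \<xi>' *
              of_bool (\<xi> + \<xi>' v* matrix_power A l = 0)))"

text \<open>
  The parameter \<open>v\<close> is the variance, whereas \<^const>\<open>normal_density\<close> takes the standard deviation.
\<close>

definition centered_normal :: "real \<Rightarrow> real measure" where
  "centered_normal v =
     (if v = 0 then return borel 0 else density lborel (normal_density 0 (sqrt v)))"

end

theory Submission
  imports Defs
begin

text \<open>
  Choose a band-limited weight \<open>w\<close> with \<open>w \<ge> 1\<close> on \<open>\<Gamma>\<close>. As \<open>A\<close> is expanding, the frequencies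
  \<open>\<xi> A\<^sup>k\<close> run off to infinity exponentially fast, so that in \<open>L\<^sup>2(w dx)\<close> the functions \<open>f(A\<^sup>k x)\<close> and
  \<open>f(A\<^sup>l x)\<close> are nearly orthogonal once \<open>|k - l|\<close> is large, up to the tail \<open>f - f\<^bsub>2^m\<^esub>\<close> with \<open>m\<close>
  proportional to \<open>|k - l|\<close>. The summability hypothesis therefore bounds the normalised sums of
  \<open>f - f\<^bsub>2^m\<^esub>\<close> uniformly in \<open>N\<close> by a quantity tending to 0 with \<open>m\<close>, and reduces everything to
  trigonometric polynomials \<open>g\<close>.

  For these, cut \<open>\<Sum> g(A\<^sup>k x)\<close> into long blocks separated by short gaps of negligible variance. The block sums
  \<open>Y\<^sub>j\<close> form a lacunary sequence: every test function sees the Riesz product \<open>\<Prod> (1 + \<i> \<tau> Y\<^sub>j)\<close> as almost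
  equal to 1, while \<open>\<tau>\<^sup>2 \<Sum> Y\<^sub>j\<^sup>2\<close> is almost constant. Since \<open>exp (\<i> y) = (1 + \<i> y) exp (- y\<^sup>2 / 2 + O(|y|\<^sup>3))\<close>,
  the characteristic functions converge to the Gaussian one with respect to every density \<open>\<psi> \<le> w\<close>.

  The second moment over \<open>\<Gamma>\<close> is at least the Gaussian one in the limit because \<open>1 - cos y \<le> y\<^sup>2 / 2\<close>; the same holds
  for the complementary density \<open>w - 1\<^sub>\<Gamma>\<close>, and the two add up to the full \<open>w\<close>-moment, which is known.
\<close>

section \<open>Expanding matrices and plane waves\<close>

text \<open>Multiplication by \<open>A\<close> need not descend to the torus, so
  \<open>f(A^k x)\<close> need not be periodic and no invariant measure is at hand: all information
  comes from Fourier integrals at the rows \<open>\<xi> v* A^k\<close>. Two kinds of density are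
  used. For a trigonometric polynomial, decay of order \<open>1 / norm \<eta>\<close> suffices, as
  finitely many coefficients meet exponentially growing frequencies. The coefficients of
  \<open>f\<close> are merely square summable, and bounds by absolute values need not be summable
  over all pairs; a weight whose Fourier integral vanishes beyond a radius makes the distant pairs
  contribute exactly 0, and Cauchy-Schwarz handles the rest. An indicator lacks this property, hence
  the domination by \<open>w\<close>: an error small in L2(w) is small for every density below
  \<open>w\<close>. Characteristic functions are bounded and therefore pass to the indicator,
  whereas weak convergence does not control second moments. Only a one-sided inequality survives it,
  which is why the complementary density is brought in.\<close>

lemma borel_measurable_cis: "cis \<in> borel_measurable borel"
  by (intro borel_measurable_continuous_onI continuous_intros)

definition wave :: "real^'d \<Rightarrow> real^'d \<Rightarrow> complex" where
  "wave \<eta> x = cis (2 * pi * (\<eta> \<bullet> x))"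

lemma wave_zero [simp]: "wave 0 x = 1" "wave \<eta> 0 = 1"
  by (simp_all add: wave_def)

lemma wave_add: "wave (\<eta> + \<zeta>) x = wave \<eta> x * wave \<zeta> x"
  by (simp add: wave_def cis_mult inner_add_left distrib_left)

lemma wave_add_right: "wave \<eta> (x + y) = wave \<eta> x * wave \<eta> y"
  by (simp add: wave_def cis_mult inner_add_right distrib_left)

lemma norm_wave [simp]: "norm (wave \<eta> x) = 1"
  by (simp add: wave_def)

lemma cnj_wave: "cnj (wave \<eta> x) = wave (- \<eta>) x"
  by (simp add: wave_def cis_cnj)

lemma wave_measurable [measurable]: "wave \<eta> \<in> borel_measurable borel"
  unfolding wave_def by (intro borel_measurable_continuous_onI continuous_intros)

lemma matrix_power_add: "matrix_power A (m + n) = matrix_power A m ** matrix_power A n"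
  by (induction m) (simp_all add: matrix_mul_assoc)

lemma matrix_power_mult: "matrix_power (matrix_power A m) n = matrix_power A (m * n)"
  by (induction n) (simp_all add: matrix_power_add)

lemma wave_mult_vector: "wave \<eta> (A *v x) = wave (\<eta> v* A) x"
  by (simp add: wave_def dot_lmul_matrix)

lemma mult_vector_measurable [measurable]: "(\<lambda>x. (A :: real^'d^'d) *v x) \<in> borel_measurable borel"
  by (intro borel_measurable_continuous_onI matrix_vector_mult_linear_continuous_on)

locale expanding_matrix =
  fixes A :: "real^'d^'d" and q :: real
  assumes q_gt_1: "1 < q" and expands: "\<And>x. q * norm x \<le> norm (A *v x)"
begin

lemma expands_power: "q ^ k * norm x \<le> norm (matrix_power A k *v x)"
proof (induction k)
  case (Suc k)
  have "q ^ Suc k * norm x \<le> q * norm (matrix_power A k *v x)"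
    using Suc q_gt_1 by (simp add: mult.assoc)
  also have "\<dots> \<le> norm (A *v (matrix_power A k *v x))" by (rule expands)
  finally show ?case by (simp add: matrix_vector_mul_assoc)
qed simp

text \<open>Every fact of the locale thereby becomes available for \<open>matrix_power A k\<close>;
  inverses and row bounds for powers are obtained in this way. Exponent 0 is excluded because the
  expansion factor must exceed 1.\<close>

lemma power_expanding:
  assumes "k > 0" shows "expanding_matrix (matrix_power A k) (q ^ k)"
  using assms q_gt_1 expands_power by unfold_locales (auto simp: one_less_power)

lemma inverse_ex: "\<exists>B. A ** B = mat 1 \<and> B ** A = mat 1"
proof -
  have "\<forall>x. A *v x = 0 \<longrightarrow> x = 0"
  proof (intro allI impI)
    fix x assume "A *v x = 0"
    then have "q * norm x \<le> 0" using expands[of x] by simp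
    then show "x = 0" using q_gt_1 by (simp add: mult_le_0_iff)
  qed
  then show ?thesis
    using matrix_left_invertible_ker[of A] matrix_left_right_inverse[of _ A] by metis
qed

definition inv_matrix :: "real^'d^'d" where
  "inv_matrix = (SOME B. A ** B = mat 1 \<and> B ** A = mat 1)"

lemma inv_matrix: "A ** inv_matrix = mat 1" "inv_matrix ** A = mat 1"
  using someI_ex[OF inverse_ex] by (auto simp: inv_matrix_def)

lemma inv_contracts: "norm (inv_matrix *v x) \<le> norm x / q"
  using expands[of "inv_matrix *v x"] q_gt_1
  by (simp add: matrix_vector_mul_assoc inv_matrix field_simps)

text \<open>The hypothesis concerns columns, but frequencies are rows. Duality transfers it: the
  square of \<open>norm \<xi>\<close> is the pairing of \<open>\<xi> v* A\<close> with
  \<open>inv_matrix *v \<xi>\<close>, and the inverse contracts by \<open>1 / q\<close>.\<close>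

lemma row_expands: "q * norm \<xi> \<le> norm (\<xi> v* A)"
proof (cases "\<xi> = 0")
  case False
  have "norm \<xi> * norm \<xi> = \<xi> \<bullet> (A *v (inv_matrix *v \<xi>))"
    by (simp add: matrix_vector_mul_assoc inv_matrix dot_square_norm power2_eq_square)
  also have "\<dots> = (\<xi> v* A) \<bullet> (inv_matrix *v \<xi>)"
    by (simp add: dot_lmul_matrix)
  also have "\<dots> \<le> norm (\<xi> v* A) * (norm \<xi> / q)"
    by (rule order_trans[OF norm_cauchy_schwarz mult_left_mono[OF inv_contracts]]) simp
  finally show ?thesis using False q_gt_1 by (simp add: field_simps)
qed simp

lemma row_expands_power: "q ^ k * norm \<xi> \<le> norm (\<xi> v* matrix_power A k)"
proof (cases "k = 0")
  case False
  then interpret k: expanding_matrix "matrix_power A k" "q ^ k"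
    by (intro power_expanding) simp
  show ?thesis by (rule k.row_expands)
qed simp

lemma q_power_ge_1: "1 \<le> q ^ k"
  using q_gt_1 by (simp add: one_le_power)

lemma norm_row_ge: "norm \<xi> \<le> norm (\<xi> v* matrix_power A k)"
  using row_expands_power[of k \<xi>] mult_right_mono[OF q_power_ge_1[of k], of "norm \<xi>"] by simp

lemma row_nonzero: "\<xi> \<noteq> 0 \<Longrightarrow> \<xi> v* matrix_power A k \<noteq> 0"
  using norm_row_ge[of \<xi> k] by auto

lemma row_eq_0_iff: "\<xi> v* matrix_power A k = 0 \<longleftrightarrow> \<xi> = 0"
  using row_nonzero by auto

text \<open>Used to write the frequencies of a block as images of short rows under one common power
  of \<open>A\<close>, the form in which the Riesz product estimates take them.\<close>

lemma row_inverse_ex: "\<exists>u. \<xi> = u v* matrix_power A k \<and> norm u \<le> norm \<xi> / q ^ k"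
proof (cases "k = 0")
  case True then show ?thesis by (intro exI[of _ \<xi>]) simp
next
  case False
  then interpret k: expanding_matrix "matrix_power A k" "q ^ k"
    by (intro power_expanding) simp
  have "\<xi> = (\<xi> v* k.inv_matrix) v* matrix_power A k"
    by (simp add: vector_matrix_mul_assoc k.inv_matrix)
  then show ?thesis
    using k.row_expands[of "\<xi> v* k.inv_matrix"] q_gt_1
    by (intro exI[of _ "\<xi> v* k.inv_matrix"]) (auto simp: field_simps)
qed

text \<open>A translation of \<open>A^k x\<close> by a bounded vector is a translation of
  \<open>x\<close> by a vector that is no longer, whatever \<open>k\<close> is. This permits
  averaging over the unit cube at the cost of a bounded shift of the weight.\<close>

lemma column_inverse_ex: "\<exists>u. x = matrix_power A k *v u \<and> norm u \<le> norm x"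
proof (cases "k = 0")
  case True then show ?thesis by (intro exI[of _ x]) simp
next
  case False
  then interpret k: expanding_matrix "matrix_power A k" "q ^ k"
    by (intro power_expanding) simp
  have "norm (k.inv_matrix *v x) \<le> norm x"
    using k.inv_contracts[of x] divide_left_mono[OF q_power_ge_1[of k], of "norm x"] q_power_ge_1[of k]
    by simp
  then show ?thesis
    by (intro exI[of _ "k.inv_matrix *v x"]) (simp add: matrix_vector_mul_assoc k.inv_matrix)
qed

end

section \<open>Weak convergence against integrable densities\<close>

definition fourier_int :: "(real^'d \<Rightarrow> real) \<Rightarrow> real^'d \<Rightarrow> complex" where
  "fourier_int \<phi> \<eta> = (LINT x|lborel. complex_of_real (\<phi> x) * wave \<eta> x)"

text \<open>First order decay is all that geometrically growing frequencies demand, and it is modest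
  enough to hold for compactly supported Lipschitz functions, hence on an L1-dense class.\<close>

definition test_fun :: "(real^'d \<Rightarrow> real) \<Rightarrow> real \<Rightarrow> bool" where
  "test_fun \<phi> C \<longleftrightarrow> integrable lborel \<phi> \<and> 0 \<le> C \<and>
     (\<forall>\<eta>. \<eta> \<noteq> 0 \<longrightarrow> norm (fourier_int \<phi> \<eta>) \<le> C / norm \<eta>)"

lemma integrable_mult_bounded:
  fixes \<phi> :: "'a \<Rightarrow> real" and F :: "'a \<Rightarrow> complex"
  assumes "integrable M \<phi>" and [measurable]: "F \<in> borel_measurable M" and "\<And>x. norm (F x) \<le> K"
  shows "integrable M (\<lambda>x. complex_of_real (\<phi> x) * F x)"
proof (rule Bochner_Integration.integrable_bound[of M "\<lambda>x. K * \<bar>\<phi> x\<bar>"])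
  show "integrable M (\<lambda>x. K * \<bar>\<phi> x\<bar>)" using assms(1) by auto
  have [measurable]: "\<phi> \<in> borel_measurable M" using assms(1) by auto
  show "(\<lambda>x. complex_of_real (\<phi> x) * F x) \<in> borel_measurable M" by measurable
  show "AE x in M. norm (complex_of_real (\<phi> x) * F x) \<le> norm (K * \<bar>\<phi> x\<bar>)"
  proof (rule AE_I2)
    fix x
    have "norm (complex_of_real (\<phi> x) * F x) = \<bar>\<phi> x\<bar> * norm (F x)" by (simp add: norm_mult)
    also have "\<dots> \<le> \<bar>\<phi> x\<bar> * \<bar>K\<bar>" using assms(3)[of x] by (intro mult_left_mono) auto
    finally show "norm (complex_of_real (\<phi> x) * F x) \<le> norm (K * \<bar>\<phi> x\<bar>)" by (simp add: abs_mult mult.commute)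
  qed
qed

lemma norm_integral_mult_bounded:
  fixes \<phi> :: "'a \<Rightarrow> real" and F :: "'a \<Rightarrow> complex"
  assumes "integrable M \<phi>" and "F \<in> borel_measurable M" and "\<And>x. norm (F x) \<le> K"
  shows "norm (LINT x|M. complex_of_real (\<phi> x) * F x) \<le> K * (LINT x|M. \<bar>\<phi> x\<bar>)"
proof -
  have "norm (LINT x|M. complex_of_real (\<phi> x) * F x) \<le> (LINT x|M. norm (complex_of_real (\<phi> x) * F x))"
    by (rule integral_norm_bound)
  also have "\<dots> \<le> (LINT x|M. K * \<bar>\<phi> x\<bar>)"
  proof (rule integral_mono)
    show "integrable M (\<lambda>x. cmod (complex_of_real (\<phi> x) * F x))"
      by (intro integrable_norm integrable_mult_bounded[OF assms])
    show "integrable M (\<lambda>x. K * \<bar>\<phi> x\<bar>)" using assms(1) by auto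
    show "cmod (complex_of_real (\<phi> x) * F x) \<le> K * \<bar>\<phi> x\<bar>" for x
      using mult_left_mono[OF assms(3)[of x], of "\<bar>\<phi> x\<bar>"] by (simp add: norm_mult mult.commute)
  qed
  finally show ?thesis by simp
qed

lemma integrable_wave:
  assumes "integrable lborel \<phi>"
  shows "integrable lborel (\<lambda>x. complex_of_real (\<phi> x) * wave \<eta> x)"
  by (rule integrable_mult_bounded[OF assms, of _ 1]) simp_all

lemma norm_fourier_int_le:
  assumes "integrable lborel \<phi>" shows "norm (fourier_int \<phi> \<eta>) \<le> (LINT x|lborel. \<bar>\<phi> x\<bar>)"
  unfolding fourier_int_def using norm_integral_mult_bounded[OF assms, of "wave \<eta>" 1] by simp

lemma fourier_int_zero: "fourier_int \<phi> 0 = complex_of_real (LINT x|lborel. \<phi> x)"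
  by (simp add: fourier_int_def)

text \<open>Shifting by half a period \<open>u = \<eta> / (2|\<eta>|\<^sup>2)\<close> changes the sign of \<open>wave \<eta>\<close>.\<close>

lemma lipschitz_test_fun:
  fixes \<phi> :: "real^'d \<Rightarrow> real"
  assumes [measurable]: "\<phi> \<in> borel_measurable borel"
    and lip: "\<And>x y. \<bar>\<phi> x - \<phi> y\<bar> \<le> L * norm (x - y)" and supp: "\<And>x. R < norm x \<Longrightarrow> \<phi> x = 0"
    and bnd: "\<And>x. \<bar>\<phi> x\<bar> \<le> K"
  shows "\<exists>C. test_fun \<phi> C"
proof -
  have intb: "integrable lborel (\<lambda>x::real^'d. indicator (cball 0 r) x *\<^sub>R (1::real))" for r
    using emeasure_bounded_finite[of "cball (0::real^'d) r"] by (simp add: integrable_real_indicator)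
  have ib: "integrable lborel (\<lambda>x::real^'d. k * indicator (cball 0 r) x)" for r k :: real
    using integrable_mult_right[OF intb, of k r] by simp
  have int: "integrable lborel \<phi>"
  proof (rule Bochner_Integration.integrable_bound[OF ib[of K R]])
    show "AE x in lborel. norm (\<phi> x) \<le> norm (K * indicator (cball 0 R) x)"
      using bnd supp by (intro AE_I2) (auto simp: indicator_def not_le intro: order_trans[OF bnd])
  qed simp
  define V where "V = measure lborel (cball (0::real^'d) (\<bar>R\<bar> + 1))"
  \<comment> \<open>The second entry of the maximum serves the frequencies of norm at most 2, where
    the trivial bound is enough. For the others the half period has norm at most 1, so the
    difference below is supported in the ball of volume \<open>V\<close>.\<close>
  define C where "C = max (\<bar>L\<bar> * V) (2 * (LINT x|lborel. \<bar>\<phi> x\<bar>))"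
  have C0: "0 \<le> C" unfolding C_def V_def by (simp add: le_max_iff_disj)
  have "norm (fourier_int \<phi> \<eta>) \<le> C / norm \<eta>" if "\<eta> \<noteq> 0" for \<eta>
  proof (cases "norm \<eta> \<le> 2")
    case True
    have "norm (fourier_int \<phi> \<eta>) \<le> (LINT x|lborel. \<bar>\<phi> x\<bar>)" by (rule norm_fourier_int_le[OF int])
    also have "\<dots> \<le> C / 2" by (simp add: C_def)
    also have "\<dots> \<le> C / norm \<eta>" using True that C0 by (intro divide_left_mono) auto
    finally show ?thesis .
  next
    case False
    define u where "u = (1 / (2 * (norm \<eta>)\<^sup>2)) *\<^sub>R \<eta>"
    have nu: "norm u = 1 / (2 * norm \<eta>)" using that by (simp add: u_def power2_eq_square)
    have "\<eta> \<bullet> u = 1 / 2" using that by (simp add: u_def dot_square_norm)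
    then have "2 * pi * (\<eta> \<bullet> u) = pi" by simp
    then have "wave \<eta> u = - 1" unfolding wave_def by (metis cis_pi)
    then have w: "wave \<eta> (x + u) = - wave \<eta> x" for x
      by (simp add: wave_add_right)
    have "fourier_int \<phi> \<eta> = (LINT x|lborel. complex_of_real (\<phi> (x + u)) * wave \<eta> (x + u))"
      unfolding fourier_int_def
      by (subst lborel_distr_plus[of u, symmetric], subst integral_distr) (simp_all add: add.commute)
    also have "\<dots> = - (LINT x|lborel. complex_of_real (\<phi> (x + u)) * wave \<eta> x)"
      by (simp add: w)
    finally have eq: "fourier_int \<phi> \<eta> = - (LINT x|lborel. complex_of_real (\<phi> (x + u)) * wave \<eta> x)" .
    have int2: "integrable lborel (\<lambda>x. \<phi> (x + u))"
      using int by (subst (asm) lborel_distr_plus[of u, symmetric], subst (asm) integrable_distr_eq)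
         (simp_all add: add.commute)
    have "2 * fourier_int \<phi> \<eta> = fourier_int \<phi> \<eta> - (LINT x|lborel. complex_of_real (\<phi> (x + u)) * wave \<eta> x)"
      by (subst mult_2, subst (2) eq) simp
    also have "\<dots> = (LINT x|lborel. complex_of_real (\<phi> x - \<phi> (x + u)) * wave \<eta> x)"
      unfolding fourier_int_def
      by (subst Bochner_Integration.integral_diff[symmetric])
         (auto intro!: integrable_wave int int2 simp: left_diff_distrib)
    also have "norm \<dots> \<le> (LINT x|lborel. \<bar>\<phi> x - \<phi> (x + u)\<bar>)"
      using norm_integral_mult_bounded[of lborel "\<lambda>x. \<phi> x - \<phi> (x + u)" "wave \<eta>" 1] int int2 by simp
    also have "\<dots> \<le> (LINT x|lborel. (\<bar>L\<bar> * norm u) * indicator (cball (0::real^'d) (\<bar>R\<bar> + 1)) x)"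
    proof (rule integral_mono)
      show "integrable lborel (\<lambda>x. \<bar>\<phi> x - \<phi> (x + u)\<bar>)" using int int2 by auto
      show "\<bar>\<phi> x - \<phi> (x + u)\<bar> \<le> \<bar>L\<bar> * norm u * indicator (cball 0 (\<bar>R\<bar> + 1)) x" for x
      proof (cases "x \<in> cball 0 (\<bar>R\<bar> + 1)")
        case True
        have "L * norm u \<le> \<bar>L\<bar> * norm u" by (intro mult_right_mono) auto
        then show ?thesis using lip[of x "x + u"] True by auto
      next
        case out: False
        have "norm u \<le> 1" using False unfolding nu by (intro divide_le_eq_1[THEN iffD2]) auto
        moreover have "norm x \<le> norm (x + u) + norm u"
          using norm_triangle_ineq[of "x + u" "- u"] by simp
        ultimately have "\<bar>R\<bar> < norm (x + u)" "\<bar>R\<bar> < norm x" using out by auto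
        then show ?thesis using supp[of x] supp[of "x + u"] out by auto
      qed
    qed (rule ib)
    also have "\<dots> = \<bar>L\<bar> * V / (2 * norm \<eta>)" by (simp add: V_def nu)
    also have "\<dots> \<le> C / (2 * norm \<eta>)" by (intro divide_right_mono) (simp_all add: C_def)
    finally have "norm (2 * fourier_int \<phi> \<eta>) \<le> C / (2 * norm \<eta>)" .
    moreover have "C / (2 * norm \<eta>) \<le> C / norm \<eta>"
      using that C0 by (intro divide_left_mono) auto
    ultimately show ?thesis
      using norm_ge_zero[of "fourier_int \<phi> \<eta>"] unfolding norm_mult norm_numeral by linarith
  qed
  then show ?thesis using int C0 by (auto simp: test_fun_def)
qed

text \<open>For a uniformly bounded sequence, having this for all integrable \<open>\<psi>\<close>
  is weak-star convergence in L-infinity to the constant \<open>c\<close>.\<close>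

definition weak_lim :: "(nat \<Rightarrow> real^'d \<Rightarrow> complex) \<Rightarrow> complex \<Rightarrow> (real^'d \<Rightarrow> real) \<Rightarrow> bool" where
  "weak_lim F c \<psi> \<longleftrightarrow>
     (\<lambda>n. LINT x|lborel. complex_of_real (\<psi> x) * F n x) \<longlonglongrightarrow> c * complex_of_real (LINT x|lborel. \<psi> x)"

locale bounded_seq =
  fixes F :: "nat \<Rightarrow> real^'d \<Rightarrow> complex" and K :: real
  assumes F_meas [measurable]: "\<And>n. F n \<in> borel_measurable borel" and F_bnd: "\<And>n x. norm (F n x) \<le> K"
begin

lemma F_integrable: "integrable lborel \<psi> \<Longrightarrow> integrable lborel (\<lambda>x. complex_of_real (\<psi> x) * F n x)"
  by (rule integrable_mult_bounded[OF _ _ F_bnd]) simp_all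

lemma weak_lim_add:
  assumes "integrable lborel \<phi>" "integrable lborel \<psi>" "weak_lim F c \<phi>" "weak_lim F c \<psi>"
  shows "weak_lim F c (\<lambda>x. \<phi> x + \<psi> x)"
  using tendsto_add[OF assms(3,4)[unfolded weak_lim_def]] assms(1,2)
  by (simp add: weak_lim_def distrib_left distrib_right F_integrable)

lemma weak_lim_scale:
  assumes "weak_lim F c \<phi>" shows "weak_lim F c (\<lambda>x. a * \<phi> x)"
  using tendsto_mult_left[OF assms[unfolded weak_lim_def], of "complex_of_real a"]
  by (simp add: weak_lim_def mult.assoc mult.left_commute)

text \<open>The uniform bound \<open>K\<close> makes the functionals equicontinuous on L1, so the
  densities with the right limit form an L1-closed set.\<close>

lemma weak_lim_closure:
  assumes \<psi>: "integrable lborel \<psi>"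
    and approx: "\<And>e. 0 < e \<Longrightarrow> \<exists>\<phi>. integrable lborel \<phi> \<and> weak_lim F c \<phi> \<and> (LINT x|lborel. \<bar>\<psi> x - \<phi> x\<bar>) \<le> e"
  shows "weak_lim F c \<psi>"
  unfolding weak_lim_def
proof (rule LIMSEQ_I)
  fix e :: real assume e: "0 < e"
  define D where "D = \<bar>K\<bar> + norm c + 1"
  have D: "0 < D" unfolding D_def by (simp add: add_nonneg_pos)
  obtain \<phi> where \<phi>: "integrable lborel \<phi>" and lim: "weak_lim F c \<phi>"
    and close: "(LINT x|lborel. \<bar>\<psi> x - \<phi> x\<bar>) \<le> e / (2 * D)"
    using approx[of "e / (2 * D)"] e D by auto
  let ?I = "\<lambda>\<psi> n. LINT x|lborel. complex_of_real (\<psi> x) * F n x"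
  obtain N where N: "\<And>n. N \<le> n \<Longrightarrow> norm (?I \<phi> n - c * complex_of_real (LINT x|lborel. \<phi> x)) < e / 2"
    using LIMSEQ_D[OF lim[unfolded weak_lim_def], of "e/2"] e by auto
  show "\<exists>no. \<forall>n\<ge>no. norm (?I \<psi> n - c * complex_of_real (LINT x|lborel. \<psi> x)) < e"
  proof (intro exI allI impI)
    fix n assume "N \<le> n"
    have "?I \<psi> n - ?I \<phi> n = (LINT x|lborel. complex_of_real (\<psi> x - \<phi> x) * F n x)"
      by (subst Bochner_Integration.integral_diff[symmetric])
         (auto simp: F_integrable \<psi> \<phi> left_diff_distrib)
    then have 1: "norm (?I \<psi> n - ?I \<phi> n) \<le> K * (LINT x|lborel. \<bar>\<psi> x - \<phi> x\<bar>)"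
      using norm_integral_mult_bounded[of lborel "\<lambda>x. \<psi> x - \<phi> x" "F n" K] \<psi> \<phi> F_bnd by simp
    have "(LINT x|lborel. \<phi> x) - (LINT x|lborel. \<psi> x) = - (LINT x|lborel. \<psi> x - \<phi> x)"
      using \<psi> \<phi> by simp
    then have 2: "norm (c * complex_of_real (LINT x|lborel. \<phi> x) - c * complex_of_real (LINT x|lborel. \<psi> x))
        \<le> norm c * (LINT x|lborel. \<bar>\<psi> x - \<phi> x\<bar>)"
      by (auto simp: norm_mult right_diff_distrib[symmetric] of_real_diff[symmetric]
           simp del: of_real_diff intro!: mult_left_mono)
    have "(K + norm c) * (LINT x|lborel. \<bar>\<psi> x - \<phi> x\<bar>) \<le> D * (LINT x|lborel. \<bar>\<psi> x - \<phi> x\<bar>)"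
      unfolding D_def by (intro mult_right_mono) auto
    also have "\<dots> \<le> e / 2" using mult_left_mono[OF close, of D] D by (simp add: field_simps)
    finally have 3: "(K + norm c) * (LINT x|lborel. \<bar>\<psi> x - \<phi> x\<bar>) \<le> e / 2" .
    have tri: "norm (a - d) \<le> norm (a - b) + norm (b - c') + norm (c' - d)" for a b c' d :: complex
      by norm
    show "norm (?I \<psi> n - c * complex_of_real (LINT x|lborel. \<psi> x)) < e"
      using tri[of "?I \<psi> n" "c * complex_of_real (LINT x|lborel. \<psi> x)" "?I \<phi> n"
           "c * complex_of_real (LINT x|lborel. \<phi> x)"] 1 2 3 N[OF \<open>N \<le> n\<close>]
      by (simp add: distrib_right)
  qed
qed

lemma weak_lim_dominated:
  assumes "\<And>m. integrable lborel (s m)" "\<And>m. weak_lim F c (s m)" "\<And>x. (\<lambda>m. s m x) \<longlonglongrightarrow> \<psi> x"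
    and bnd: "\<And>m x. \<bar>s m x\<bar> \<le> g x" and g: "integrable lborel g"
  shows "weak_lim F c \<psi>"
proof -
  have [measurable]: "s m \<in> borel_measurable borel" for m using assms(1)[of m] by auto
  have [measurable]: "\<psi> \<in> borel_measurable borel"
    by (rule borel_measurable_LIMSEQ_metric[of s]) (use assms(3) in auto)
  have b\<psi>: "\<bar>\<psi> x\<bar> \<le> g x" for x
    by (rule LIMSEQ_le_const2[OF tendsto_rabs[OF assms(3)]]) (use bnd in auto)
  have \<psi>: "integrable lborel \<psi>"
    by (rule Bochner_Integration.integrable_bound[OF g]) (auto intro!: AE_I2 order_trans[OF b\<psi>])
  have "(\<lambda>m. LINT x|lborel. \<bar>\<psi> x - s m x\<bar>) \<longlonglongrightarrow> (LINT x::real^'d|lborel. (0::real))"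
  proof (rule integral_dominated_convergence[where w = "\<lambda>x. 2 * g x"])
    show "AE x in lborel. (\<lambda>m. \<bar>\<psi> x - s m x\<bar>) \<longlonglongrightarrow> 0"
    proof (rule AE_I2)
      show "(\<lambda>m. \<bar>\<psi> x - s m x\<bar>) \<longlonglongrightarrow> 0" for x
        using tendsto_rabs[OF tendsto_diff[OF tendsto_const[of "\<psi> x"] assms(3)[of x]]] by simp
    qed
    show "AE x in lborel. norm \<bar>\<psi> x - s m x\<bar> \<le> 2 * g x" for m
    proof (rule AE_I2)
      show "norm \<bar>\<psi> x - s m x\<bar> \<le> 2 * g x" for x
        using b\<psi>[of x] bnd[of m x] by simp
    qed
  qed (use g in auto)
  then have "\<forall>e>0. \<exists>m. (LINT x|lborel. \<bar>\<psi> x - s m x\<bar>) \<le> e"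
    by (auto simp: lim_sequentially dist_real_def) (metis abs_le_D1 less_imp_le order_refl)
  then show ?thesis using assms(1,2) by (intro weak_lim_closure[OF \<psi>]) blast
qed

text \<open>Test functions reach compact sets through Lipschitz cutoffs, compact sets reach bounded
  Borel sets by inner regularity, truncation gives all sets of finite measure, and induction on
  integrable functions does the rest.\<close>

lemma weak_lim_extend:
  assumes test: "\<And>\<phi> C. test_fun \<phi> C \<Longrightarrow> weak_lim F c \<phi>" and "integrable lborel \<psi>"
  shows "weak_lim F c \<psi>"
proof -
  have compact: "weak_lim F c (indicator S)" if cS: "compact S" for S
  proof (cases "S = {}")
    case True then show ?thesis by (simp add: weak_lim_def)
  next
    case False
    \<comment> \<open>Lipschitz cutoffs decreasing to the indicator of \<open>S\<close>. The factor
      \<open>Suc m\<close> instead of \<open>m\<close> gives already \<open>s 0\<close> a bounded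
      support, so that \<open>s 0\<close> can dominate the whole sequence.\<close>
    define s where "s m x = max 0 (1 - real (Suc m) * infdist x S)" for m x
    have [measurable]: "s m \<in> borel_measurable borel" for m
      unfolding s_def by (intro borel_measurable_continuous_onI continuous_intros)
    have smono: "0 \<le> s m x" "s m x \<le> 1" for m x using infdist_nonneg[of x S] by (auto simp: s_def)
    obtain R where R: "\<And>x. x \<in> S \<Longrightarrow> norm x \<le> R"
      using compact_imp_bounded[OF cS] by (auto simp: bounded_iff)
    have far: "1 \<le> infdist x S" if "R + 1 < norm x" for x
      unfolding infdist_def using False R that
      by (auto intro!: cINF_greatest simp: dist_norm) (smt (verit) norm_triangle_ineq2 R)
    have supp: "s m x = 0" if "R + 1 < norm x" for m x
      using mult_mono[of 1 "real (Suc m)" 1 "infdist x S"] far[OF that] by (simp add: s_def)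
    have "\<bar>s m x - s m y\<bar> \<le> real (Suc m) * norm (x - y)" for m x y
    proof -
      have "\<bar>infdist x S - infdist y S\<bar> \<le> norm (x - y)"
        using infdist_triangle_abs[of x S y] by (simp add: dist_norm)
      then have "real (Suc m) * \<bar>infdist x S - infdist y S\<bar> \<le> real (Suc m) * norm (x - y)"
        by (rule mult_left_mono) simp
      moreover have "\<bar>s m x - s m y\<bar> \<le> \<bar>real (Suc m) * infdist x S - real (Suc m) * infdist y S\<bar>"
        by (auto simp: s_def)
      moreover have "\<bar>real (Suc m) * infdist x S - real (Suc m) * infdist y S\<bar> = real (Suc m) * \<bar>infdist x S - infdist y S\<bar>"
        by (simp only: right_diff_distrib[symmetric] abs_mult abs_of_nat)
      ultimately show ?thesis by linarith
    qed
    then have tf: "\<exists>C. test_fun (s m) C" for m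
      using supp smono by (intro lipschitz_test_fun[of _ "real (Suc m)" "R + 1" 1]) auto
    show ?thesis
    proof (rule weak_lim_dominated[of s c "indicator S" "s 0"])
      show "integrable lborel (s m)" for m using tf[of m] by (auto simp: test_fun_def)
      show "integrable lborel (s 0)" using tf[of 0] by (auto simp: test_fun_def)
      show "weak_lim F c (s m)" for m using tf test by auto
      show "\<bar>s m x\<bar> \<le> s 0 x" for m x
        using smono[of m x] mult_right_mono[of 1 "real (Suc m)" "infdist x S"] infdist_nonneg[of x S]
        by (auto simp: s_def)
      show "(\<lambda>m. s m x) \<longlonglongrightarrow> indicator S x" for x
      proof (cases "x \<in> S")
        case True then show ?thesis by (simp add: s_def)
      next
        case xS: False
        then have pos: "0 < infdist x S"
          using cS False by (simp add: compact_imp_closed infdist_pos_not_in_closed)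
        obtain k where k: "1 / infdist x S < real k" using reals_Archimedean2 by blast
        have "s m x = 0" if "k \<le> m" for m
        proof -
          have "1 \<le> real k * infdist x S" using k pos by (simp add: field_simps)
          also have "\<dots> \<le> real (Suc m) * infdist x S" using that pos by (intro mult_right_mono) auto
          finally show ?thesis by (simp add: s_def)
        qed
        then have "eventually (\<lambda>m. 0 = s m x) sequentially" unfolding eventually_sequentially by metis
        then have "(\<lambda>m. s m x) \<longlonglongrightarrow> 0" by (rule Lim_transform_eventually[OF tendsto_const])
        then show ?thesis using xS by simp
      qed
    qed
  qed
  have bdd: "weak_lim F c (indicator S)" if S: "S \<in> sets lborel" and "bounded S" for S
  proof (rule weak_lim_closure)
    have fin: "emeasure lborel S < \<infinity>" by (rule emeasure_bounded_finite) fact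
    then show "integrable lborel (indicator S :: _ \<Rightarrow> real)" using S by (simp add: integrable_real_indicator)
    fix e :: real assume "0 < e"
    obtain T where T: "closed T" "T \<subseteq> S" "S - T \<in> lmeasurable" "emeasure lebesgue (S - T) < ennreal e"
      using sets_lebesgue_inner_closed[of S e] S \<open>0 < e\<close> by auto
    have cT: "compact T" using T \<open>bounded S\<close> bounded_subset compact_eq_bounded_closed by blast
    have Tm [measurable]: "T \<in> sets borel" using T by simp
    have [measurable]: "S \<in> sets borel" using S by simp
    have "emeasure lebesgue (S - T) = emeasure lborel (S - T)" by (simp add: emeasure_completion)
    then have "measure lborel (S - T) \<le> e" using T(4) \<open>0 < e\<close>
      by (simp add: measure_def enn2real_leI)
    moreover have "(\<lambda>x. \<bar>indicator S x - indicator T x\<bar> :: real) = indicator (S - T)"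
      using T(2) by (auto simp: fun_eq_iff indicator_def)
    ultimately have "(LINT x|lborel. \<bar>indicator S x - indicator T x\<bar>) \<le> e" by simp
    moreover have "integrable lborel (indicator T :: _ \<Rightarrow> real)"
      using emeasure_bounded_finite[OF compact_imp_bounded[OF cT]] by (simp add: integrable_real_indicator)
    ultimately show "\<exists>\<phi>. integrable lborel \<phi> \<and> weak_lim F c \<phi> \<and> (LINT x|lborel. \<bar>indicator S x - \<phi> x\<bar>) \<le> e"
      using compact[OF cT] by blast
  qed
  have fin: "weak_lim F c (indicator S)" if [measurable]: "S \<in> sets lborel" and f: "emeasure lborel S < \<infinity>" for S
  proof (rule weak_lim_dominated[of "\<lambda>m. indicator (S \<inter> cball 0 (real m))" c _ "indicator S"])
    show int: "integrable lborel (indicator S :: _ \<Rightarrow> real)" using f that(1) by (simp add: integrable_real_indicator)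
    have b: "bounded (S \<inter> cball 0 (real m))" for m by (simp add: bounded_Int)
    then show "weak_lim F c (indicator (S \<inter> cball 0 (real m)))" for m
      using that(1) by (intro bdd) (auto intro!: sets.Int)
    show "integrable lborel (indicator (S \<inter> cball 0 (real m)) :: _ \<Rightarrow> real)" for m
      using emeasure_bounded_finite[OF b[of m]] that(1) by (auto intro!: integrable_real_indicator sets.Int)
    show "(\<lambda>m. indicator (S \<inter> cball 0 (real m)) x) \<longlonglongrightarrow> (indicator S x :: real)" for x
    proof -
      obtain k where "norm x \<le> real k" using real_arch_simple by blast
      then have "eventually (\<lambda>m. indicator S x = (indicator (S \<inter> cball 0 (real m)) x :: real)) sequentially"
        unfolding eventually_sequentially by (intro exI[of _ k]) (auto simp: indicator_def)
      then show ?thesis by (rule Lim_transform_eventually[OF tendsto_const])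
    qed
  qed (auto simp: indicator_def)
  show ?thesis using \<open>integrable lborel \<psi>\<close>
  proof (induction rule: integrable_induct)
    case (base A a)
    then show ?case using weak_lim_scale[OF fin, of A a] by (simp add: mult.commute)
  next
    case (add f g) then show ?case by (intro weak_lim_add)
  next
    case (lim f s)
    then show ?case
      by (intro weak_lim_dominated[of s c f "\<lambda>x. 2 * \<bar>f x\<bar>"]) auto
  qed
qed

end

section \<open>Second moments of trigonometric polynomials\<close>

lemma cesaro_mean:
  fixes X :: "nat \<Rightarrow> 'a::real_normed_vector"
  assumes "X \<longlonglongrightarrow> L"
  shows "(\<lambda>N. (1 / real N) *\<^sub>R (\<Sum>m<N. X m)) \<longlonglongrightarrow> L"
proof (rule LIMSEQ_I)
  fix e :: real assume e: "0 < e"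
  obtain k where k: "\<And>m. k \<le> m \<Longrightarrow> norm (X m - L) < e / 2"
    using LIMSEQ_D[OF assms, of "e/2"] e by auto
  define M where "M = (\<Sum>m<k. norm (X m - L))"
  obtain N0 where N0: "2 * M / e < real N0" using reals_Archimedean2 by blast
  show "\<exists>no. \<forall>N\<ge>no. norm ((1 / real N) *\<^sub>R (\<Sum>m<N. X m) - L) < e"
  proof (intro exI[of _ "max (max N0 k) 1"] allI impI)
    fix N assume N: "max (max N0 k) 1 \<le> N"
    have "(1 / real N) *\<^sub>R (\<Sum>m<N. X m) - L = (1 / real N) *\<^sub>R (\<Sum>m<N. X m - L)"
      using N by (simp add: sum_subtractf scaleR_right_diff_distrib sum_constant_scaleR)
    then have "norm ((1 / real N) *\<^sub>R (\<Sum>m<N. X m) - L) \<le> (1 / real N) * (\<Sum>m<N. norm (X m - L))"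
      by (auto intro!: divide_right_mono norm_sum)
    also have "(\<Sum>m<N. norm (X m - L)) = M + (\<Sum>m=k..<N. norm (X m - L))"
      unfolding M_def using N
      by (subst sum.atLeastLessThan_concat[of 0 k N "\<lambda>m. norm (X m - L)", symmetric, unfolded atLeast0LessThan]) auto
    also have "(\<Sum>m=k..<N. norm (X m - L)) \<le> (\<Sum>m=k..<N. e / 2)"
      using k by (intro sum_mono) (auto intro: less_imp_le)
    also have "\<dots> \<le> real N * (e / 2)" using e by (simp add: mult_right_mono)
    finally have "norm ((1 / real N) *\<^sub>R (\<Sum>m<N. X m) - L) \<le> (1 / real N) * (M + real N * (e / 2))"
      using N by (simp add: mult_left_mono divide_right_mono)
    also have "\<dots> = M / real N + e / 2" using N by (simp add: field_simps)
    also have "\<dots> < e"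
    proof -
      have "2 * M / e < real N" using N0 N by simp
      then show ?thesis using e N by (simp add: field_simps)
    qed
    finally show "norm ((1 / real N) *\<^sub>R (\<Sum>m<N. X m) - L) < e" .
  qed
qed

text \<open>Grouping pairs by their larger index turns a second moment into a sum over
  \<open>m\<close> of quantities that converge to the variance series; Cesaro averaging then
  applies.\<close>

lemma square_sum_by_max:
  fixes X :: "nat \<Rightarrow> 'a::comm_semiring_1"
  shows "(\<Sum>k<N. X k)\<^sup>2 = (\<Sum>m<N. X m * X m + 2 * (\<Sum>k<m. X k * X m))"
proof (induction N)
  case (Suc N)
  have "(\<Sum>k<Suc N. X k)\<^sup>2 = (\<Sum>k<N. X k)\<^sup>2 + (X N * X N + 2 * ((\<Sum>k<N. X k) * X N))"
    by (simp add: power2_eq_square mult_2 algebra_simps)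
  then show ?case by (simp add: Suc sum_distrib_right)
qed simp

text \<open>An indexed family rather than a set of frequencies: products and block sums repeat
  frequencies, and in this form equal ones need not be merged.\<close>

definition trig_poly :: "('i \<Rightarrow> complex) \<Rightarrow> ('i \<Rightarrow> real^'d) \<Rightarrow> 'i set \<Rightarrow> real^'d \<Rightarrow> complex" where
  "trig_poly c \<eta> I x = (\<Sum>i\<in>I. c i * wave (\<eta> i) x)"

text \<open>The limiting covariance of the polynomial at two times \<open>n\<close> steps apart:
  only pairs of frequencies that cancel exactly survive. No conjugation occurs because the
  polynomials of interest are real-valued; \<open>trig_variance\<close> is the resulting Green-Kubo
  series.\<close>

definition trig_corr :: "('i \<Rightarrow> complex) \<Rightarrow> ('i \<Rightarrow> real^'d) \<Rightarrow> 'i set \<Rightarrow> real^'d^'d \<Rightarrow> nat \<Rightarrow> complex" where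
  "trig_corr c \<eta> I A n = (\<Sum>i\<in>I. \<Sum>j\<in>I. c i * c j * of_bool (\<eta> i + \<eta> j v* matrix_power A n = 0))"

definition trig_variance :: "('i \<Rightarrow> complex) \<Rightarrow> ('i \<Rightarrow> real^'d) \<Rightarrow> 'i set \<Rightarrow> real^'d^'d \<Rightarrow> complex" where
  "trig_variance c \<eta> I A = trig_corr c \<eta> I A 0 + 2 * (\<Sum>n. trig_corr c \<eta> I A (Suc n))"

lemma trig_poly_measurable [measurable]: "trig_poly c \<eta> I \<in> borel_measurable borel"
  unfolding trig_poly_def by measurable

lemma norm_trig_poly_le: "norm (trig_poly c \<eta> I x) \<le> (\<Sum>i\<in>I. norm (c i))"
  unfolding trig_poly_def by (rule order_trans[OF norm_sum]) (simp add: norm_mult)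

lemma trig_poly_mult_vector: "trig_poly c \<eta> I (A *v x) = trig_poly c (\<lambda>i. \<eta> i v* A) I x"
  by (simp add: trig_poly_def wave_mult_vector)

lemma trig_poly_mult:
  "trig_poly c \<eta> I x * trig_poly d \<zeta> J x = trig_poly (\<lambda>(i,j). c i * d j) (\<lambda>(i,j). \<eta> i + \<zeta> j) (I \<times> J) x"
  by (simp add: trig_poly_def sum_product sum.cartesian_product wave_add case_prod_unfold mult_ac)

lemma integral_trig_poly:
  assumes "integrable lborel \<phi>"
  shows "(LINT x|lborel. complex_of_real (\<phi> x) * trig_poly c \<eta> I x) = (\<Sum>i\<in>I. c i * fourier_int \<phi> (\<eta> i))"
proof -
  have "(LINT x|lborel. complex_of_real (\<phi> x) * trig_poly c \<eta> I x)
      = (LINT x|lborel. (\<Sum>i\<in>I. c i * (complex_of_real (\<phi> x) * wave (\<eta> i) x)))"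
    by (simp add: trig_poly_def sum_distrib_left mult_ac)
  also have "\<dots> = (\<Sum>i\<in>I. c i * fourier_int \<phi> (\<eta> i))"
    unfolding fourier_int_def
    by (subst Bochner_Integration.integral_sum) (auto intro!: integrable_wave assms)
  finally show ?thesis .
qed

lemma power_over_tendsto_0:
  fixes q :: real assumes "1 < q"
  shows "(\<lambda>m. K * real (Suc m) / q ^ m) \<longlonglongrightarrow> 0"
proof -
  have "summable (\<lambda>m. real (Suc m) * (1/q) ^ m)"
    using summable_norm_cancel[of "\<lambda>m. real (Suc m) * (1/q) ^ m"] geometric_deriv_sums[of "1/q"] assms
    by (auto simp: sums_iff diffs_def)
  from tendsto_mult_left[OF summable_LIMSEQ_zero[OF this], of K] show ?thesis
    by (simp add: power_divide mult.assoc)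
qed

context expanding_matrix
begin

text \<open>For large \<open>n\<close> the row \<open>\<eta> j v* matrix_power A n\<close> outweighs
  every \<open>\<eta> i\<close>, and half of the minimal frequency norm \<open>m\<close> serves as
  \<open>\<delta>\<close>. Below the threshold \<open>n0\<close> only finitely many values occur, so
  their minimum, taken over the nonzero ones, is positive.\<close>

lemma frequency_gap:
  assumes "finite I" and nz: "\<And>i. i \<in> I \<Longrightarrow> \<eta> i \<noteq> 0"
  shows "\<exists>\<delta>>0. \<forall>i\<in>I. \<forall>j\<in>I. \<forall>n. \<eta> i + \<eta> j v* matrix_power A n \<noteq> 0 \<longrightarrow>
           \<delta> * q ^ n \<le> norm (\<eta> i + \<eta> j v* matrix_power A n)"
    and "\<exists>n0. \<forall>i\<in>I. \<forall>j\<in>I. \<forall>n\<ge>n0. \<eta> i + \<eta> j v* matrix_power A n \<noteq> 0"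
proof -
  define Z where "Z i j n = \<eta> i + \<eta> j v* matrix_power A n" for i j n
  obtain m where m: "0 < m" "\<And>i. i \<in> I \<Longrightarrow> m \<le> norm (\<eta> i)"
  proof (cases "I = {}")
    case False
    then show ?thesis using assms
      by (intro that[of "Min ((\<lambda>i. norm (\<eta> i)) ` I)"]) (auto simp: Min_gr_iff)
  qed (use that[of 1] in auto)
  define B where "B = (\<Sum>i\<in>I. norm (\<eta> i))"
  have B: "norm (\<eta> i) \<le> B" if "i \<in> I" for i
    unfolding B_def by (rule member_le_sum[of i I "\<lambda>i. norm (\<eta> i)"]) (use that assms in auto)
  obtain n0 where n0: "2 * B / m < q ^ n0" using real_arch_pow[OF q_gt_1] by blast
  have big: "m / 2 * q ^ n \<le> norm (Z i j n)" "Z i j n \<noteq> 0" if "i \<in> I" "j \<in> I" "n0 \<le> n" for i j n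
  proof -
    have "2 * B / m < q ^ n" using n0 power_increasing[OF \<open>n0 \<le> n\<close>, of q] q_gt_1 by linarith
    then have "2 * B < m * q ^ n" using m by (simp add: field_simps)
    moreover have "m * q ^ n \<le> norm (\<eta> j v* matrix_power A n)"
    proof -
      have "q ^ n * m \<le> q ^ n * norm (\<eta> j)" using m(2)[OF \<open>j \<in> I\<close>] q_gt_1 by (intro mult_left_mono) auto
      then show ?thesis using row_expands_power[of n "\<eta> j"] by (subst mult.commute) linarith
    qed
    moreover have "norm (\<eta> j v* matrix_power A n) \<le> norm (Z i j n) + norm (\<eta> i)"
      unfolding Z_def using norm_triangle_ineq[of "\<eta> i + \<eta> j v* matrix_power A n" "- \<eta> i"] by simp
    ultimately show 1: "m / 2 * q ^ n \<le> norm (Z i j n)" using B[OF \<open>i \<in> I\<close>] by simp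
    have "0 < m / 2 * q ^ n" using m q_gt_1 by simp
    then show "Z i j n \<noteq> 0" using 1 by auto
  qed
  show "\<exists>n0. \<forall>i\<in>I. \<forall>j\<in>I. \<forall>n\<ge>n0. \<eta> i + \<eta> j v* matrix_power A n \<noteq> 0"
    using big(2) unfolding Z_def by blast
  define S where "S = insert (m / 2) ((\<lambda>(i,j,n). norm (Z i j n) / q ^ n) ` {(i,j,n) \<in> I \<times> I \<times> {..<n0}. Z i j n \<noteq> 0})"
  have "finite {(i,j,n) \<in> I \<times> I \<times> {..<n0}. Z i j n \<noteq> 0}"
    by (rule finite_subset[of _ "I \<times> I \<times> {..<n0}"]) (use assms in auto)
  then have S: "finite S" "S \<noteq> {}" by (auto simp: S_def)
  have "0 < Min S" using S m q_gt_1 by (auto simp: S_def Min_gr_iff)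
  moreover have "Min S * q ^ n \<le> norm (Z i j n)" if "i \<in> I" "j \<in> I" "Z i j n \<noteq> 0" for i j n
  proof (cases "n < n0")
    case True
    have "Min S \<le> norm (Z i j n) / q ^ n"
      by (rule Min_le[OF S(1)]) (use that True in \<open>auto simp: S_def intro!: image_eqI[of _ _ "(i,j,n)"]\<close>)
    then show ?thesis using q_gt_1 by (simp add: field_simps)
  next
    case False
    have "Min S \<le> m / 2" by (rule Min_le[OF S(1)]) (simp add: S_def)
    then have "Min S * q ^ n \<le> m / 2 * q ^ n" using q_gt_1 by (intro mult_right_mono) auto
    moreover have "n0 \<le> n" using False by simp
    ultimately show ?thesis using big(1)[OF that(1,2), of n] by linarith
  qed
  ultimately show "\<exists>\<delta>>0. \<forall>i\<in>I. \<forall>j\<in>I. \<forall>n. \<eta> i + \<eta> j v* matrix_power A n \<noteq> 0 \<longrightarrow>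
           \<delta> * q ^ n \<le> norm (\<eta> i + \<eta> j v* matrix_power A n)"
    unfolding Z_def by blast
qed

lemma trig_corr_finite_support:
  assumes "finite I" "\<And>i. i \<in> I \<Longrightarrow> \<eta> i \<noteq> 0"
  shows "\<exists>n0. \<forall>n\<ge>n0. trig_corr c \<eta> I A n = 0"
proof -
  obtain n0 where n0: "\<forall>i\<in>I. \<forall>j\<in>I. \<forall>n\<ge>n0. \<eta> i + \<eta> j v* matrix_power A n \<noteq> 0"
    using frequency_gap(2)[of I \<eta>, OF assms] by blast
  have "trig_corr c \<eta> I A n = 0" if "n0 \<le> n" for n
    unfolding trig_corr_def using n0 that by (intro sum.neutral ballI) auto
  then show ?thesis by blast
qed

lemma trig_corr_sums:
  assumes "finite I" "\<And>i. i \<in> I \<Longrightarrow> \<eta> i \<noteq> 0"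
  shows "(\<lambda>m. trig_corr c \<eta> I A 0 + 2 * (\<Sum>n<m. trig_corr c \<eta> I A (Suc n))) \<longlonglongrightarrow> trig_variance c \<eta> I A"
proof -
  obtain n0 where n0: "\<And>n. n0 \<le> n \<Longrightarrow> trig_corr c \<eta> I A n = 0"
    using trig_corr_finite_support[of I \<eta> c, OF assms] by blast
  have "summable (\<lambda>n. trig_corr c \<eta> I A (Suc n))"
    by (rule summable_finite[of "{..<n0}"]) (auto intro!: n0)
  from summable_LIMSEQ[OF this] show ?thesis
    unfolding trig_variance_def by (intro tendsto_intros)
qed

text \<open>The product has the frequencies \<open>\<eta> i + \<eta> j v* A^n\<close>, pushed on by
  \<open>A^k\<close>. Those equal to 0 produce the main term exactly; the others have norm at least
  \<open>\<delta> * q ^ (k + n)\<close>, so the decay of the test function bounds them in terms of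
  the later of the two times.\<close>

lemma correlation_bound:
  assumes "finite I" "\<And>i. i \<in> I \<Longrightarrow> \<eta> i \<noteq> 0" and w: "test_fun w C"
  shows "\<exists>K\<ge>0. \<forall>k n. norm ((LINT x|lborel. complex_of_real (w x) *
             (trig_poly c \<eta> I (matrix_power A k *v x) * trig_poly c \<eta> I (matrix_power A (k + n) *v x)))
           - fourier_int w 0 * trig_corr c \<eta> I A n) \<le> K / q ^ (k + n)"
proof -
  obtain \<delta> where \<delta>: "\<delta> > 0" "\<And>i j n. i \<in> I \<Longrightarrow> j \<in> I \<Longrightarrow> \<eta> i + \<eta> j v* matrix_power A n \<noteq> 0 \<Longrightarrow>
           \<delta> * q ^ n \<le> norm (\<eta> i + \<eta> j v* matrix_power A n)"
    using frequency_gap(1)[of I \<eta>, OF assms(1,2)] by blast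
  have C: "0 \<le> C" using w by (simp add: test_fun_def)
  define K where "K = (\<Sum>i\<in>I. \<Sum>j\<in>I. norm (c i) * norm (c j) * (C / \<delta>))"
  have "0 \<le> K" unfolding K_def using C \<delta> by (intro sum_nonneg) auto
  moreover have "norm ((LINT x|lborel. complex_of_real (w x) *
             (trig_poly c \<eta> I (matrix_power A k *v x) * trig_poly c \<eta> I (matrix_power A (k + n) *v x)))
           - fourier_int w 0 * trig_corr c \<eta> I A n) \<le> K / q ^ (k + n)" for k n
  proof -
    define Z where "Z i j = \<eta> i v* matrix_power A k + \<eta> j v* matrix_power A (k + n)" for i j
    have Z: "Z i j = (\<eta> i + \<eta> j v* matrix_power A n) v* matrix_power A k" for i j
      unfolding Z_def add.commute[of k n] matrix_power_add
      by (simp add: vector_matrix_left_distrib vector_matrix_mul_assoc)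
    have eq: "(LINT x|lborel. complex_of_real (w x) *
             (trig_poly c \<eta> I (matrix_power A k *v x) * trig_poly c \<eta> I (matrix_power A (k + n) *v x)))
       = (\<Sum>i\<in>I. \<Sum>j\<in>I. c i * c j * fourier_int w (Z i j))"
      using w unfolding trig_poly_mult_vector trig_poly_mult Z_def
      by (subst integral_trig_poly) (auto simp: test_fun_def sum.cartesian_product case_prod_unfold)
    have tm: "norm (c i * c j * fourier_int w (Z i j)
           - fourier_int w 0 * (c i * c j * of_bool (\<eta> i + \<eta> j v* matrix_power A n = 0)))
        \<le> norm (c i) * norm (c j) * (C / \<delta>) / q ^ (k + n)" (is "?L \<le> _") if "i \<in> I" "j \<in> I" for i j
    proof (cases "\<eta> i + \<eta> j v* matrix_power A n = 0")
      case True
      then have "Z i j = 0" by (simp add: Z)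
      moreover have "0 \<le> norm (c i) * norm (c j) * (C / \<delta>) / q ^ (k + n)"
        using C \<delta>(1) q_gt_1 by simp
      ultimately show ?thesis using True by simp
    next
      case False
      then have nz: "Z i j \<noteq> 0" unfolding Z by (rule row_nonzero)
      have "q ^ k * (\<delta> * q ^ n) \<le> q ^ k * norm (\<eta> i + \<eta> j v* matrix_power A n)"
        using \<delta>(2)[OF that False] q_gt_1 by (intro mult_left_mono) auto
      also have "\<dots> \<le> norm (Z i j)" unfolding Z by (rule row_expands_power)
      finally have "\<delta> * q ^ (k + n) \<le> norm (Z i j)" by (simp add: power_add mult_ac)
      then have "C / norm (Z i j) \<le> C / (\<delta> * q ^ (k + n))"
        using C \<delta>(1) q_gt_1 by (intro divide_left_mono) (auto intro!: mult_pos_pos simp: nz)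
      moreover have "norm (fourier_int w (Z i j)) \<le> C / norm (Z i j)" using w nz by (simp add: test_fun_def)
      ultimately have "norm (fourier_int w (Z i j)) \<le> C / (\<delta> * q ^ (k + n))" by simp
      from mult_left_mono[OF this, of "norm (c i) * norm (c j)"] False show ?thesis
        by (simp add: norm_mult)
    qed
    have "norm ((\<Sum>i\<in>I. \<Sum>j\<in>I. c i * c j * fourier_int w (Z i j)) - fourier_int w 0 * trig_corr c \<eta> I A n)
       \<le> (\<Sum>i\<in>I. \<Sum>j\<in>I. norm (c i) * norm (c j) * (C / \<delta>) / q ^ (k + n))"
      unfolding trig_corr_def sum_distrib_left sum_subtractf[symmetric]
      by (intro sum_norm_le) (use tm in auto)
    also have "\<dots> = K / q ^ (k + n)" by (simp add: K_def sum_divide_distrib)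
    finally show ?thesis unfolding eq .
  qed
  ultimately show ?thesis by blast
qed

lemma integrable_trig_poly2:
  fixes B D :: "real^'d^'d"
  assumes "integrable lborel w"
  shows "integrable lborel (\<lambda>x. complex_of_real (w x) * (trig_poly c \<eta> I (B *v x) * trig_poly d \<zeta> J (D *v x)))"
  by (rule integrable_mult_bounded[OF assms])
     (auto simp: norm_mult intro!: mult_mono norm_trig_poly_le sum_nonneg)

proposition trig_second_moment:
  assumes fin: "finite I" "\<And>i. i \<in> I \<Longrightarrow> \<eta> i \<noteq> 0" and w: "test_fun w C"
  shows "(\<lambda>N. (LINT x|lborel. complex_of_real (w x) * (\<Sum>k<N. trig_poly c \<eta> I (matrix_power A k *v x))\<^sup>2) / of_nat N)
    \<longlonglongrightarrow> fourier_int w 0 * trig_variance c \<eta> I A"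
proof -
  have wi: "integrable lborel w" using w by (simp add: test_fun_def)
  define P where "P k x = trig_poly c \<eta> I (matrix_power A k *v x)" for k x
  define a where "a k l = (LINT x|lborel. complex_of_real (w x) * (P k x * P l x))" for k l
  define r where "r = trig_corr c \<eta> I A"
  define w0 where "w0 = fourier_int w 0"
  obtain K where K: "0 \<le> K" "\<And>k n. norm (a k (k + n) - w0 * r n) \<le> K / q ^ (k + n)"
    using correlation_bound[of I \<eta> w C c, OF fin w] unfolding a_def P_def r_def w0_def by blast
  have int: "integrable lborel (\<lambda>x. complex_of_real (w x) * (P k x * P l x))" for k l
    unfolding P_def by (rule integrable_trig_poly2[OF wi])
  define D where "D m = a m m + 2 * (\<Sum>k<m. a k m)" for m
  have D: "(LINT x|lborel. complex_of_real (w x) * (\<Sum>k<N. P k x)\<^sup>2) = (\<Sum>m<N. D m)" for N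
  proof -
    have "(LINT x|lborel. complex_of_real (w x) * (\<Sum>k<N. P k x)\<^sup>2)
        = (LINT x|lborel. (\<Sum>m<N. complex_of_real (w x) * (P m x * P m x)
             + 2 * (\<Sum>k<m. complex_of_real (w x) * (P k x * P m x))))"
      by (simp only: square_sum_by_max sum_distrib_left distrib_left mult.left_commute[of "complex_of_real (w x)" 2 for x])
    also have "\<dots> = (\<Sum>m<N. (LINT x|lborel. complex_of_real (w x) * (P m x * P m x)
             + 2 * (\<Sum>k<m. complex_of_real (w x) * (P k x * P m x))))"
      by (intro Bochner_Integration.integral_sum Bochner_Integration.integrable_add integrable_mult_right
           Bochner_Integration.integrable_sum int)
    also have "\<dots> = (\<Sum>m<N. D m)"
      unfolding D_def a_def
      by (intro sum.cong refl, subst Bochner_Integration.integral_add)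
         (auto intro!: int simp: Bochner_Integration.integral_sum[OF int])
    finally show ?thesis .
  qed
  \<comment> \<open>All covariances with later time \<open>m\<close> carry an error of at most
    \<open>K / q ^ m\<close>. Their number grows only linearly in \<open>m\<close>, so the total
    error in \<open>D m\<close> still tends to 0.\<close>
  have "(\<lambda>m. D m - w0 * (r 0 + 2 * (\<Sum>n<m. r (Suc n)))) \<longlonglongrightarrow> 0"
  proof (rule Lim_null_comparison[OF always_eventually power_over_tendsto_0[OF q_gt_1, of "2 * K"]], rule allI)
    fix m
    have e: "(\<Sum>k<m. a k m - w0 * r (m - k)) = (\<Sum>k<m. a k m) - w0 * (\<Sum>n<m. r (Suc n))"
      using sum.nat_diff_reindex[of "\<lambda>n. r (Suc n)" m]
      by (simp add: sum_subtractf sum_distrib_left[symmetric] Suc_diff_Suc)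
    have "D m - w0 * (r 0 + 2 * (\<Sum>n<m. r (Suc n))) = (a m m - w0 * r 0) + 2 * (\<Sum>k<m. a k m - w0 * r (m - k))"
      unfolding D_def e by (simp add: algebra_simps)
    also have "norm \<dots> \<le> norm (a m m - w0 * r 0) + 2 * (\<Sum>k<m. norm (a k m - w0 * r (m - k)))"
      by (rule norm_triangle_le) (simp add: norm_mult norm_sum)
    also have "\<dots> \<le> K / q ^ m + 2 * (\<Sum>k<m. K / q ^ m)"
    proof (intro add_mono mult_left_mono sum_mono)
      show "norm (a m m - w0 * r 0) \<le> K / q ^ m" using K(2)[of m 0] by simp
      show "norm (a k m - w0 * r (m - k)) \<le> K / q ^ m" if "k \<in> {..<m}" for k
        using K(2)[of k "m - k"] that by simp
    qed simp
    also have "\<dots> \<le> 2 * K * real (Suc m) / q ^ m"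
      using K(1) q_gt_1 by (simp add: field_simps)
    finally show "norm (D m - w0 * (r 0 + 2 * (\<Sum>n<m. r (Suc n)))) \<le> 2 * K * real (Suc m) / q ^ m" .
  qed
  moreover have "(\<lambda>m. w0 * (r 0 + 2 * (\<Sum>n<m. r (Suc n)))) \<longlonglongrightarrow> w0 * trig_variance c \<eta> I A"
    unfolding r_def by (intro tendsto_mult_left trig_corr_sums fin)
  ultimately have "D \<longlonglongrightarrow> w0 * trig_variance c \<eta> I A"
    using tendsto_add by fastforce
  from cesaro_mean[OF this] show ?thesis
    unfolding P_def[symmetric] D w0_def by (simp add: scaleR_conv_of_real field_simps)
qed

end

section \<open>Riesz products\<close>

text \<open>This is \<open>1 + y^2 \<le> exp (y^2)\<close> after taking square roots. Factors of
  modulus at most 1 are what the factorwise comparison of long products needs.\<close>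

lemma norm_one_plus_i_exp_le:
  "norm ((1 + \<i> * complex_of_real y) * exp (- complex_of_real (y\<^sup>2 / 2))) \<le> 1"
proof -
  have "norm (1 + \<i> * complex_of_real y) = sqrt (1 + y\<^sup>2)"
    by (simp add: cmod_def)
  also have "\<dots> \<le> sqrt (exp (y\<^sup>2))"
    using exp_ge_add_one_self[of "y\<^sup>2"] by (intro real_sqrt_le_mono) simp
  also have "\<dots> = exp (y\<^sup>2 / 2)"
    by (rule real_sqrt_unique) (simp_all add: power2_eq_square exp_add[symmetric])
  finally have "norm (1 + \<i> * complex_of_real y) \<le> exp (y\<^sup>2 / 2)" .
  then have "norm (1 + \<i> * complex_of_real y) * exp (- (y\<^sup>2 / 2)) \<le> exp (y\<^sup>2 / 2) * exp (- (y\<^sup>2 / 2))"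
    by (intro mult_right_mono) auto
  moreover have "exp (- complex_of_real (y\<^sup>2 / 2)) = complex_of_real (exp (- (y\<^sup>2 / 2)))"
    by (metis exp_of_real of_real_minus)
  ultimately show ?thesis unfolding norm_mult by (simp add: norm_inverse exp_minus)
qed

text \<open>The reciprocal of the quadratic Taylor bound for \<open>exp z\<close> lies below the
  claimed polynomial, because the two quadratics multiply to \<open>1 + z^4 / 4\<close>.\<close>

lemma exp_minus_le_quadratic: "0 \<le> z \<Longrightarrow> exp (- z) \<le> 1 - z + z\<^sup>2 / 2" for z :: real
proof -
  assume z: "0 \<le> z"
  have p: "0 < 1 + z + z\<^sup>2 / 2" using z by (simp add: add_pos_nonneg)
  have "(1 + z + z\<^sup>2 / 2) * (1 - z + z\<^sup>2 / 2) = 1 + z ^ 4 / 4"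
    by (simp add: field_simps power2_eq_square power4_eq_xxxx)
  then have "1 \<le> (1 + z + z\<^sup>2 / 2) * (1 - z + z\<^sup>2 / 2)" by simp
  then have "1 / (1 + z + z\<^sup>2 / 2) \<le> 1 - z + z\<^sup>2 / 2" using p by (simp add: divide_le_eq mult.commute)
  moreover have "1 / exp z \<le> 1 / (1 + z + z\<^sup>2 / 2)"
    using exp_lower_Taylor_quadratic[OF z] p by (intro divide_left_mono) auto
  ultimately show ?thesis by (simp add: exp_minus inverse_eq_divide)
qed

text \<open>Both expressions agree to second order. The cubic error collects the Taylor remainder of
  \<open>cis\<close>, that of the real exponential, and the cross term \<open>y * z\<close> which
  appears when \<open>1 + i y\<close> meets \<open>1 - z\<close>.\<close>

lemma cis_approx:
  assumes "\<bar>y\<bar> \<le> 1"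
  shows "norm (cis y - (1 + \<i> * complex_of_real y) * exp (- complex_of_real (y\<^sup>2 / 2))) \<le> 2 * \<bar>y\<bar> ^ 3"
proof -
  define z where "z = y\<^sup>2 / 2"
  have z: "0 \<le> z" "z \<le> 1" using assms by (auto simp: z_def abs_square_le_1[symmetric])
  have 1: "norm (cis y - (1 + \<i> * complex_of_real y - complex_of_real z)) \<le> \<bar>y\<bar> ^ 3 / 6"
    using iexp_approx1[of y 2] by (simp add: cis_conv_exp numeral_eq_Suc z_def power2_eq_square algebra_simps)
  have exp2: "\<bar>exp (- z) - (1 - z)\<bar> \<le> z\<^sup>2 / 2"
    using exp_minus_le_quadratic[OF z(1)] exp_ge_add_one_self[of "- z"] by simp
  have "norm ((1 + \<i> * complex_of_real y) * complex_of_real (exp (- z) - (1 - z))) \<le> 2 * (z\<^sup>2 / 2)"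
    unfolding norm_mult norm_of_real
  proof (intro mult_mono exp2)
    show "norm (1 + \<i> * complex_of_real y) \<le> 2"
      by (rule order_trans[OF norm_triangle_ineq]) (use assms in \<open>simp add: norm_mult\<close>)
  qed auto
  also have "2 * (z\<^sup>2 / 2) = \<bar>y\<bar> ^ 3 * \<bar>y\<bar> / 4" by (simp add: z_def power2_eq_square power3_eq_cube)
  also have "\<dots> \<le> \<bar>y\<bar> ^ 3 / 4" using assms by (intro divide_right_mono mult_left_le) auto
  finally have 2: "norm ((1 + \<i> * complex_of_real y) * complex_of_real (exp (- z) - (1 - z))) \<le> \<bar>y\<bar> ^ 3 / 4" .
  have 3: "norm (\<i> * complex_of_real (y * z)) \<le> \<bar>y\<bar> ^ 3 / 2"
    by (simp add: norm_mult abs_mult z_def power2_eq_square power3_eq_cube)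
  have "cis y - (1 + \<i> * complex_of_real y) * exp (- complex_of_real z)
      = (cis y - (1 + \<i> * complex_of_real y - complex_of_real z))
        - (1 + \<i> * complex_of_real y) * complex_of_real (exp (- z) - (1 - z)) + \<i> * complex_of_real (y * z)"
    by (simp add: exp_of_real[symmetric] algebra_simps)
  also have "norm \<dots> \<le> \<bar>y\<bar> ^ 3 / 6 + \<bar>y\<bar> ^ 3 / 4 + \<bar>y\<bar> ^ 3 / 2"
  proof -
    have "norm (a - b + c) \<le> norm a + norm b + norm c" for a b c :: complex by norm
    then show ?thesis by (rule order_trans) (intro add_mono 1 2 3)
  qed
  also have "\<dots> \<le> 2 * \<bar>y\<bar> ^ 3" by simp
  finally show ?thesis by (simp add: z_def)
qed

lemma tendsto_0_if_norm_le:
  fixes a :: "nat \<Rightarrow> 'a::real_normed_vector"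
  assumes "\<And>n. norm (a n) \<le> b n" "b \<longlonglongrightarrow> 0" shows "a \<longlonglongrightarrow> 0"
  by (rule Lim_null_comparison[OF always_eventually assms(2)]) (use assms(1) in auto)

context expanding_matrix
begin

text \<open>Each factor \<open>exp (i \<tau> Y)\<close> along the orbit is replaced by its linear
  part, which keeps the product a finite sum of waves whenever \<open>Y\<close> is a trigonometric
  polynomial.\<close>

definition riesz_prod :: "real \<Rightarrow> (real^'d \<Rightarrow> complex) \<Rightarrow> nat \<Rightarrow> real^'d \<Rightarrow> complex" where
  "riesz_prod \<tau> Y n x = (\<Prod>j<n. 1 + \<i> * complex_of_real \<tau> * Y (matrix_power A j *v x))"

lemma riesz_prod_measurable [measurable]:
  assumes [measurable]: "Y \<in> borel_measurable borel"
  shows "riesz_prod \<tau> Y n \<in> borel_measurable borel"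
proof -
  have [measurable]: "(\<lambda>x. Y (matrix_power A j *v x)) \<in> borel_measurable borel" for j
    by (rule measurable_compose[OF mult_vector_measurable assms])
  show ?thesis unfolding riesz_prod_def by measurable
qed

lemma norm_riesz_prod_le:
  assumes "\<And>x. norm (Y x) \<le> M"
  shows "norm (riesz_prod \<tau> Y n x) \<le> (1 + \<bar>\<tau>\<bar> * M) ^ n"
proof -
  have "norm (riesz_prod \<tau> Y n x) = (\<Prod>j<n. norm (1 + \<i> * complex_of_real \<tau> * Y (matrix_power A j *v x)))"
    by (simp add: riesz_prod_def prod_norm)
  also have "\<dots> \<le> (\<Prod>j<n. 1 + \<bar>\<tau>\<bar> * M)"
  proof (intro prod_mono conjI norm_ge_zero)
    fix j
    have "norm (1 + \<i> * complex_of_real \<tau> * Y (matrix_power A j *v x)) \<le> 1 + \<bar>\<tau>\<bar> * norm (Y (matrix_power A j *v x))"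
      by (rule order_trans[OF norm_triangle_ineq]) (simp add: norm_mult)
    also have "\<dots> \<le> 1 + \<bar>\<tau>\<bar> * M" using assms by (intro add_left_mono mult_left_mono) auto
    finally show "norm (1 + \<i> * complex_of_real \<tau> * Y (matrix_power A j *v x)) \<le> 1 + \<bar>\<tau>\<bar> * M" .
  qed
  finally show ?thesis by simp
qed

text \<open>Peeling off the last factor gives a recursion in \<open>n\<close> for the Fourier
  integrals of the product: the frequency either stays or moves by one of the rows
  \<open>\<eta> i v* A^n\<close>.\<close>

lemma riesz_prod_wave_expand:
  assumes \<phi>: "integrable lborel \<phi>"
  shows "(LINT x|lborel. complex_of_real (\<phi> x) * (riesz_prod \<tau> (trig_poly c \<eta> I) (Suc n) x * wave \<theta> x))
     = (LINT x|lborel. complex_of_real (\<phi> x) * (riesz_prod \<tau> (trig_poly c \<eta> I) n x * wave \<theta> x))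
      + \<i> * complex_of_real \<tau> * (\<Sum>i\<in>I. c i * (LINT x|lborel. complex_of_real (\<phi> x) *
           (riesz_prod \<tau> (trig_poly c \<eta> I) n x * wave (\<theta> + \<eta> i v* matrix_power A n) x)))"
proof -
  let ?T = "riesz_prod \<tau> (trig_poly c \<eta> I)"
  have int: "integrable lborel (\<lambda>x. complex_of_real (\<phi> x) * (?T n x * wave \<zeta> x))" for \<zeta>
    by (rule integrable_mult_bounded[OF \<phi>, where K = "(1 + \<bar>\<tau>\<bar> * (\<Sum>i\<in>I. norm (c i))) ^ n"])
       (auto simp: norm_mult intro!: norm_riesz_prod_le norm_trig_poly_le)
  have "complex_of_real (\<phi> x) * (?T (Suc n) x * wave \<theta> x)
     = complex_of_real (\<phi> x) * (?T n x * wave \<theta> x)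
      + \<i> * complex_of_real \<tau> * (\<Sum>i\<in>I. c i * (complex_of_real (\<phi> x) *
           (?T n x * wave (\<theta> + \<eta> i v* matrix_power A n) x)))" for x
    by (simp add: riesz_prod_def trig_poly_def wave_mult_vector wave_add sum_distrib_left sum_distrib_right
         algebra_simps)
  then show ?thesis
    by (simp add: Bochner_Integration.integral_add Bochner_Integration.integral_sum int)
qed

text \<open>
  A frequency \<open>v A\<^sup>n\<close> with \<open>|v| \<ge> 2B\<close> dominates everything in the product up to index \<open>n\<close>, so that
  the induction needs no description of the frequencies of the product.
\<close>

lemma riesz_prod_fourier_bound:
  assumes \<phi>: "test_fun \<phi> C" and "finite I" and q8: "8 \<le> q" and B: "0 < B"
    and u: "\<And>i. i \<in> I \<Longrightarrow> \<eta> i = u i v* A \<and> norm (u i) \<le> B"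
    and \<tau>: "\<bar>\<tau>\<bar> * (\<Sum>i\<in>I. norm (c i)) \<le> 1" and v: "2 * B \<le> norm v"
  shows "norm (LINT x|lborel. complex_of_real (\<phi> x) *
           (riesz_prod \<tau> (trig_poly c \<eta> I) n x * wave (v v* matrix_power A n) x)) \<le> C / norm v * (1 / 2) ^ n"
  using v
proof (induction n arbitrary: v)
  case 0
  then have "v \<noteq> 0" using B by auto
  then show ?case using \<phi> by (simp add: riesz_prod_def test_fun_def fourier_int_def[symmetric])
next
  case (Suc n)
  let ?L = "\<lambda>n \<theta>. LINT x|lborel. complex_of_real (\<phi> x) * (riesz_prod \<tau> (trig_poly c \<eta> I) n x * wave \<theta> x)"
  have C: "0 \<le> C" using \<phi> by (simp add: test_fun_def)
  have nv: "0 < norm v" using Suc.prems B by linarith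
  \<comment> \<open>A perturbation of norm at most \<open>B\<close> costs at most half of
    \<open>norm v\<close>, and one application of \<open>A\<close> gains a factor 8, hence the net
    \<open>1 / 4\<close>. The recursion multiplies by at most \<open>1 + 1\<close>, which leaves the
    \<open>1 / 2\<close> of the claim.\<close>
  define b where "b = C / norm v * (1 / 4) * (1 / 2) ^ n"
  have key: "norm (?L n ((v + z) v* matrix_power A (Suc n))) \<le> b" if "norm z \<le> B" for z
  proof -
    have "norm v \<le> norm (v + z) + norm z" using norm_triangle_ineq[of "v + z" "- z"] by simp
    then have "norm v / 2 \<le> norm (v + z)" using that Suc.prems by linarith
    then have "8 * (norm v / 2) \<le> q * norm (v + z)" using q8 by (intro mult_mono) auto
    also have "\<dots> \<le> norm ((v + z) v* A)" by (rule row_expands)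
    finally have big: "4 * norm v \<le> norm ((v + z) v* A)" by simp
    have "norm (?L n (((v + z) v* A) v* matrix_power A n)) \<le> C / norm ((v + z) v* A) * (1 / 2) ^ n"
      using big Suc.prems nv by (intro Suc.IH) linarith
    also have "\<dots> \<le> C / (4 * norm v) * (1 / 2) ^ n"
    proof -
      have "0 < norm ((v + z) v* A)" using big nv by linarith
      then show ?thesis using big nv C by (intro mult_right_mono divide_left_mono mult_pos_pos) auto
    qed
    finally show ?thesis by (simp add: vector_matrix_mul_assoc b_def)
  qed
  \<comment> \<open>Writing \<open>\<eta> i\<close> as \<open>u i v* A\<close> raises its power from
    \<open>n\<close> to \<open>Suc n\<close>, so that the shift amounts to perturbing
    \<open>v\<close> by the short row \<open>u i\<close>.\<close>
  have shift: "v v* matrix_power A (Suc n) + \<eta> i v* matrix_power A n = (v + u i) v* matrix_power A (Suc n)"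
    if "i \<in> I" for i
    using u[OF that] by (simp add: vector_matrix_left_distrib vector_matrix_mul_assoc)
  have "?L (Suc n) (v v* matrix_power A (Suc n)) = ?L n (v v* matrix_power A (Suc n))
     + \<i> * complex_of_real \<tau> * (\<Sum>i\<in>I. c i * ?L n ((v + u i) v* matrix_power A (Suc n)))"
    using \<phi> shift by (subst riesz_prod_wave_expand) (auto simp: test_fun_def simp del: matrix_power.simps)
  also have "norm \<dots> \<le> b + \<bar>\<tau>\<bar> * (\<Sum>i\<in>I. norm (c i) * b)"
  proof (intro norm_triangle_mono)
    show "norm (?L n (v v* matrix_power A (Suc n))) \<le> b" using key[of 0] B by simp
    have "norm (\<Sum>i\<in>I. c i * ?L n ((v + u i) v* matrix_power A (Suc n))) \<le> (\<Sum>i\<in>I. norm (c i) * b)"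
      using key u by (intro sum_norm_le) (auto simp: norm_mult simp del: matrix_power.simps intro!: mult_left_mono)
    then show "norm (\<i> * complex_of_real \<tau> * (\<Sum>i\<in>I. c i * ?L n ((v + u i) v* matrix_power A (Suc n))))
        \<le> \<bar>\<tau>\<bar> * (\<Sum>i\<in>I. norm (c i) * b)"
      by (simp add: norm_mult mult_left_mono del: matrix_power.simps)
  qed
  also have "\<dots> = (1 + \<bar>\<tau>\<bar> * (\<Sum>i\<in>I. norm (c i))) * b"
    unfolding sum_distrib_right[symmetric] by (simp add: algebra_simps)
  also have "\<dots> \<le> 2 * b"
    using \<tau> C nv by (intro mult_right_mono) (auto simp: b_def)
  also have "\<dots> = C / norm v * (1 / 2) ^ Suc n" by (simp add: b_def)
  finally show ?case .
qed

text \<open>Telescoping in the number of factors. A new factor contributes only the frequencies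
  \<open>\<eta> i v* A^n\<close>; as \<open>\<eta> i\<close> has norm at least \<open>2 * B\<close>,
  the previous bound applies and the increments form a geometric series. The result is uniform in
  \<open>n\<close> and vanishes with \<open>\<tau>\<close>.\<close>

lemma riesz_prod_mean:
  assumes \<phi>: "test_fun \<phi> C" and "finite I" and q8: "8 \<le> q" and B: "0 < B"
    and u: "\<And>i. i \<in> I \<Longrightarrow> \<eta> i = u i v* A \<and> norm (u i) \<le> B" and big: "\<And>i. i \<in> I \<Longrightarrow> 2 * B \<le> norm (\<eta> i)"
    and \<tau>: "\<bar>\<tau>\<bar> * (\<Sum>i\<in>I. norm (c i)) \<le> 1"
  shows "norm ((LINT x|lborel. complex_of_real (\<phi> x) * riesz_prod \<tau> (trig_poly c \<eta> I) n x)
            - complex_of_real (LINT x|lborel. \<phi> x)) \<le> \<bar>\<tau>\<bar> * (\<Sum>i\<in>I. norm (c i)) * (C / B)"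
proof -
  let ?L = "\<lambda>n \<theta>. LINT x|lborel. complex_of_real (\<phi> x) * (riesz_prod \<tau> (trig_poly c \<eta> I) n x * wave \<theta> x)"
  define M where "M = \<bar>\<tau>\<bar> * (\<Sum>i\<in>I. norm (c i))"
  have C: "0 \<le> C" using \<phi> by (simp add: test_fun_def)
  have M: "0 \<le> M" by (simp add: M_def sum_nonneg)
  have step: "norm (?L (Suc n) 0 - ?L n 0) \<le> M * (C / (2 * B)) * (1 / 2) ^ n" for n
  proof -
    have "?L (Suc n) 0 - ?L n 0 = \<i> * complex_of_real \<tau> * (\<Sum>i\<in>I. c i * ?L n (\<eta> i v* matrix_power A n))"
      using \<phi> by (subst riesz_prod_wave_expand) (auto simp: test_fun_def)
    also have "norm \<dots> \<le> \<bar>\<tau>\<bar> * (\<Sum>i\<in>I. norm (c i) * (C / (2 * B) * (1 / 2) ^ n))"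
    proof -
      have "norm (?L n (\<eta> i v* matrix_power A n)) \<le> C / (2 * B) * (1 / 2) ^ n" if "i \<in> I" for i
      proof -
        have "norm (?L n (\<eta> i v* matrix_power A n)) \<le> C / norm (\<eta> i) * (1 / 2) ^ n"
          by (rule riesz_prod_fourier_bound[OF \<phi> \<open>finite I\<close> q8 B u \<tau> big[OF that]])
        also have "\<dots> \<le> C / (2 * B) * (1 / 2) ^ n"
        proof -
          have "0 < norm (\<eta> i)" using big[OF that] B by linarith
          then show ?thesis using big[OF that] B C by (intro mult_right_mono divide_left_mono) (auto intro: mult_pos_pos)
        qed
        finally show ?thesis .
      qed
      then have "norm (\<Sum>i\<in>I. c i * ?L n (\<eta> i v* matrix_power A n)) \<le> (\<Sum>i\<in>I. norm (c i) * (C / (2 * B) * (1 / 2) ^ n))"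
        unfolding norm_mult[of "c _"] by (intro sum_norm_le) (simp only: norm_mult, intro mult_left_mono, auto)
      then show ?thesis by (simp add: norm_mult mult_left_mono)
    qed
    finally show ?thesis unfolding M_def sum_distrib_right[symmetric] by (simp add: mult.assoc)
  qed
  have "norm (?L n 0 - ?L 0 0) \<le> (\<Sum>k<n. M * (C / (2 * B)) * (1 / 2) ^ k)"
  proof (induction n)
    case (Suc n)
    then show ?case using step[of n] norm_triangle_ineq[of "?L (Suc n) 0 - ?L n 0" "?L n 0 - ?L 0 0"] by simp
  qed simp
  also have "\<dots> = M * (C / (2 * B)) * (\<Sum>k<n. (1 / 2) ^ k)" by (simp add: sum_distrib_left)
  also have "\<dots> \<le> M * (C / (2 * B)) * 2"
    using M C B by (intro mult_left_mono) (auto simp: sum_gp_strict intro!: mult_nonneg_nonneg)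
  finally show ?thesis by (simp add: M_def riesz_prod_def)
qed

end

section \<open>Lacunary trigonometric sums\<close>

lemma integrable_weight_bounded:
  fixes u :: "'a \<Rightarrow> real"
  assumes "integrable M w" and [measurable]: "u \<in> borel_measurable M" and "\<And>x. \<bar>u x\<bar> \<le> K"
  shows "integrable M (\<lambda>x. w x * u x)"
proof (rule Bochner_Integration.integrable_bound[of M "\<lambda>x. K * \<bar>w x\<bar>"])
  have [measurable]: "w \<in> borel_measurable M" using assms(1) by auto
  show "integrable M (\<lambda>x. K * \<bar>w x\<bar>)" using assms(1) by auto
  show "(\<lambda>x. w x * u x) \<in> borel_measurable M" by measurable
  show "AE x in M. norm (w x * u x) \<le> norm (K * \<bar>w x\<bar>)"
  proof (rule AE_I2)
    fix x
    have "\<bar>w x\<bar> * \<bar>u x\<bar> \<le> \<bar>w x\<bar> * \<bar>K\<bar>" using assms(3)[of x] by (intro mult_left_mono) auto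
    then show "norm (w x * u x) \<le> norm (K * \<bar>w x\<bar>)" by (simp add: abs_mult mult.commute)
  qed
qed

lemma weighted_product_integrable:
  fixes u v w :: "'a \<Rightarrow> real"
  assumes [measurable]: "u \<in> borel_measurable M" "v \<in> borel_measurable M" "w \<in> borel_measurable M"
    and w: "\<And>x. 0 \<le> w x"
    and u: "integrable M (\<lambda>x. w x * (u x)\<^sup>2)" and v: "integrable M (\<lambda>x. w x * (v x)\<^sup>2)"
  shows "integrable M (\<lambda>x. w x * (u x * v x))"
proof (rule Bochner_Integration.integrable_bound[of M "\<lambda>x. w x * (u x)\<^sup>2 + w x * (v x)\<^sup>2"])
  show "AE x in M. norm (w x * (u x * v x)) \<le> norm (w x * (u x)\<^sup>2 + w x * (v x)\<^sup>2)"
  proof (rule AE_I2)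
    fix x
    have "\<bar>u x * v x\<bar> \<le> (u x)\<^sup>2 + (v x)\<^sup>2"
    proof -
      have "2 * \<bar>u x\<bar> * \<bar>v x\<bar> \<le> (u x)\<^sup>2 + (v x)\<^sup>2"
        using sum_squares_bound[of "\<bar>u x\<bar>" "\<bar>v x\<bar>"] by simp
      moreover have "0 \<le> \<bar>u x\<bar> * \<bar>v x\<bar>" by simp
      ultimately show ?thesis unfolding abs_mult by linarith
    qed
    from mult_left_mono[OF this w[of x]] w[of x] show "norm (w x * (u x * v x)) \<le> norm (w x * (u x)\<^sup>2 + w x * (v x)\<^sup>2)"
      by (simp add: abs_mult distrib_left)
  qed
qed (use u v in auto)

lemma weighted_Cauchy_Schwarz:
  fixes u v w :: "'a \<Rightarrow> real"
  assumes meas: "u \<in> borel_measurable M" "v \<in> borel_measurable M" "w \<in> borel_measurable M"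
    and w: "\<And>x. 0 \<le> w x"
    and u: "integrable M (\<lambda>x. w x * (u x)\<^sup>2)" and v: "integrable M (\<lambda>x. w x * (v x)\<^sup>2)"
  shows "\<bar>LINT x|M. w x * (u x * v x)\<bar> \<le> sqrt (LINT x|M. w x * (u x)\<^sup>2) * sqrt (LINT x|M. w x * (v x)\<^sup>2)"
proof -
  define U V I where "U = (LINT x|M. w x * (u x)\<^sup>2)" and "V = (LINT x|M. w x * (v x)\<^sup>2)"
    and "I = (LINT x|M. w x * (u x * v x))"
  have uv: "integrable M (\<lambda>x. w x * (u x * v x))"
    by (rule weighted_product_integrable[OF meas w u v])
  have quad: "0 \<le> U - 2 * s * I + s\<^sup>2 * V" for s
  proof -
    have "0 \<le> (LINT x|M. w x * (u x - s * v x)\<^sup>2)" using w by (intro Bochner_Integration.integral_nonneg) auto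
    also have "\<dots> = (LINT x|M. w x * (u x)\<^sup>2 - (2 * s) * (w x * (u x * v x)) + s\<^sup>2 * (w x * (v x)\<^sup>2))"
      by (rule Bochner_Integration.integral_cong) (auto simp: power2_eq_square algebra_simps)
    also have "\<dots> = U - 2 * s * I + s\<^sup>2 * V"
      unfolding U_def V_def I_def using u v uv by simp
    finally show ?thesis .
  qed
  have UV: "0 \<le> U" "0 \<le> V" unfolding U_def V_def using w by (auto intro!: Bochner_Integration.integral_nonneg)
  have "I\<^sup>2 \<le> U * V"
  proof (cases "V = 0")
    case True
    have "I = 0"
    proof (rule ccontr)
      assume "I \<noteq> 0"
      \<comment> \<open>For \<open>V = 0\<close> the quadratic is affine in \<open>s\<close>, and
        this choice gives it the value -1.\<close>
      with quad[of "(U + 1) / (2 * I)"] True show False by simp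
    qed
    then show ?thesis using UV by simp
  next
    case False
    have "0 \<le> U - 2 * (I / V) * I + (I / V)\<^sup>2 * V" by (rule quad)
    also have "\<dots> = U - I\<^sup>2 / V" using False by (simp add: power2_eq_square)
    finally show ?thesis using False UV by (simp add: field_simps)
  qed
  then have "\<bar>I\<bar> \<le> sqrt (U * V)" by (metis real_sqrt_abs real_sqrt_le_mono)
  then show ?thesis by (simp add: U_def V_def I_def real_sqrt_mult)
qed

lemma weighted_L1_le_L2:
  fixes u w :: "'a \<Rightarrow> real"
  assumes "u \<in> borel_measurable M" and wi: "integrable M w" and w: "\<And>x. 0 \<le> w x"
    and u: "integrable M (\<lambda>x. w x * (u x)\<^sup>2)"
  shows "integrable M (\<lambda>x. w x * \<bar>u x\<bar>)"
    and "(LINT x|M. w x * \<bar>u x\<bar>) \<le> sqrt (LINT x|M. w x) * sqrt (LINT x|M. w x * (u x)\<^sup>2)"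
proof -
  have meas [measurable]: "w \<in> borel_measurable M" "u \<in> borel_measurable M" by (rule borel_measurable_integrable[OF wi], rule assms(1))
  show "integrable M (\<lambda>x. w x * \<bar>u x\<bar>)"
    using weighted_product_integrable[of "\<lambda>_. 1" M "\<lambda>x. \<bar>u x\<bar>" w] w wi u by simp
  show "(LINT x|M. w x * \<bar>u x\<bar>) \<le> sqrt (LINT x|M. w x) * sqrt (LINT x|M. w x * (u x)\<^sup>2)"
    using weighted_Cauchy_Schwarz[of "\<lambda>_. 1" M "\<lambda>x. \<bar>u x\<bar>" w] w wi u by simp
qed

text \<open>The variance and the mean square are defined as complex sums. That they are real and
  nonnegative is read off from their being limits of second moments, up to the positive mass of the
  weight.\<close>

lemma nonneg_real_limit:
  assumes "(\<lambda>n. complex_of_real (r n)) \<longlonglongrightarrow> complex_of_real m * z" and "\<And>n. 0 \<le> r n" and "0 < m"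
  shows "z = complex_of_real (Re z)" "0 \<le> Re z"
proof -
  have "Im (complex_of_real m * z) = 0"
    using tendsto_Im[OF assms(1)] by (simp add: LIMSEQ_const_iff)
  then show "z = complex_of_real (Re z)" using \<open>0 < m\<close> by (simp add: complex_eq_iff)
  have "0 \<le> Re (complex_of_real m * z)"
    using tendsto_Re[OF assms(1)] assms(2) by (intro LIMSEQ_le_const) auto
  then show "0 \<le> Re z" using \<open>0 < m\<close> by (simp add: zero_le_mult_iff)
qed

lemma cis_sum: "cis (\<Sum>j\<in>J. y j) = (\<Prod>j\<in>J. cis (y j))"
  by (induction J rule: infinite_finite_induct) (auto simp: cis_mult[symmetric])

text \<open>The weight is part of the setting, so that all L2 estimates refer to the same measure
  and every density below \<open>w\<close> inherits them. Matrix and frequencies vary: the same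
  locale is later instantiated with powers of \<open>A\<close> and with block sums.\<close>

locale trig_system = expanding_matrix A q for A :: "real^'d^'d" and q :: real +
  fixes c :: "'i \<Rightarrow> complex" and \<eta> :: "'i \<Rightarrow> real^'d" and I :: "'i set" and g :: "real^'d \<Rightarrow> real"
    and w :: "real^'d \<Rightarrow> real" and C :: real
  assumes fin: "finite I" and nz: "\<And>i. i \<in> I \<Longrightarrow> \<eta> i \<noteq> 0"
    and real: "\<And>x. trig_poly c \<eta> I x = complex_of_real (g x)"
    and w_test: "test_fun w C" and w_nonneg: "\<And>x. 0 \<le> w x" and w_pos: "0 < (LINT x|lborel. w x)"
begin

lemma g_measurable [measurable]: "g \<in> borel_measurable borel"
proof -
  have "g = (\<lambda>x. Re (trig_poly c \<eta> I x))" by (simp add: real)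
  then show ?thesis by simp
qed

lemma g_bound: "\<bar>g x\<bar> \<le> (\<Sum>i\<in>I. norm (c i))"
  using norm_trig_poly_le[of c \<eta> I x] by (simp add: real)

lemma w_integrable: "integrable lborel w"
  using w_test by (simp add: test_fun_def)

definition part_sum :: "nat \<Rightarrow> real^'d \<Rightarrow> real" where
  "part_sum N x = (\<Sum>k<N. g (matrix_power A k *v x))"

lemma part_sum_measurable [measurable]: "part_sum N \<in> borel_measurable borel"
  unfolding part_sum_def by measurable

lemma part_sum_bound: "\<bar>part_sum N x\<bar> \<le> real N * (\<Sum>i\<in>I. norm (c i))"
proof -
  have "\<bar>part_sum N x\<bar> \<le> (\<Sum>k<N. (\<Sum>i\<in>I. norm (c i)))"
    unfolding part_sum_def by (rule order_trans[OF sum_abs]) (intro sum_mono g_bound)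
  then show ?thesis by simp
qed

lemma integrable_bounded_square:
  assumes [measurable]: "u \<in> borel_measurable borel" and "\<And>x. \<bar>u x\<bar> \<le> K"
  shows "integrable lborel (\<lambda>x. w x * (u x)\<^sup>2)"
proof (rule integrable_weight_bounded[OF w_integrable])
  show "\<bar>(u x)\<^sup>2\<bar> \<le> K\<^sup>2" for x using power_mono[OF assms(2)[of x], of 2] by simp
qed simp

lemma part_sum_square_integrable: "integrable lborel (\<lambda>x. w x * (part_sum N x)\<^sup>2)"
  by (rule integrable_bounded_square[OF _ part_sum_bound]) simp

lemma second_moment_complex:
  "(\<lambda>N. complex_of_real ((LINT x|lborel. w x * (part_sum N x)\<^sup>2) / real N))
     \<longlonglongrightarrow> complex_of_real (LINT x|lborel. w x) * trig_variance c \<eta> I A"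
proof -
  have "complex_of_real (LINT x|lborel. w x * (part_sum N x)\<^sup>2)
     = (LINT x|lborel. complex_of_real (w x) * (\<Sum>k<N. trig_poly c \<eta> I (matrix_power A k *v x))\<^sup>2)" for N
    unfolding real part_sum_def by (subst integral_complex_of_real[symmetric]) simp
  then show ?thesis
    using trig_second_moment[of I \<eta> w C c, OF fin nz w_test] by (simp add: fourier_int_zero)
qed

definition variance :: real where "variance = Re (trig_variance c \<eta> I A)"

lemma variance_nonneg: "0 \<le> variance"
  and variance_complex: "trig_variance c \<eta> I A = complex_of_real variance"
proof -
  have "0 \<le> (LINT x|lborel. w x * (part_sum N x)\<^sup>2) / real N" for N
    using w_nonneg by (intro divide_nonneg_nonneg Bochner_Integration.integral_nonneg) auto
  note n = nonneg_real_limit[OF second_moment_complex this w_pos]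
  show "0 \<le> variance" unfolding variance_def by (rule n(2))
  show "trig_variance c \<eta> I A = complex_of_real variance" unfolding variance_def by (rule n(1))
qed

lemma second_moment:
  "(\<lambda>N. (LINT x|lborel. w x * (part_sum N x)\<^sup>2) / real N) \<longlonglongrightarrow> (LINT x|lborel. w x) * variance"
  using tendsto_Re[OF second_moment_complex] by (simp add: variance_def)

text \<open>The limiting mean of the squares of \<open>g\<close> along the orbit. When
  \<open>g\<close> is a block sum, this is the variance of one block.\<close>

definition corr0 :: real where "corr0 = Re (trig_corr c \<eta> I A 0)"

lemma corr0_nonneg: "0 \<le> corr0"
  and corr0_complex: "trig_corr c \<eta> I A 0 = complex_of_real corr0"
proof -
  define r where "r k = (LINT x|lborel. w x * (g (matrix_power A k *v x))\<^sup>2)" for k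
  obtain K where K: "\<And>k n. norm ((LINT x|lborel. complex_of_real (w x) *
             (trig_poly c \<eta> I (matrix_power A k *v x) * trig_poly c \<eta> I (matrix_power A (k + n) *v x)))
           - fourier_int w 0 * trig_corr c \<eta> I A n) \<le> K / q ^ (k + n)" "0 \<le> K"
    using correlation_bound[of I \<eta> w C c, OF fin nz w_test] by blast
  have "norm (complex_of_real (r k) - complex_of_real (LINT x|lborel. w x) * trig_corr c \<eta> I A 0) \<le> K / q ^ k" for k
  proof -
    have "complex_of_real (r k) = (LINT x|lborel. complex_of_real (w x) *
             (trig_poly c \<eta> I (matrix_power A k *v x) * trig_poly c \<eta> I (matrix_power A (k + 0) *v x)))"
      unfolding real r_def by (subst integral_complex_of_real[symmetric]) (simp add: power2_eq_square)
    then show ?thesis using K(1)[of k 0] by (simp add: fourier_int_zero)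
  qed
  moreover have "(\<lambda>k. K / q ^ k) \<longlonglongrightarrow> 0"
    using tendsto_mult_left[OF LIMSEQ_realpow_zero[of "1/q"], of K] q_gt_1 by (simp add: power_divide)
  ultimately have "(\<lambda>k. complex_of_real (r k) - complex_of_real (LINT x|lborel. w x) * trig_corr c \<eta> I A 0) \<longlonglongrightarrow> 0"
    by (rule tendsto_0_if_norm_le)
  then have "(\<lambda>k. complex_of_real (r k)) \<longlonglongrightarrow> complex_of_real (LINT x|lborel. w x) * trig_corr c \<eta> I A 0"
    by (simp add: LIM_zero_iff)
  note lim = this
  have "0 \<le> r k" for k unfolding r_def using w_nonneg by (intro Bochner_Integration.integral_nonneg) auto
  note n = nonneg_real_limit[OF lim this w_pos]
  show "0 \<le> corr0" unfolding corr0_def by (rule n(2))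
  show "trig_corr c \<eta> I A 0 = complex_of_real corr0" unfolding corr0_def by (rule n(1))
qed

text \<open>Subtracting \<open>corr0\<close> from the square of \<open>g\<close> removes precisely
  its zero frequencies. What remains is again a trigonometric polynomial of the kind treated above,
  so its normalised second moments converge and are therefore bounded.\<close>

lemma law_of_large_numbers:
  "\<exists>L. \<forall>N. (LINT x|lborel. w x * (\<Sum>k<N. (g (matrix_power A k *v x))\<^sup>2 - corr0)\<^sup>2) \<le> L * real N"
proof -
  define J where "J = {(i,j) \<in> I \<times> I. \<eta> i + \<eta> j \<noteq> 0}"
  define h where "h x = (g x)\<^sup>2 - corr0" for x
  have fJ: "finite J" by (rule finite_subset[of _ "I \<times> I"]) (auto simp: J_def fin)
  have h: "trig_poly (\<lambda>(i,j). c i * c j) (\<lambda>(i,j). \<eta> i + \<eta> j) J x = complex_of_real (h x)" for x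
  proof -
    have "complex_of_real ((g x)\<^sup>2) = trig_poly (\<lambda>(i,j). c i * c j) (\<lambda>(i,j). \<eta> i + \<eta> j) (I \<times> I) x"
      by (simp add: power2_eq_square real[symmetric] trig_poly_mult)
    also have "\<dots> = trig_poly (\<lambda>(i,j). c i * c j) (\<lambda>(i,j). \<eta> i + \<eta> j) J x
        + (\<Sum>(i,j)\<in>I \<times> I - J. c i * c j * wave (\<eta> i + \<eta> j) x)"
      unfolding trig_poly_def case_prod_unfold
      by (subst sum.subset_diff[of J "I \<times> I"]) (auto simp: J_def fin)
    also have "(\<Sum>(i,j)\<in>I \<times> I - J. c i * c j * wave (\<eta> i + \<eta> j) x)
        = (\<Sum>(i,j)\<in>I \<times> I. c i * c j * of_bool (\<eta> i + \<eta> j = 0))"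
      by (rule sum.mono_neutral_cong_left) (auto simp: J_def fin)
    also have "\<dots> = complex_of_real corr0"
      unfolding corr0_complex[symmetric] trig_corr_def by (simp add: sum.cartesian_product)
    finally show ?thesis by (simp add: h_def)
  qed
  interpret H: trig_system A q "\<lambda>(i,j). c i * c j" "\<lambda>(i,j). \<eta> i + \<eta> j" J h w C
    by unfold_locales (use fJ h w_test w_nonneg w_pos in \<open>auto simp: J_def\<close>)
  have "Bseq (\<lambda>N. (LINT x|lborel. w x * (H.part_sum N x)\<^sup>2) / real N)"
    using H.second_moment by (rule convergent_imp_Bseq[OF convergentI])
  then obtain L where L: "\<And>N. \<bar>(LINT x|lborel. w x * (H.part_sum N x)\<^sup>2) / real N\<bar> \<le> L"
    by (auto simp: Bseq_def)
  have "(LINT x|lborel. w x * (H.part_sum N x)\<^sup>2) \<le> L * real N" for N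
    using L[of N] by (cases "N = 0") (auto simp: H.part_sum_def field_simps abs_le_iff)
  then show ?thesis unfolding H.part_sum_def h_def by blast
qed

lemma riesz_prod_real:
  "riesz_prod \<tau> (trig_poly c \<eta> I) n x
     = (\<Prod>j<n. 1 + \<i> * complex_of_real (\<tau> * g (matrix_power A j *v x)))"
  by (simp add: riesz_prod_def real mult.assoc)

definition quad_sum :: "nat \<Rightarrow> real^'d \<Rightarrow> real" where
  "quad_sum n x = (\<Sum>j<n. (g (matrix_power A j *v x))\<^sup>2)"

lemma quad_sum_measurable [measurable]: "quad_sum n \<in> borel_measurable borel"
  unfolding quad_sum_def by measurable

lemma quad_sum_nonneg: "0 \<le> quad_sum n x"
  unfolding quad_sum_def by (intro sum_nonneg) auto

lemma quad_sum_le: "quad_sum n x \<le> real n * (\<Sum>i\<in>I. norm (c i))\<^sup>2"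
proof -
  have "(g y)\<^sup>2 \<le> (\<Sum>i\<in>I. norm (c i))\<^sup>2" for y
    using power_mono[OF g_bound[of y], of 2] by simp
  then have "quad_sum n x \<le> (\<Sum>j<n. (\<Sum>i\<in>I. norm (c i))\<^sup>2)"
    unfolding quad_sum_def by (intro sum_mono)
  then show ?thesis by simp
qed

lemma norm_riesz_prod_exp: "norm (riesz_prod \<tau> (trig_poly c \<eta> I) n x) \<le> exp (\<tau>\<^sup>2 * quad_sum n x / 2)"
proof -
  have "norm (1 + \<i> * complex_of_real y) \<le> exp (y\<^sup>2 / 2)" for y
  proof -
    have "exp (- complex_of_real (y\<^sup>2 / 2)) = complex_of_real (exp (- (y\<^sup>2 / 2)))"
      by (metis exp_of_real of_real_minus)
    then show ?thesis using norm_one_plus_i_exp_le[of y] unfolding norm_mult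
      by (simp add: exp_minus norm_inverse) (simp add: field_simps)
  qed
  then have "norm (riesz_prod \<tau> (trig_poly c \<eta> I) n x) \<le> (\<Prod>j<n. exp ((\<tau> * g (matrix_power A j *v x))\<^sup>2 / 2))"
    unfolding riesz_prod_real prod_norm[symmetric] by (intro prod_mono conjI norm_ge_zero) blast
  also have "\<dots> = exp (\<tau>\<^sup>2 * quad_sum n x / 2)"
    unfolding quad_sum_def by (simp add: exp_sum[symmetric] power_mult_distrib sum_distrib_left sum_divide_distrib)
  finally show ?thesis .
qed

text \<open>Factors of modulus at most 1 on both sides: the two products differ by no more than the
  sum of the cubic errors of single factors.\<close>

lemma cis_riesz_approx:
  assumes "\<bar>\<tau>\<bar> * (\<Sum>i\<in>I. norm (c i)) \<le> 1"
  shows "norm (cis (\<tau> * part_sum n x)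
           - riesz_prod \<tau> (trig_poly c \<eta> I) n x * complex_of_real (exp (- (\<tau>\<^sup>2 * quad_sum n x / 2))))
         \<le> real n * (2 * (\<bar>\<tau>\<bar> * (\<Sum>i\<in>I. norm (c i))) ^ 3)"
proof -
  define y where "y j = \<tau> * g (matrix_power A j *v x)" for j
  have y: "\<bar>y j\<bar> \<le> \<bar>\<tau>\<bar> * (\<Sum>i\<in>I. norm (c i))" for j
    unfolding y_def abs_mult by (intro mult_left_mono g_bound) auto
  have e: "exp (- complex_of_real ((y j)\<^sup>2 / 2)) = complex_of_real (exp (- ((y j)\<^sup>2 / 2)))" for j
    by (metis exp_of_real of_real_minus)
  have "complex_of_real (exp (- (\<tau>\<^sup>2 * quad_sum n x / 2))) = (\<Prod>j<n. exp (- complex_of_real ((y j)\<^sup>2 / 2)))"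
    unfolding e quad_sum_def of_real_prod[symmetric]
    by (simp add: exp_sum[symmetric] y_def power_mult_distrib sum_distrib_left sum_divide_distrib sum_negf)
  then have 1: "riesz_prod \<tau> (trig_poly c \<eta> I) n x * complex_of_real (exp (- (\<tau>\<^sup>2 * quad_sum n x / 2)))
      = (\<Prod>j<n. (1 + \<i> * complex_of_real (y j)) * exp (- complex_of_real ((y j)\<^sup>2 / 2)))"
    unfolding riesz_prod_real y_def[symmetric] by (simp only: prod.distrib)
  have 2: "cis (\<tau> * part_sum n x) = (\<Prod>j<n. cis (y j))"
    by (simp add: part_sum_def y_def sum_distrib_left cis_sum)
  have "norm ((\<Prod>j<n. cis (y j)) - (\<Prod>j<n. (1 + \<i> * complex_of_real (y j)) * exp (- complex_of_real ((y j)\<^sup>2 / 2))))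
     \<le> (\<Sum>j<n. norm (cis (y j) - (1 + \<i> * complex_of_real (y j)) * exp (- complex_of_real ((y j)\<^sup>2 / 2))))"
    by (intro norm_prod_diff norm_one_plus_i_exp_le) simp
  also have "\<dots> \<le> (\<Sum>j<n. 2 * (\<bar>\<tau>\<bar> * (\<Sum>i\<in>I. norm (c i))) ^ 3)"
  proof (intro sum_mono)
    fix j
    have "norm (cis (y j) - (1 + \<i> * complex_of_real (y j)) * exp (- complex_of_real ((y j)\<^sup>2 / 2))) \<le> 2 * \<bar>y j\<bar> ^ 3"
      using y[of j] assms by (intro cis_approx) linarith
    also have "\<dots> \<le> 2 * (\<bar>\<tau>\<bar> * (\<Sum>i\<in>I. norm (c i))) ^ 3"
      using y[of j] by (intro mult_left_mono power_mono) auto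
    finally show "norm (cis (y j) - (1 + \<i> * complex_of_real (y j)) * exp (- complex_of_real ((y j)\<^sup>2 / 2)))
        \<le> 2 * (\<bar>\<tau>\<bar> * (\<Sum>i\<in>I. norm (c i))) ^ 3" .
  qed
  finally show ?thesis unfolding 1 2 by simp
qed

lemma quad_sum_L1:
  "\<exists>L\<ge>0. \<forall>n. (LINT x|lborel. w x * \<bar>quad_sum n x - real n * corr0\<bar>) \<le> L * sqrt (real n)"
proof -
  obtain L where L: "\<And>N. (LINT x|lborel. w x * (\<Sum>k<N. (g (matrix_power A k *v x))\<^sup>2 - corr0)\<^sup>2) \<le> L * real N"
    using law_of_large_numbers by blast
  define W where "W = (LINT x|lborel. w x)"
  have eq: "(\<Sum>k<n. (g (matrix_power A k *v x))\<^sup>2 - corr0) = quad_sum n x - real n * corr0" for n x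
    by (simp add: quad_sum_def sum_subtractf)
  have "(LINT x|lborel. w x * \<bar>quad_sum n x - real n * corr0\<bar>) \<le> (sqrt W * sqrt \<bar>L\<bar>) * sqrt (real n)" for n
  proof -
    have b: "\<bar>quad_sum n x - real n * corr0\<bar> \<le> real n * (\<Sum>i\<in>I. norm (c i))\<^sup>2 + real n * corr0" for x
      using quad_sum_nonneg[of n x] quad_sum_le[of n x] mult_nonneg_nonneg[OF of_nat_0_le_iff corr0_nonneg, of n] by linarith
    have "(LINT x|lborel. w x * \<bar>quad_sum n x - real n * corr0\<bar>)
        \<le> sqrt W * sqrt (LINT x|lborel. w x * (quad_sum n x - real n * corr0)\<^sup>2)"
      unfolding W_def
      by (rule weighted_L1_le_L2(2)[OF _ w_integrable w_nonneg]) (auto intro!: integrable_bounded_square b)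
    also have "\<dots> \<le> sqrt W * sqrt (\<bar>L\<bar> * real n)"
    proof (intro mult_left_mono real_sqrt_le_mono)
      have "L * real n \<le> \<bar>L\<bar> * real n" by (intro mult_right_mono) auto
      then show "(LINT x|lborel. w x * (quad_sum n x - real n * corr0)\<^sup>2) \<le> \<bar>L\<bar> * real n"
        using L[of n] unfolding eq by linarith
      show "0 \<le> sqrt W" using w_pos by (simp add: W_def)
    qed
    finally show ?thesis by (simp add: real_sqrt_mult)
  qed
  then show ?thesis using w_pos by (intro exI[of _ "sqrt W * sqrt \<bar>L\<bar>"]) (auto simp: W_def)
qed

text \<open>The Riesz product stays bounded because \<open>\<tau>^2 * quad_sum\<close> does, and it
  tends weakly to 1. By the law of large numbers its Gaussian companion is almost the constant
  \<open>exp (- s2 * corr0 / 2)\<close> in L1(w) and can be taken out of the integral. The sequences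
  \<open>\<tau>\<close> and \<open>n\<close> are separate since in the application one is
  \<open>t / sqrt N\<close> and the other counts complete periods.\<close>

proposition lacunary_clt:
  assumes q8: "8 \<le> q" and B: "0 < B"
    and u: "\<And>i. i \<in> I \<Longrightarrow> \<eta> i = u i v* A \<and> norm (u i) \<le> B" and big: "\<And>i. i \<in> I \<Longrightarrow> 2 * B \<le> norm (\<eta> i)"
    and \<psi>: "integrable lborel \<psi>" and \<psi>w: "\<And>x. \<bar>\<psi> x\<bar> \<le> w x"
    and n: "filterlim n at_top sequentially" and \<tau>n: "(\<lambda>N. (\<tau> N)\<^sup>2 * real (n N)) \<longlonglongrightarrow> s2"
  shows "(\<lambda>N. LINT x|lborel. complex_of_real (\<psi> x) * cis (\<tau> N * part_sum (n N) x))
     \<longlonglongrightarrow> complex_of_real ((LINT x|lborel. \<psi> x) * exp (- (s2 * corr0 / 2)))"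
proof -
  define M where "M = (\<Sum>i\<in>I. norm (c i))"
  define T where "T N = riesz_prod (\<tau> N) (trig_poly c \<eta> I) (n N)" for N
  define \<kappa> where "\<kappa> = s2 * corr0 / 2"
  define V where "V N x = (\<tau> N)\<^sup>2 * quad_sum (n N) x" for N x
  have M: "0 \<le> M" by (simp add: M_def sum_nonneg)
  have n_real: "filterlim (\<lambda>N. real (n N)) at_top sequentially"
    by (rule filterlim_compose[OF filterlim_real_sequentially n])
  have inv: "(\<lambda>N. inverse (real (n N))) \<longlonglongrightarrow> 0"
    by (rule tendsto_inverse_0_at_top[OF n_real])
  have ev1: "eventually (\<lambda>N. 1 \<le> n N) sequentially"
    using n by (simp add: filterlim_at_top)
  have \<tau>0: "\<tau> \<longlonglongrightarrow> 0"
  proof -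
    have "(\<lambda>N. ((\<tau> N)\<^sup>2 * real (n N)) * inverse (real (n N))) \<longlonglongrightarrow> 0"
      using tendsto_mult[OF \<tau>n inv] by simp
    moreover have "eventually (\<lambda>N. ((\<tau> N)\<^sup>2 * real (n N)) * inverse (real (n N)) = (\<tau> N)\<^sup>2) sequentially"
      using ev1 by eventually_elim simp
    ultimately have "(\<lambda>N. (\<tau> N)\<^sup>2) \<longlonglongrightarrow> 0" by (rule Lim_transform_eventually)
    then have "(\<lambda>N. sqrt ((\<tau> N)\<^sup>2)) \<longlonglongrightarrow> sqrt 0" by (rule tendsto_real_sqrt)
    then show ?thesis by (simp add: tendsto_rabs_zero_iff)
  qed
  obtain Bd where Bd': "\<forall>N. norm ((\<tau> N)\<^sup>2 * real (n N)) \<le> Bd"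
    using convergent_imp_Bseq[OF convergentI[OF \<tau>n]] unfolding Bseq_def by blast
  have Bd: "(\<tau> N)\<^sup>2 * real (n N) \<le> Bd" for N using spec[OF Bd', of N] by simp
  have V: "0 \<le> V N x" "V N x \<le> Bd * M\<^sup>2" for N x
  proof -
    show "0 \<le> V N x" by (simp add: V_def quad_sum_nonneg)
    have "V N x \<le> (\<tau> N)\<^sup>2 * (real (n N) * M\<^sup>2)"
      unfolding V_def M_def by (intro mult_left_mono quad_sum_le) auto
    also have "\<dots> \<le> Bd * M\<^sup>2" using mult_right_mono[OF Bd[of N], of "M\<^sup>2"] by (simp add: mult.assoc)
    finally show "V N x \<le> Bd * M\<^sup>2" .
  qed
  \<comment> \<open>A bound for all Riesz products at once: \<open>\<tau>^2 * n\<close> converges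
    and is thus at most \<open>Bd\<close>.\<close>
  define E where "E = exp (Bd * M\<^sup>2 / 2)"
  have Tb: "norm (T N x) \<le> E" for N x
  proof -
    have "norm (T N x) \<le> exp (V N x / 2)" unfolding T_def V_def by (rule norm_riesz_prod_exp)
    also have "\<dots> \<le> E" unfolding E_def using V(2)[of N x] by simp
    finally show ?thesis .
  qed
  have [measurable]: "T N \<in> borel_measurable borel" for N unfolding T_def by simp
  interpret T: bounded_seq T E by unfold_locales (use Tb in auto)
  have small: "eventually (\<lambda>N. \<bar>\<tau> N\<bar> * M \<le> 1) sequentially"
  proof -
    have "(\<lambda>N. \<bar>\<tau> N\<bar> * M) \<longlonglongrightarrow> \<bar>0\<bar> * M" by (intro tendsto_intros \<tau>0)
    then have "eventually (\<lambda>N. \<bar>\<tau> N\<bar> * M < 1) sequentially" by (simp add: order_tendsto_iff)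
    then show ?thesis by eventually_elim simp
  qed
  have "weak_lim T 1 \<phi>" if \<phi>: "test_fun \<phi> C'" for \<phi> C'
  proof -
    have "(\<lambda>N. (LINT x|lborel. complex_of_real (\<phi> x) * T N x) - complex_of_real (LINT x|lborel. \<phi> x)) \<longlonglongrightarrow> 0"
    proof (rule Lim_null_comparison)
      show "eventually (\<lambda>N. norm ((LINT x|lborel. complex_of_real (\<phi> x) * T N x) - complex_of_real (LINT x|lborel. \<phi> x))
           \<le> \<bar>\<tau> N\<bar> * M * (C' / B)) sequentially"
        using small
      proof eventually_elim
        case (elim N)
        show ?case unfolding T_def M_def
          by (rule riesz_prod_mean[OF \<phi> fin q8 B u big]) (use elim in \<open>auto simp: M_def\<close>)
      qed
      have "(\<lambda>N. \<bar>\<tau> N\<bar> * M * (C' / B)) \<longlonglongrightarrow> \<bar>0\<bar> * M * (C' / B)" by (intro tendsto_intros \<tau>0)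
      then show "(\<lambda>N. \<bar>\<tau> N\<bar> * M * (C' / B)) \<longlonglongrightarrow> 0" by simp
    qed
    then show ?thesis unfolding weak_lim_def by (simp add: LIM_zero_iff)
  qed
  from T.weak_lim_extend[OF this \<psi>]
  have T_lim: "(\<lambda>N. LINT x|lborel. complex_of_real (\<psi> x) * T N x) \<longlonglongrightarrow> complex_of_real (LINT x|lborel. \<psi> x)"
    by (simp add: weak_lim_def)
  obtain L where L: "0 \<le> L" "\<And>n. (LINT x|lborel. w x * \<bar>quad_sum n x - real n * corr0\<bar>) \<le> L * sqrt (real n)"
    using quad_sum_L1 by blast
  define W where "W = (LINT x|lborel. w x)"
  \<comment> \<open>\<open>\<delta>\<close> collects the errors that are uniform in
    \<open>x\<close>: the cubic terms and the deviation of \<open>\<tau>^2 * n\<close> from its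
    limit. The fluctuation of \<open>quad_sum\<close> is controlled only after integration against
    \<open>w\<close> and enters through \<open>\<epsilon>\<close>.\<close>
  define \<delta> where "\<delta> N = real (n N) * (2 * (\<bar>\<tau> N\<bar> * M) ^ 3) + E / 2 * \<bar>(\<tau> N)\<^sup>2 * real (n N) - s2\<bar> * corr0" for N
  define \<epsilon> where "\<epsilon> N = W * \<delta> N + E / 2 * ((\<tau> N)\<^sup>2 * (L * sqrt (real (n N))))" for N
  let ?F = "\<lambda>N x. cis (\<tau> N * part_sum (n N) x)"
  have cis_meas [measurable]: "?F N \<in> borel_measurable borel" for N
  proof -
    show ?thesis using borel_measurable_cis by measurable
  qed
  have diff: "norm ((LINT x|lborel. complex_of_real (\<psi> x) * ?F N x)
      - complex_of_real (exp (- \<kappa>)) * (LINT x|lborel. complex_of_real (\<psi> x) * T N x)) \<le> \<epsilon> N"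
    if sm: "\<bar>\<tau> N\<bar> * M \<le> 1" for N
  proof -
    have i1: "integrable lborel (\<lambda>x. complex_of_real (\<psi> x) * ?F N x)"
      by (rule integrable_mult_bounded[OF \<psi>, of _ 1]) auto
    have i2: "integrable lborel (\<lambda>x. complex_of_real (\<psi> x) * T N x)" by (rule T.F_integrable[OF \<psi>])
    have b: "\<bar>quad_sum (n N) x - real (n N) * corr0\<bar> \<le> real (n N) * M\<^sup>2 + real (n N) * corr0" for x
      using quad_sum_nonneg[of "n N" x] quad_sum_le[of "n N" x, folded M_def] mult_nonneg_nonneg[OF of_nat_0_le_iff corr0_nonneg, of "n N"] by linarith
    have iw: "integrable lborel (\<lambda>x. w x * \<bar>quad_sum (n N) x - real (n N) * corr0\<bar>)"
      by (rule integrable_weight_bounded[OF w_integrable]) (use b in auto)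
    have pt: "norm (complex_of_real (\<psi> x) * (?F N x - complex_of_real (exp (- \<kappa>)) * T N x))
        \<le> \<delta> N * w x + E / 2 * (\<tau> N)\<^sup>2 * (w x * \<bar>quad_sum (n N) x - real (n N) * corr0\<bar>)" for x
    proof -
      have e_lip: "\<bar>exp (- a) - exp (- b)\<bar> \<le> \<bar>a - b\<bar>" if "0 \<le> a" "0 \<le> b" for a b :: real
      proof -
        have *: "\<bar>exp (- a) - exp (- b)\<bar> \<le> \<bar>a - b\<bar>" if "0 \<le> a" "a \<le> b" for a b :: real
        proof -
          have "exp (- a) - exp (- b) = exp (- a) * (1 - exp (- (b - a)))"
            by (simp add: right_diff_distrib exp_add[symmetric])
          also have "\<dots> \<le> 1 * (b - a)"
          proof (rule mult_mono)
            show "1 - exp (- (b - a)) \<le> b - a" using exp_ge_add_one_self[of "- (b - a)"] by linarith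
          qed (use that in auto)
          finally show ?thesis using that by simp
        qed
        show ?thesis using *[of a b] *[of b a] that by (cases "a \<le> b") (auto simp: abs_minus_commute)
      qed
      have s2: "0 \<le> s2" by (rule LIMSEQ_le_const[OF \<tau>n]) auto
      have \<kappa>: "0 \<le> \<kappa>" using s2 corr0_nonneg by (simp add: \<kappa>_def)
      have a1: "norm (?F N x - T N x * complex_of_real (exp (- (V N x / 2)))) \<le> real (n N) * (2 * (\<bar>\<tau> N\<bar> * M) ^ 3)"
        using cis_riesz_approx[of "\<tau> N" "n N" x] sm unfolding T_def V_def M_def by simp
      have "norm (T N x * (complex_of_real (exp (- (V N x / 2))) - complex_of_real (exp (- \<kappa>)))) \<le> E * \<bar>V N x / 2 - \<kappa>\<bar>"
        unfolding norm_mult of_real_diff[symmetric] norm_of_real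
        using Tb[of N x] e_lip[of "V N x / 2" \<kappa>] V(1)[of N x] \<kappa> by (intro mult_mono) (auto simp: E_def)
      also have "V N x / 2 - \<kappa> = ((\<tau> N)\<^sup>2 * (quad_sum (n N) x - real (n N) * corr0) + ((\<tau> N)\<^sup>2 * real (n N) - s2) * corr0) / 2"
        by (simp add: V_def \<kappa>_def algebra_simps diff_divide_distrib add_divide_distrib)
      also have "E * \<bar>\<dots>\<bar> \<le> E * (((\<tau> N)\<^sup>2 * \<bar>quad_sum (n N) x - real (n N) * corr0\<bar> + \<bar>(\<tau> N)\<^sup>2 * real (n N) - s2\<bar> * corr0) / 2)"
      proof (rule mult_left_mono)
        have "\<bar>(\<tau> N)\<^sup>2 * (quad_sum (n N) x - real (n N) * corr0) + ((\<tau> N)\<^sup>2 * real (n N) - s2) * corr0\<bar>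
          \<le> \<bar>(\<tau> N)\<^sup>2 * (quad_sum (n N) x - real (n N) * corr0)\<bar> + \<bar>((\<tau> N)\<^sup>2 * real (n N) - s2) * corr0\<bar>"
          by (rule abs_triangle_ineq)
        also have "\<dots> = (\<tau> N)\<^sup>2 * \<bar>quad_sum (n N) x - real (n N) * corr0\<bar> + \<bar>(\<tau> N)\<^sup>2 * real (n N) - s2\<bar> * corr0"
          using corr0_nonneg by (simp only: abs_mult abs_of_nonneg[OF corr0_nonneg] abs_power2)
        finally show "\<bar>((\<tau> N)\<^sup>2 * (quad_sum (n N) x - real (n N) * corr0) + ((\<tau> N)\<^sup>2 * real (n N) - s2) * corr0) / 2\<bar>
          \<le> ((\<tau> N)\<^sup>2 * \<bar>quad_sum (n N) x - real (n N) * corr0\<bar> + \<bar>(\<tau> N)\<^sup>2 * real (n N) - s2\<bar> * corr0) / 2"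
          by simp
      qed (simp add: E_def)
      finally have a2: "norm (T N x * (complex_of_real (exp (- (V N x / 2))) - complex_of_real (exp (- \<kappa>))))
         \<le> E / 2 * (\<tau> N)\<^sup>2 * \<bar>quad_sum (n N) x - real (n N) * corr0\<bar> + E / 2 * \<bar>(\<tau> N)\<^sup>2 * real (n N) - s2\<bar> * corr0"
        by (simp add: algebra_simps)
      have dec: "?F N x - complex_of_real (exp (- \<kappa>)) * T N x
        = (?F N x - T N x * complex_of_real (exp (- (V N x / 2))))
          + T N x * (complex_of_real (exp (- (V N x / 2))) - complex_of_real (exp (- \<kappa>)))"
        by (simp add: algebra_simps)
      have "norm (?F N x - complex_of_real (exp (- \<kappa>)) * T N x)
         \<le> norm (?F N x - T N x * complex_of_real (exp (- (V N x / 2))))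
          + norm (T N x * (complex_of_real (exp (- (V N x / 2))) - complex_of_real (exp (- \<kappa>))))"
        by (subst dec) (rule norm_triangle_ineq)
      then have "norm (?F N x - complex_of_real (exp (- \<kappa>)) * T N x)
          \<le> \<delta> N + E / 2 * (\<tau> N)\<^sup>2 * \<bar>quad_sum (n N) x - real (n N) * corr0\<bar>" (is "?l \<le> ?r")
        using a1 a2
        unfolding \<delta>_def by linarith
      then have "\<bar>\<psi> x\<bar> * ?l \<le> w x * ?r"
        using \<psi>w w_nonneg by (intro mult_mono) auto
      then show ?thesis unfolding norm_mult[of "complex_of_real (\<psi> x)"] by (simp add: algebra_simps)
    qed
    have "(LINT x|lborel. complex_of_real (\<psi> x) * ?F N x)
      - complex_of_real (exp (- \<kappa>)) * (LINT x|lborel. complex_of_real (\<psi> x) * T N x)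
      = (LINT x|lborel. complex_of_real (\<psi> x) * ?F N x - complex_of_real (exp (- \<kappa>)) * (complex_of_real (\<psi> x) * T N x))"
      using i1 i2 by simp
    also have "\<dots> = (LINT x|lborel. complex_of_real (\<psi> x) * (?F N x - complex_of_real (exp (- \<kappa>)) * T N x))"
      by (simp add: right_diff_distrib mult.left_commute)
    also have "norm \<dots> \<le> (LINT x|lborel. norm (complex_of_real (\<psi> x) * (?F N x - complex_of_real (exp (- \<kappa>)) * T N x)))"
      by (rule integral_norm_bound)
    also have "\<dots> \<le> (LINT x|lborel. \<delta> N * w x + E / 2 * (\<tau> N)\<^sup>2 * (w x * \<bar>quad_sum (n N) x - real (n N) * corr0\<bar>))"
    proof (rule integral_mono)
      have "integrable lborel (\<lambda>x. complex_of_real (\<psi> x) * ?F N x - complex_of_real (exp (- \<kappa>)) * (complex_of_real (\<psi> x) * T N x))"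
        using i1 i2 by simp
      then show "integrable lborel (\<lambda>x. norm (complex_of_real (\<psi> x) * (?F N x - complex_of_real (exp (- \<kappa>)) * T N x)))"
        by (simp add: right_diff_distrib mult.left_commute)
      show "integrable lborel (\<lambda>x. \<delta> N * w x + E / 2 * (\<tau> N)\<^sup>2 * (w x * \<bar>quad_sum (n N) x - real (n N) * corr0\<bar>))"
        by (intro Bochner_Integration.integrable_add integrable_mult_right w_integrable iw)
    qed (rule pt)
    also have "\<dots> = \<delta> N * W + E / 2 * (\<tau> N)\<^sup>2 * (LINT x|lborel. w x * \<bar>quad_sum (n N) x - real (n N) * corr0\<bar>)"
      using iw w_integrable by (simp add: W_def)
    also have "\<dots> \<le> \<delta> N * W + E / 2 * (\<tau> N)\<^sup>2 * (L * sqrt (real (n N)))"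
      by (intro add_left_mono mult_left_mono L) (simp add: E_def)
    finally show ?thesis by (simp add: \<epsilon>_def mult_ac)
  qed
  have \<epsilon>0: "\<epsilon> \<longlonglongrightarrow> 0"
  proof -
    have "(\<lambda>N. \<bar>\<tau> N\<bar> * (2 * ((\<tau> N)\<^sup>2 * real (n N)) * M ^ 3)) \<longlonglongrightarrow> \<bar>0\<bar> * (2 * s2 * M ^ 3)"
      by (intro tendsto_intros \<tau>0 \<tau>n)
    then have 1: "(\<lambda>N. real (n N) * (2 * (\<bar>\<tau> N\<bar> * M) ^ 3)) \<longlonglongrightarrow> 0"
      by (simp add: power_mult_distrib power3_eq_cube power2_eq_square abs_mult_self_eq mult_ac)
    have 2: "(\<lambda>N. E / 2 * \<bar>(\<tau> N)\<^sup>2 * real (n N) - s2\<bar> * corr0) \<longlonglongrightarrow> E / 2 * \<bar>s2 - s2\<bar> * corr0"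
      by (intro tendsto_intros \<tau>n)
    have 3: "\<delta> \<longlonglongrightarrow> 0" unfolding \<delta>_def using tendsto_add[OF 1 2] by simp
    have "(\<lambda>N. ((\<tau> N)\<^sup>2 * real (n N)) * sqrt (inverse (real (n N)))) \<longlonglongrightarrow> s2 * sqrt 0"
      by (intro tendsto_intros \<tau>n inv)
    moreover have "((\<tau> N)\<^sup>2 * real (n N)) * sqrt (inverse (real (n N))) = (\<tau> N)\<^sup>2 * sqrt (real (n N))" for N
      by (simp only: real_sqrt_inverse divide_inverse[symmetric] times_divide_eq_right[symmetric] real_div_sqrt of_nat_0_le_iff)
    ultimately have "(\<lambda>N. (\<tau> N)\<^sup>2 * sqrt (real (n N))) \<longlonglongrightarrow> 0" by simp
    from tendsto_mult_left[OF this, of "E / 2 * L"] have "(\<lambda>N. E / 2 * ((\<tau> N)\<^sup>2 * (L * sqrt (real (n N))))) \<longlonglongrightarrow> 0"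
      by (simp add: mult_ac)
    from tendsto_add[OF tendsto_mult_left[OF 3, of W] this] show ?thesis unfolding \<epsilon>_def by simp
  qed
  have "(\<lambda>N. (LINT x|lborel. complex_of_real (\<psi> x) * ?F N x)
      - complex_of_real (exp (- \<kappa>)) * (LINT x|lborel. complex_of_real (\<psi> x) * T N x)) \<longlonglongrightarrow> 0"
    by (rule Lim_null_comparison[OF _ \<epsilon>0]) (use small in eventually_elim, rule diff)
  from tendsto_add[OF this tendsto_mult_left[OF T_lim, of "complex_of_real (exp (- \<kappa>))"]]
  show ?thesis by (simp add: \<kappa>_def mult.commute)
qed

end

section \<open>Blocks and gaps\<close>

text \<open>Interchange of limits, applied both with the block length and with the frequency cutoff
  as \<open>p\<close>. Closeness is asked only for \<open>N\<close> large depending on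
  \<open>p\<close>, and \<open>r\<close> allows small \<open>p\<close> to be ignored.\<close>

lemma double_limit:
  fixes x :: "nat \<Rightarrow> 'a::real_normed_vector"
  assumes y: "\<And>p. r \<le> p \<Longrightarrow> y p \<longlonglongrightarrow> L p"
    and close: "\<And>p. r \<le> p \<Longrightarrow> eventually (\<lambda>N. norm (x N - y p N) \<le> \<delta> p) sequentially"
    and \<delta>: "\<delta> \<longlonglongrightarrow> (0::real)" and L: "L \<longlonglongrightarrow> L'"
  shows "x \<longlonglongrightarrow> L'"
proof (rule tendstoI)
  fix e :: real assume e: "0 < e"
  have "eventually (\<lambda>p. dist (\<delta> p) 0 < e / 3 \<and> dist (L p) L' < e / 3 \<and> r \<le> p) sequentially"
    using e by (intro eventually_conj tendstoD[OF \<delta>] tendstoD[OF L] eventually_ge_at_top) auto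
  then obtain p where p: "dist (\<delta> p) 0 < e / 3" "dist (L p) L' < e / 3" "r \<le> p"
    using eventually_happens'[OF sequentially_bot] by blast
  have "eventually (\<lambda>N. dist (y p N) (L p) < e / 3) sequentially"
    using e by (intro tendstoD[OF y[OF p(3)]]) auto
  then show "eventually (\<lambda>N. dist (x N) L' < e) sequentially"
    using close[OF p(3)]
  proof eventually_elim
    case (elim N)
    have "dist (x N) (y p N) < e / 3" using elim(2) p(1) by (simp add: dist_norm)
    then show ?case
      using elim(1) p(2) dist_triangle[of "x N" L' "y p N"] dist_triangle[of "y p N" L' "L p"] by linarith
  qed
qed

lemma square_sum_symmetric:
  fixes a :: "nat \<Rightarrow> nat \<Rightarrow> 'a::comm_ring_1"
  assumes "\<And>k l. a k l = a l k"
  shows "(\<Sum>k<N. \<Sum>l<N. a k l) = (\<Sum>m<N. a m m + 2 * (\<Sum>k<m. a k m))"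
proof (induction N)
  case (Suc N)
  have e: "(\<Sum>l<N. a N l) = (\<Sum>k<N. a k N)" by (rule sum.cong[OF refl]) (rule assms)
  have "(\<Sum>k<Suc N. \<Sum>l<Suc N. a k l)
      = (\<Sum>k<N. \<Sum>l<N. a k l) + (\<Sum>k<N. a k N) + ((\<Sum>l<N. a N l) + a N N)"
    by (simp add: sum.distrib)
  also have "\<dots> = (\<Sum>m<N. a m m + 2 * (\<Sum>k<m. a k m)) + (a N N + 2 * (\<Sum>k<N. a k N))"
    unfolding Suc e by (simp only: mult_2 ac_simps)
  finally show ?case by simp
qed simp

context trig_system
begin

text \<open>Cutting the orbit into periods of length \<open>P\<close> replaces \<open>A\<close> by
  its \<open>P\<close>-th power and \<open>g\<close> by a sum over the offsets in \<open>K\<close>.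
  Long blocks and short gaps are the two instances.\<close>

lemma block_system:
  assumes "finite K" and P: "0 < P"
  shows "trig_system (matrix_power A P) (q ^ P) (\<lambda>(i,k). c i) (\<lambda>(i,k). \<eta> i v* matrix_power A k) (I \<times> K)
           (\<lambda>x. \<Sum>k\<in>K. g (matrix_power A k *v x)) w C"
proof -
  interpret P: expanding_matrix "matrix_power A P" "q ^ P" by (rule power_expanding[OF P])
  show ?thesis
  proof unfold_locales
    show "trig_poly (\<lambda>(i,k). c i) (\<lambda>(i,k). \<eta> i v* matrix_power A k) (I \<times> K) x
      = complex_of_real (\<Sum>k\<in>K. g (matrix_power A k *v x))" for x
      unfolding of_real_sum real[symmetric] trig_poly_mult_vector
      unfolding trig_poly_def by (subst sum.swap) (simp add: sum.cartesian_product case_prod_unfold)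
    show "finite (I \<times> K)" using assms(1) fin by simp
    show "(case i of (i, k) \<Rightarrow> \<eta> i v* matrix_power A k) \<noteq> 0" if "i \<in> I \<times> K" for i
      using that nz row_nonzero by (cases i) auto
  qed (rule w_test, rule w_nonneg, rule w_pos)
qed

text \<open>The covariance depends on the time difference alone, because \<open>A^k\<close> is
  injective on rows and can be cancelled.\<close>

lemma pair_corr:
  "(\<Sum>i\<in>I. \<Sum>j\<in>I. c i * c j * of_bool (\<eta> i v* matrix_power A k + \<eta> j v* matrix_power A (k + n) = 0))
     = trig_corr c \<eta> I A n"
proof -
  have "\<eta> i v* matrix_power A k + \<eta> j v* matrix_power A (k + n)
      = (\<eta> i + \<eta> j v* matrix_power A n) v* matrix_power A k" for i j
    unfolding add.commute[of k n] matrix_power_add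
    by (simp add: vector_matrix_left_distrib vector_matrix_mul_assoc)
  then show ?thesis unfolding trig_corr_def by (simp add: row_eq_0_iff)
qed

text \<open>The variance of one block is the sum of all covariances inside it. Grouped by the larger
  index, these are Cesaro sums of the partial sums of \<open>trig_variance\<close>; dividing by the
  full period \<open>p + r\<close> instead of \<open>p\<close> does not change the limit.\<close>

lemma block_corr_tendsto:
  "(\<lambda>p. (\<Sum>k\<in>{r..<p + r}. \<Sum>l\<in>{r..<p + r}. \<Sum>i\<in>I. \<Sum>j\<in>I.
       c i * c j * of_bool (\<eta> i v* matrix_power A k + \<eta> j v* matrix_power A l = 0)) / of_nat (p + r))
     \<longlonglongrightarrow> complex_of_real variance"
proof -
  define \<rho> where "\<rho> = trig_corr c \<eta> I A"
  define a where "a k l = (\<Sum>i\<in>I. \<Sum>j\<in>I.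
       c i * c j * of_bool (\<eta> i v* matrix_power A k + \<eta> j v* matrix_power A l = 0))" for k l
  have sym: "a k l = a l k" for k l
    unfolding a_def by (subst sum.swap) (simp add: add.commute mult.commute)
  have a: "a k (k + n) = \<rho> n" for k n
    unfolding a_def \<rho>_def by (rule pair_corr)
  define d where "d m = \<rho> 0 + 2 * (\<Sum>n<m. \<rho> (Suc n))" for m
  have "(\<Sum>k\<in>{r..<p + r}. \<Sum>l\<in>{r..<p + r}. a k l) = (\<Sum>m<p. d m)" for p
  proof -
    have "(\<Sum>k\<in>{r..<p + r}. \<Sum>l\<in>{r..<p + r}. a k l) = (\<Sum>k<p. \<Sum>l<p. a (k + r) (l + r))"
      using sum.shift_bounds_nat_ivl[of "\<lambda>k. \<Sum>l<p. a k (l + r)" 0 r p]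
        sum.shift_bounds_nat_ivl[of "\<lambda>l. a k l" 0 r p for k]
      by (simp add: atLeast0LessThan)
    also have "\<dots> = (\<Sum>m<p. a (m + r) (m + r) + 2 * (\<Sum>k<m. a (k + r) (m + r)))"
      by (rule square_sum_symmetric) (rule sym)
    also have "\<dots> = (\<Sum>m<p. d m)"
    proof (rule sum.cong[OF refl])
      fix m
      have "(\<Sum>k<m. a (k + r) (m + r)) = (\<Sum>k<m. \<rho> (m - k))"
      proof (rule sum.cong[OF refl])
        fix k assume "k \<in> {..<m}"
        then have e: "k + r + (m - k) = m + r" by simp
        show "a (k + r) (m + r) = \<rho> (m - k)" using a[of "k + r" "m - k"] unfolding e .
      qed
      also have "\<dots> = (\<Sum>n<m. \<rho> (Suc n))"
        using sum.nat_diff_reindex[of "\<lambda>n. \<rho> (Suc n)" m] by (simp add: Suc_diff_Suc)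
      finally show "a (m + r) (m + r) + 2 * (\<Sum>k<m. a (k + r) (m + r)) = d m"
        using a[of "m + r" 0] by (simp add: d_def)
    qed
    finally show ?thesis .
  qed
  moreover have "(\<lambda>p. (\<Sum>m<p. d m) / of_nat (p + r)) \<longlonglongrightarrow> complex_of_real variance"
  proof -
    have "d \<longlonglongrightarrow> complex_of_real variance"
      unfolding d_def \<rho>_def variance_complex[symmetric] by (rule trig_corr_sums[OF fin nz])
    from cesaro_mean[OF this]
    have 1: "(\<lambda>p. (\<Sum>m<p. d m) / of_nat p) \<longlonglongrightarrow> complex_of_real variance"
      by (simp add: scaleR_conv_of_real field_simps)
    have "(\<lambda>p. real p / real (p + r)) \<longlonglongrightarrow> 1"
    proof -
      have "(\<lambda>p. 1 - real r * inverse (real (p + r))) \<longlonglongrightarrow> 1 - real r * 0"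
        by (intro tendsto_intros LIMSEQ_ignore_initial_segment[OF lim_inverse_n])
      moreover have "eventually (\<lambda>p. 1 - real r * inverse (real (p + r)) = real p / real (p + r)) sequentially"
        using eventually_gt_at_top[of 0] by eventually_elim (simp add: divide_simps)
      ultimately have "(\<lambda>p. real p / real (p + r)) \<longlonglongrightarrow> 1 - real r * 0"
        by (rule Lim_transform_eventually)
      then show ?thesis by simp
    qed
    from tendsto_mult[OF 1 tendsto_of_real[OF this]]
    have "(\<lambda>p. (\<Sum>m<p. d m) / of_nat p * complex_of_real (real p / real (p + r))) \<longlonglongrightarrow> complex_of_real variance"
      by simp
    moreover have "eventually (\<lambda>p. (\<Sum>m<p. d m) / of_nat p * complex_of_real (real p / real (p + r))
        = (\<Sum>m<p. d m) / of_nat (p + r)) sequentially"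
      using eventually_gt_at_top[of 0] by eventually_elim simp
    ultimately show ?thesis by (rule Lim_transform_eventually)
  qed
  ultimately show ?thesis unfolding a_def by simp
qed

end

lemma norm_cis_diff_le: "norm (cis a - cis b) \<le> \<bar>a - b\<bar>"
proof -
  have "cis a - cis b = cis b * (cis (a - b) - 1)"
    by (simp add: right_diff_distrib cis_mult)
  then show ?thesis
    using iexp_approx1[of "a - b" 0] by (simp add: norm_mult cis_conv_exp)
qed

text \<open>\<open>cis\<close> has Lipschitz constant 1, so Cauchy-Schwarz converts an error in
  L2(w) into an error of characteristic functions for all densities below \<open>w\<close>
  simultaneously.\<close>

lemma norm_char_diff_le:
  fixes \<psi> w u v :: "'a \<Rightarrow> real"
  assumes \<psi>: "integrable M \<psi>" and \<psi>w: "\<And>x. \<bar>\<psi> x\<bar> \<le> w x" and w: "integrable M w"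
    and [measurable]: "u \<in> borel_measurable M" "v \<in> borel_measurable M"
    and int: "integrable M (\<lambda>x. w x * (u x - v x)\<^sup>2)"
  shows "norm ((LINT x|M. complex_of_real (\<psi> x) * cis (u x)) - (LINT x|M. complex_of_real (\<psi> x) * cis (v x)))
     \<le> sqrt (LINT x|M. w x) * sqrt (LINT x|M. w x * (u x - v x)\<^sup>2)"
proof -
  have w_nonneg: "0 \<le> w x" for x using \<psi>w[of x] by linarith
  have [measurable]: "(\<lambda>x. cis (u x)) \<in> borel_measurable M" "(\<lambda>x. cis (v x)) \<in> borel_measurable M"
    using borel_measurable_cis by measurable
  have iu: "integrable M (\<lambda>x. complex_of_real (\<psi> x) * cis (u x))"
    and iv: "integrable M (\<lambda>x. complex_of_real (\<psi> x) * cis (v x))"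
    by (rule integrable_mult_bounded[OF \<psi>, of _ 1]; simp)+
  have "(LINT x|M. complex_of_real (\<psi> x) * cis (u x)) - (LINT x|M. complex_of_real (\<psi> x) * cis (v x))
      = (LINT x|M. complex_of_real (\<psi> x) * cis (u x) - complex_of_real (\<psi> x) * cis (v x))"
    using iu iv by simp
  also have "norm \<dots> \<le> (LINT x|M. norm (complex_of_real (\<psi> x) * cis (u x) - complex_of_real (\<psi> x) * cis (v x)))"
    by (rule integral_norm_bound)
  also have "\<dots> \<le> (LINT x|M. w x * \<bar>u x - v x\<bar>)"
  proof (rule integral_mono)
    show "integrable M (\<lambda>x. norm (complex_of_real (\<psi> x) * cis (u x) - complex_of_real (\<psi> x) * cis (v x)))"
      using iu iv by simp
    show "integrable M (\<lambda>x. w x * \<bar>u x - v x\<bar>)"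
      by (rule weighted_L1_le_L2(1)[OF _ w w_nonneg int]) simp
    show "norm (complex_of_real (\<psi> x) * cis (u x) - complex_of_real (\<psi> x) * cis (v x)) \<le> w x * \<bar>u x - v x\<bar>" for x
      unfolding right_diff_distrib[symmetric] norm_mult norm_of_real
      using \<psi>w[of x] w_nonneg[of x] norm_cis_diff_le[of "u x" "v x"] by (intro mult_mono) auto
  qed
  also have "\<dots> \<le> sqrt (LINT x|M. w x) * sqrt (LINT x|M. w x * (u x - v x)\<^sup>2)"
    by (rule weighted_L1_le_L2(2)[OF _ w w_nonneg int]) simp
  finally show ?thesis .
qed

lemma sum_Times: "(\<Sum>z\<in>A \<times> B. h z) = (\<Sum>x\<in>A. \<Sum>y\<in>B. h (x, y))"
  by (simp add: sum.cartesian_product)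

context trig_system
begin

text \<open>A period \<open>P = p + r\<close> consists of a gap of length \<open>r\<close> followed
  by a block of length \<open>p\<close>. The gap length depends on the frequencies only: it lifts
  all block frequencies above \<open>2 * B\<close>, while pulling them back through
  \<open>A^P\<close> keeps them below \<open>B\<close>, so the block sums are lacunary. With
  \<open>p\<close> fixed and \<open>N\<close> growing, the gaps cost a fixed amount per period, a
  share of order \<open>1 / P\<close>, which disappears as \<open>p\<close> grows.\<close>

theorem trig_clt:
  assumes \<psi>: "integrable lborel \<psi>" and \<psi>w: "\<And>x. \<bar>\<psi> x\<bar> \<le> w x"
  shows "(\<lambda>N. LINT x|lborel. complex_of_real (\<psi> x) * cis (t / sqrt (real N) * part_sum N x))
     \<longlonglongrightarrow> complex_of_real ((LINT x|lborel. \<psi> x) * exp (- (t\<^sup>2 * variance / 2)))"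
proof -
  obtain m where m: "0 < m" "\<And>i. i \<in> I \<Longrightarrow> m \<le> norm (\<eta> i)"
  proof (cases "I = {}")
    case False
    then show ?thesis using fin nz
      by (intro that[of "Min ((\<lambda>i. norm (\<eta> i)) ` I)"]) (auto simp: Min_gr_iff)
  qed (use that[of 1] in auto)
  define B where "B = 1 + (\<Sum>i\<in>I. norm (\<eta> i))"
  have B: "0 < B" unfolding B_def by (simp add: add_pos_nonneg sum_nonneg)
  have \<eta>B: "norm (\<eta> i) < B" if "i \<in> I" for i
    unfolding B_def using member_le_sum[of i I "\<lambda>i. norm (\<eta> i)"] that fin by auto
  \<comment> \<open>The first entry moves every frequency beyond \<open>2 * B\<close> after
    \<open>r\<close> steps; the second makes the expansion factor of a whole period at least
    8.\<close>
  obtain r where r: "max (2 * B / m) 8 < q ^ r" using real_arch_pow[OF q_gt_1] by blast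
  have rB: "2 * B \<le> q ^ k * m" if "r \<le> k" for k
  proof -
    have "2 * B / m \<le> q ^ k" using r power_increasing[OF that, of q] q_gt_1 by linarith
    then show ?thesis using m by (simp add: field_simps)
  qed
  have far: "2 * B \<le> norm (\<eta> i v* matrix_power A k)" if "i \<in> I" "r \<le> k" for i k
  proof -
    have "2 * B \<le> q ^ k * norm (\<eta> i)"
      using rB[OF that(2)] mult_left_mono[OF m(2)[OF that(1)], of "q ^ k"] q_power_ge_1[of k] by linarith
    then show ?thesis using row_expands_power[of k "\<eta> i"] by linarith
  qed
  have "0 < r" using r by (cases r) auto
  define M where "M = (\<Sum>i\<in>I. norm (c i))"
  define W where "W = (LINT x|lborel. w x)"
  define KG where "KG = (real r * M)\<^sup>2"
  have M: "0 \<le> M" by (simp add: M_def sum_nonneg)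
  define cr where "cr p = Re (\<Sum>k\<in>{r..<p + r}. \<Sum>l\<in>{r..<p + r}. \<Sum>i\<in>I. \<Sum>j\<in>I.
       c i * c j * of_bool (\<eta> i v* matrix_power A k + \<eta> j v* matrix_power A l = 0))" for p
  define y where "y p N = (LINT x|lborel. complex_of_real (\<psi> x) *
       cis (t / sqrt (real N) * (\<Sum>j<N div (p + r). \<Sum>k\<in>{r..<p + r}.
         g (matrix_power A k *v (matrix_power (matrix_power A (p + r)) j *v x)))))" for p N
  define L where "L p = complex_of_real ((LINT x|lborel. \<psi> x) * exp (- (t\<^sup>2 / real (p + r) * cr p / 2)))" for p
  \<comment> \<open>The square root bounds the normalised L2(w) norm of what the blocks omit. The
    factor 2 at \<open>W * KG\<close> stems from splitting the square of gaps plus final remainder;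
    of the additional 2, one half is the doubled slack \<open>1 / 2\<close> in the gap moment, the
    other the incomplete last period.\<close>
  define \<delta> where "\<delta> p = \<bar>t\<bar> * sqrt W * sqrt ((2 * W * KG + 2) * inverse (real (p + r)))" for p
  show ?thesis
  proof (rule double_limit[of r y L _ \<delta>])
    fix p assume p: "r \<le> p"
    define P where "P = p + r"
    have P: "0 < P" "r \<le> P" using \<open>0 < r\<close> by (auto simp: P_def)
    define D where "D = matrix_power A P"
    interpret E: expanding_matrix D "q ^ P" unfolding D_def by (rule power_expanding[OF P(1)])
    interpret Y: trig_system D "q ^ P" "\<lambda>(i,k). c i" "\<lambda>(i,k). \<eta> i v* matrix_power A k" "I \<times> {r..<P}"
        "\<lambda>x. \<Sum>k\<in>{r..<P}. g (matrix_power A k *v x)" w C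
      unfolding D_def by (rule block_system[OF _ P(1)]) simp
    interpret G: trig_system D "q ^ P" "\<lambda>(i,k). c i" "\<lambda>(i,k). \<eta> i v* matrix_power A k" "I \<times> {..<r}"
        "\<lambda>x. \<Sum>k\<in>{..<r}. g (matrix_power A k *v x)" w C
      unfolding D_def by (rule block_system[OF _ P(1)]) simp
    have n: "filterlim (\<lambda>N. N div P) at_top sequentially"
      unfolding filterlim_at_top
    proof
      fix Z
      show "eventually (\<lambda>N. Z \<le> N div P) sequentially"
        using eventually_ge_at_top[of "Z * P"]
        by eventually_elim (use P div_le_mono[of "Z * P" _ P] in auto)
    qed
    have \<tau>n: "(\<lambda>N. (t / sqrt (real N))\<^sup>2 * real (N div P)) \<longlonglongrightarrow> t\<^sup>2 / real P"
    proof -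
      have lim: "(\<lambda>N. real (N mod P) * inverse (real N)) \<longlonglongrightarrow> 0"
      proof (rule Lim_null_comparison)
        show "eventually (\<lambda>N. norm (real (N mod P) * inverse (real N)) \<le> real P * inverse (real N)) sequentially"
        proof (intro always_eventually allI)
          fix N
          have "real (N mod P) \<le> real P" using mod_less_divisor[OF P(1), of N] by simp
          then have "real (N mod P) * inverse (real N) \<le> real P * inverse (real N)" by (intro mult_right_mono) auto
          then show "norm (real (N mod P) * inverse (real N)) \<le> real P * inverse (real N)" by simp
        qed
        show "(\<lambda>N. real P * inverse (real N)) \<longlonglongrightarrow> 0"
          using tendsto_mult_left[OF lim_inverse_n, of "real P"] by simp
      qed
      have "(\<lambda>N. t\<^sup>2 / real P * (1 - real (N mod P) * inverse (real N))) \<longlonglongrightarrow> t\<^sup>2 / real P * (1 - 0)"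
        by (intro tendsto_intros lim)
      moreover have "eventually (\<lambda>N. t\<^sup>2 / real P * (1 - real (N mod P) * inverse (real N))
           = (t / sqrt (real N))\<^sup>2 * real (N div P)) sequentially"
        using eventually_gt_at_top[of 0]
      proof eventually_elim
        case (elim N)
        have "real N = real P * real (N div P) + real (N mod P)"
          by (metis mult_div_mod_eq of_nat_add of_nat_mult)
        then have "real (N mod P) = real N - real P * real (N div P)" by simp
        then show ?case using elim P by (simp add: power_divide divide_simps)
      qed
      ultimately have "(\<lambda>N. (t / sqrt (real N))\<^sup>2 * real (N div P)) \<longlonglongrightarrow> t\<^sup>2 / real P * (1 - 0)"
        by (rule Lim_transform_eventually)
      then show ?thesis by simp
    qed
    \<comment> \<open>For \<open>k < P\<close> the row \<open>\<eta> i v* A^k\<close> is the image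
      under \<open>A^P\<close> of the preimage of \<open>\<eta> i\<close> under
      \<open>A^(P - k)\<close>, which is no longer than \<open>\<eta> i\<close>.\<close>
    have inv_ex: "\<exists>u. \<eta> i v* matrix_power A k = u v* D \<and> norm u \<le> B" if "i \<in> I" "k < P" for i k
    proof -
      obtain u where u: "\<eta> i = u v* matrix_power A (P - k)" "norm u \<le> norm (\<eta> i) / q ^ (P - k)"
        using row_inverse_ex by blast
      have "\<eta> i v* matrix_power A k = u v* D"
        using that by (subst u(1)) (simp add: vector_matrix_mul_assoc matrix_power_add[symmetric] D_def)
      moreover have "norm (\<eta> i) / q ^ (P - k) \<le> norm (\<eta> i) / 1"
        using q_power_ge_1 q_gt_1 by (intro divide_left_mono) auto
      ultimately show ?thesis using u(2) \<eta>B[OF that(1)] by (intro exI[of _ u]) auto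
    qed
    define uu where "uu z = (SOME u. \<eta> (fst z) v* matrix_power A (snd z) = u v* D \<and> norm u \<le> B)" for z
    have uu: "\<eta> (fst z) v* matrix_power A (snd z) = uu z v* D \<and> norm (uu z) \<le> B" if "z \<in> I \<times> {r..<P}" for z
      unfolding uu_def by (rule someI_ex, rule inv_ex) (use that in auto)
    have q8: "8 \<le> q ^ P"
      using r power_increasing[OF P(2), of q] q_gt_1 by linarith
    have lim: "(\<lambda>N. LINT x|lborel. complex_of_real (\<psi> x) * cis (t / sqrt (real N) * Y.part_sum (N div P) x))
       \<longlonglongrightarrow> complex_of_real ((LINT x|lborel. \<psi> x) * exp (- (t\<^sup>2 / real P * Y.corr0 / 2)))"
    proof (rule Y.lacunary_clt[OF q8 B _ _ \<psi> \<psi>w n \<tau>n])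
      show "(case z of (i, k) \<Rightarrow> \<eta> i v* matrix_power A k) = uu z v* D \<and> norm (uu z) \<le> B"
        if "z \<in> I \<times> {r..<P}" for z using uu[OF that] by (simp add: case_prod_unfold)
      show "2 * B \<le> norm (case z of (i, k) \<Rightarrow> \<eta> i v* matrix_power A k)" if "z \<in> I \<times> {r..<P}" for z
        unfolding case_prod_unfold by (rule far) (use that in auto)
    qed
    have "Y.corr0 = cr p"
    proof -
      have "trig_corr (\<lambda>(i,k). c i) (\<lambda>(i,k). \<eta> i v* matrix_power A k) (I \<times> {r..<P}) D 0
        = (\<Sum>i\<in>I. \<Sum>k\<in>{r..<P}. \<Sum>j\<in>I. \<Sum>l\<in>{r..<P}.
             c i * c j * of_bool (\<eta> i v* matrix_power A k + \<eta> j v* matrix_power A l = 0))"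
        unfolding trig_corr_def sum_Times by simp
      also have "\<dots> = (\<Sum>k\<in>{r..<P}. \<Sum>i\<in>I. \<Sum>l\<in>{r..<P}. \<Sum>j\<in>I.
             c i * c j * of_bool (\<eta> i v* matrix_power A k + \<eta> j v* matrix_power A l = 0))"
        by (subst sum.swap, rule sum.cong[OF refl], rule sum.cong[OF refl], rule sum.swap)
      also have "\<dots> = (\<Sum>k\<in>{r..<P}. \<Sum>l\<in>{r..<P}. \<Sum>i\<in>I. \<Sum>j\<in>I.
             c i * c j * of_bool (\<eta> i v* matrix_power A k + \<eta> j v* matrix_power A l = 0))"
        by (rule sum.cong[OF refl], rule sum.swap)
      finally show ?thesis unfolding Y.corr0_def cr_def by (simp only: P_def)
    qed
    note corr0_eq = this
    have y_eq: "y p N = (LINT x|lborel. complex_of_real (\<psi> x) * cis (t / sqrt (real N) * Y.part_sum (N div P) x))" for N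
      unfolding y_def P_def[symmetric] D_def[symmetric] Y.part_sum_def ..
    have L_eq: "L p = complex_of_real ((LINT x|lborel. \<psi> x) * exp (- (t\<^sup>2 / real P * cr p / 2)))"
      unfolding L_def P_def ..
    have "y p = (\<lambda>N. LINT x|lborel. complex_of_real (\<psi> x) * cis (t / sqrt (real N) * Y.part_sum (N div P) x))"
      by (rule ext) (rule y_eq)
    then show "y p \<longlonglongrightarrow> L p" using lim unfolding corr0_eq L_eq by (simp only:)
    \<comment> \<open>As \<open>r \<le> p\<close>, gaps of different periods are more than
      \<open>r\<close> steps apart. A frequency of the later one would have outgrown every
      \<open>\<eta> i\<close>, so no cancellation is possible and only the covariance within one gap
      is left.\<close>
    have gap: "G.variance \<le> KG"
    proof -
      let ?tc = "trig_corr (\<lambda>(i,k). c i) (\<lambda>(i,k). \<eta> i v* matrix_power A k) (I \<times> {..<r}) D"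
      have "?tc (Suc n) = 0" for n
      proof -
        have "\<eta> i v* matrix_power A k + (\<eta> j v* matrix_power A l) v* matrix_power D (Suc n) \<noteq> 0"
          if "i \<in> I" "j \<in> I" "k < r" "l < r" for i j k l
        proof
          assume zero: "\<eta> i v* matrix_power A k + (\<eta> j v* matrix_power A l) v* matrix_power D (Suc n) = 0"
          define e where "e = l + P * Suc n - k"
          have "p + r \<le> P * Suc n" by (simp add: P_def)
          then have e: "l + P * Suc n = e + k" "r \<le> e" using that p by (auto simp: e_def)
          have "(\<eta> j v* matrix_power A l) v* matrix_power D (Suc n) = \<eta> j v* matrix_power A (l + P * Suc n)"
            unfolding D_def matrix_power_mult matrix_power_add vector_matrix_mul_assoc ..
          also have "\<dots> = (\<eta> j v* matrix_power A e) v* matrix_power A k"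
            by (simp only: e(1) matrix_power_add vector_matrix_mul_assoc)
          finally have "(\<eta> i + \<eta> j v* matrix_power A e) v* matrix_power A k = 0"
            using zero by (simp add: vector_matrix_left_distrib)
          then have "\<eta> j v* matrix_power A e = - \<eta> i"
            by (simp add: row_eq_0_iff add_eq_0_iff)
          then have "2 * B \<le> norm (\<eta> i)" using far[OF that(2) e(2)] by simp
          then show False using \<eta>B[OF that(1)] B by linarith
        qed
        then show ?thesis unfolding trig_corr_def by (intro sum.neutral ballI) auto
      qed
      then have "trig_variance (\<lambda>(i,k). c i) (\<lambda>(i,k). \<eta> i v* matrix_power A k) (I \<times> {..<r}) D = ?tc 0"
        by (simp add: trig_variance_def)
      then have "G.variance \<le> norm (?tc 0)" unfolding G.variance_def by (simp add: complex_Re_le_cmod)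
      also have "\<dots> \<le> (\<Sum>z\<in>I \<times> {..<r}. \<Sum>z'\<in>I \<times> {..<r}. norm (c (fst z)) * norm (c (fst z')))"
        unfolding trig_corr_def by (intro sum_norm_le) (auto simp: norm_mult of_bool_def)
      also have "\<dots> = (\<Sum>z\<in>I \<times> {..<r}. norm (c (fst z)))\<^sup>2"
        by (simp add: power2_eq_square sum_product)
      also have "(\<Sum>z\<in>I \<times> {..<r}. norm (c (fst z))) = real r * M"
        unfolding M_def by (simp add: sum.cartesian_product[symmetric, of "\<lambda>i k. norm (c i)", unfolded case_prod_unfold] sum_distrib_left)
      finally show ?thesis by (simp add: KG_def)
    qed
    define dd where "dd N x = part_sum N x - Y.part_sum (N div P) x" for N x
    have [measurable]: "dd N \<in> borel_measurable borel" for N unfolding dd_def by simp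
    \<comment> \<open>The blocks omit the gaps and, when \<open>N\<close> is not a multiple of
      \<open>P\<close>, the incomplete period at the end.\<close>
    have dd_eq: "dd N x = G.part_sum (N div P) x + (\<Sum>k\<in>{N div P * P..<N}. g (matrix_power A k *v x))" for N x
    proof -
      define f where "f k = g (matrix_power A k *v x)" for k
      have "part_sum N x = (\<Sum>k<N div P * P. f k) + (\<Sum>k\<in>{N div P * P..<N}. f k)"
        unfolding part_sum_def f_def[symmetric]
        by (subst sum.atLeastLessThan_concat[of 0 "N div P * P" N f, symmetric, unfolded atLeast0LessThan]) auto
      also have "(\<Sum>k<N div P * P. f k) = (\<Sum>j<N div P. \<Sum>k\<in>{j * P..<j * P + P}. f k)"
        by (rule sum.nat_group[symmetric])
      also have "\<dots> = (\<Sum>j<N div P. (\<Sum>k<r. f (j * P + k)) + (\<Sum>k\<in>{r..<P}. f (j * P + k)))"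
      proof (rule sum.cong[OF refl])
        fix j
        have "(\<Sum>k\<in>{j * P..<j * P + P}. f k) = (\<Sum>k\<in>{0..<P}. f (k + j * P))"
          using sum.shift_bounds_nat_ivl[of f 0 "j * P" P] by (simp add: add.commute)
        also have "\<dots> = (\<Sum>k\<in>{0..<r}. f (k + j * P)) + (\<Sum>k\<in>{r..<P}. f (k + j * P))"
          using P(2) by (intro sum.atLeastLessThan_concat[symmetric]) auto
        finally show "(\<Sum>k\<in>{j * P..<j * P + P}. f k) = (\<Sum>k<r. f (j * P + k)) + (\<Sum>k\<in>{r..<P}. f (j * P + k))"
          by (simp add: atLeast0LessThan add.commute)
      qed
      also have "\<dots> = G.part_sum (N div P) x + Y.part_sum (N div P) x"
      proof -
        have "f (j * P + k) = g (matrix_power A k *v (matrix_power D j *v x))" for j k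
          unfolding f_def D_def matrix_power_mult matrix_vector_mul_assoc matrix_power_add[symmetric]
          by (simp add: mult.commute add.commute)
        then show ?thesis by (simp add: G.part_sum_def Y.part_sum_def sum.distrib)
      qed
      finally show ?thesis by (simp add: dd_def f_def)
    qed
    have rem: "\<bar>\<Sum>k\<in>{N div P * P..<N}. g (matrix_power A k *v x)\<bar> \<le> real P * M" for N x
    proof -
      have "\<bar>\<Sum>k\<in>{N div P * P..<N}. g (matrix_power A k *v x)\<bar> \<le> (\<Sum>k\<in>{N div P * P..<N}. M)"
        unfolding M_def by (rule order_trans[OF sum_abs]) (intro sum_mono g_bound)
      also have "\<dots> = real (N mod P) * M" by (simp add: minus_div_mult_eq_mod)
      also have "\<dots> \<le> real P * M" using P M mod_less_divisor[of P N] by (intro mult_right_mono) auto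
      finally show ?thesis .
    qed
    have dd_bound: "(LINT x|lborel. w x * (dd N x)\<^sup>2)
       \<le> 2 * (LINT x|lborel. w x * (G.part_sum (N div P) x)\<^sup>2) + 2 * (real P * M)\<^sup>2 * W" for N
    proof -
      have "(LINT x|lborel. w x * (dd N x)\<^sup>2)
         \<le> (LINT x|lborel. 2 * (w x * (G.part_sum (N div P) x)\<^sup>2) + 2 * (real P * M)\<^sup>2 * w x)"
      proof (rule integral_mono')
        show "integrable lborel (\<lambda>x. 2 * (w x * (G.part_sum (N div P) x)\<^sup>2) + 2 * (real P * M)\<^sup>2 * w x)"
          by (intro Bochner_Integration.integrable_add integrable_mult_right G.part_sum_square_integrable w_integrable)
        show "w x * (dd N x)\<^sup>2 \<le> 2 * (w x * (G.part_sum (N div P) x)\<^sup>2) + 2 * (real P * M)\<^sup>2 * w x" for x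
        proof -
          define a b where "a = G.part_sum (N div P) x" and "b = (\<Sum>k\<in>{N div P * P..<N}. g (matrix_power A k *v x))"
          have "(dd N x)\<^sup>2 \<le> 2 * a\<^sup>2 + 2 * b\<^sup>2"
            unfolding dd_eq a_def[symmetric] b_def[symmetric]
            using sum_squares_bound[of a b] by (simp add: power2_sum)
          also have "b\<^sup>2 \<le> (real P * M)\<^sup>2" unfolding b_def using power_mono[OF rem[of x N], of 2] by simp
          finally have "(dd N x)\<^sup>2 \<le> 2 * a\<^sup>2 + 2 * (real P * M)\<^sup>2" by simp
          from mult_left_mono[OF this w_nonneg[of x]] show ?thesis by (simp add: a_def algebra_simps)
        qed
      qed (use w_nonneg in auto)
      also have "\<dots> = 2 * (LINT x|lborel. w x * (G.part_sum (N div P) x)\<^sup>2) + 2 * (real P * M)\<^sup>2 * W"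
        unfolding W_def using G.part_sum_square_integrable w_integrable by simp
      finally show ?thesis .
    qed
    have ev1: "eventually (\<lambda>N. (LINT x|lborel. w x * (G.part_sum (N div P) x)\<^sup>2) / real (N div P) < W * KG + 1 / 2) sequentially"
    proof -
      have "W * G.variance < W * KG + 1 / 2"
      proof -
        have "W * G.variance \<le> W * KG" using gap w_pos by (intro mult_left_mono) (auto simp: W_def)
        then show ?thesis by simp
      qed
      then show ?thesis
        using filterlim_compose[OF G.second_moment n] unfolding W_def by (rule order_tendstoD(2)[rotated])
    qed
    have ev2: "eventually (\<lambda>N. real P * (2 * (real P * M)\<^sup>2 * W) \<le> real N) sequentially"
      using eventually_ge_at_top[of "nat \<lceil>real P * (2 * (real P * M)\<^sup>2 * W)\<rceil>"] by eventually_elim linarith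
    show "eventually (\<lambda>N. norm ((LINT x|lborel. complex_of_real (\<psi> x) * cis (t / sqrt (real N) * part_sum N x)) - y p N)
        \<le> \<delta> p) sequentially"
      using ev1 ev2 eventually_ge_at_top[of P]
    proof eventually_elim
      case (elim N)
      have N: "0 < N" "0 < N div P" using elim(3) P by (auto simp: div_greater_zero_iff)
      have intd: "integrable lborel (\<lambda>x. w x * (dd N x)\<^sup>2)"
      proof (rule integrable_bounded_square)
        show "\<bar>dd N x\<bar> \<le> real N * (\<Sum>i\<in>I. norm (c i)) + real (N div P) * (\<Sum>i\<in>I \<times> {r..<P}. norm (case i of (i,k) \<Rightarrow> c i))" for x
          unfolding dd_def using part_sum_bound[of N x] Y.part_sum_bound[of "N div P" x] by linarith
      qed simp
      have sc: "w x * (t / sqrt (real N) * part_sum N x - t / sqrt (real N) * Y.part_sum (N div P) x)\<^sup>2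
         = t\<^sup>2 / real N * (w x * (dd N x)\<^sup>2)" for x
        unfolding right_diff_distrib[symmetric] dd_def[symmetric] by (simp add: power_mult_distrib power_divide)
      have "norm ((LINT x|lborel. complex_of_real (\<psi> x) * cis (t / sqrt (real N) * part_sum N x)) - y p N)
         \<le> sqrt W * sqrt (LINT x|lborel. w x * (t / sqrt (real N) * part_sum N x - t / sqrt (real N) * Y.part_sum (N div P) x)\<^sup>2)"
      proof -
        have "integrable lborel (\<lambda>x. w x * (t / sqrt (real N) * part_sum N x - t / sqrt (real N) * Y.part_sum (N div P) x)\<^sup>2)"
          unfolding sc using intd by simp
        note norm_char_diff_le[OF \<psi> \<psi>w w_integrable _ _ this]
        then show ?thesis unfolding W_def y_eq by simp
      qed
      also have "\<dots> = \<bar>t\<bar> * sqrt W * sqrt ((LINT x|lborel. w x * (dd N x)\<^sup>2) / real N)"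
        unfolding sc by (simp add: real_sqrt_mult real_sqrt_divide)
      also have "\<dots> \<le> \<bar>t\<bar> * sqrt W * sqrt ((2 * W * KG + 2) * inverse (real P))"
      proof (intro mult_left_mono real_sqrt_le_mono)
        have nP: "real (N div P) * real P \<le> real N"
          by (metis div_times_less_eq_dividend of_nat_le_iff of_nat_mult)
        have pos: "0 \<le> W * KG" using w_pos by (simp add: W_def KG_def)
        have "(LINT x|lborel. w x * (G.part_sum (N div P) x)\<^sup>2) \<le> (W * KG + 1 / 2) * real (N div P)"
          using elim(1) N by (simp add: field_simps)
        also have "\<dots> \<le> (W * KG + 1 / 2) * (real N / real P)"
          using nP pos P by (intro mult_left_mono) (auto simp: field_simps)
        finally have 1: "(LINT x|lborel. w x * (G.part_sum (N div P) x)\<^sup>2) \<le> (W * KG + 1 / 2) * (real N / real P)" .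
        have 2: "2 * (real P * M)\<^sup>2 * W \<le> real N / real P" using elim(2) P by (simp add: field_simps)
        have "(LINT x|lborel. w x * (dd N x)\<^sup>2) \<le> (2 * W * KG + 2) * (real N / real P)"
        proof -
          define y where "y = real N / real P"
          have "(2 * W * KG + 2) * y = 2 * ((W * KG + 1 / 2) * y) + y" by (simp add: algebra_simps)
          then show ?thesis using dd_bound[of N] 1 2 unfolding y_def[symmetric] by linarith
        qed
        note le = this
        have eq: "(2 * W * KG + 2) * (real N / real P) / real N = (2 * W * KG + 2) * inverse (real P)"
          using N P by (simp add: divide_inverse)
        show "(LINT x|lborel. w x * (dd N x)\<^sup>2) / real N \<le> (2 * W * KG + 2) * inverse (real P)"
          using divide_right_mono[OF le, of "real N"] unfolding eq by simp
      qed (use w_pos in \<open>simp add: W_def\<close>)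
      finally show ?case by (simp add: \<delta>_def P_def)
    qed
  next
    have inv: "(\<lambda>p. inverse (real (p + r))) \<longlonglongrightarrow> 0"
      by (rule LIMSEQ_ignore_initial_segment[OF lim_inverse_n])
    have "\<delta> \<longlonglongrightarrow> \<bar>t\<bar> * sqrt W * sqrt ((2 * W * KG + 2) * 0)"
      unfolding \<delta>_def by (intro tendsto_intros inv)
    then show "\<delta> \<longlonglongrightarrow> 0" by simp
    have "(\<lambda>p. cr p / real (p + r)) \<longlonglongrightarrow> variance"
      using tendsto_Re[OF block_corr_tendsto[of r]] unfolding cr_def Re_divide_of_nat Re_complex_of_real .
    then have "(\<lambda>p. complex_of_real ((LINT x|lborel. \<psi> x) * exp (- (t\<^sup>2 * (cr p / real (p + r)) / 2))))
       \<longlonglongrightarrow> complex_of_real ((LINT x|lborel. \<psi> x) * exp (- (t\<^sup>2 * variance / 2)))"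
      by (intro tendsto_intros) simp_all
    then show "L \<longlonglongrightarrow> complex_of_real ((LINT x|lborel. \<psi> x) * exp (- (t\<^sup>2 * variance / 2)))"
      unfolding L_def by simp
  qed
qed

end

section \<open>A band-limited weight\<close>

text \<open>The Fejer kernel up to scaling; its Fourier transform is a triangle function supported
  in [-1, 1]. The value at 0 is the continuous extension.\<close>

definition fejer :: "real \<Rightarrow> real" where
  "fejer y = (if y = 0 then 1 / 2 else (1 - cos y) / y\<^sup>2)"

lemma fejer_measurable [measurable]: "fejer \<in> borel_measurable borel"
  unfolding fejer_def[abs_def] by measurable

lemma fejer_nonneg: "0 \<le> fejer y"
  by (simp add: fejer_def)

lemma fejer_minus [simp]: "fejer (- y) = fejer y"
  by (simp add: fejer_def)

lemma cos_lower: "1 - y\<^sup>2 / 2 \<le> cos (y::real)"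
proof -
  have "(sin (y / 2))\<^sup>2 \<le> (y / 2)\<^sup>2"
    by (rule abs_le_square_iff[THEN iffD1, OF abs_sin_x_le_abs_x])
  then show ?thesis using cos_double_sin[of "y / 2"] by (simp add: power_divide)
qed

lemma fejer_le: "fejer y \<le> 3 / (1 + y\<^sup>2)"
proof (cases "y = 0")
  case False
  have "(1 - cos y) * y\<^sup>2 \<le> 2 * y\<^sup>2" using cos_ge_minus_one[of y] by (intro mult_right_mono) auto
  moreover have "1 - cos y \<le> y\<^sup>2 / 2" using cos_lower[of y] by simp
  ultimately have "(1 - cos y) * (1 + y\<^sup>2) \<le> 3 * y\<^sup>2"
    using zero_le_power2[of y] unfolding distrib_left mult_1_right by linarith
  moreover have "0 < 1 + y\<^sup>2" by (simp add: add_pos_nonneg)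
  ultimately show ?thesis using False by (simp add: fejer_def divide_le_eq pos_le_divide_eq mult.commute)
qed (simp add: fejer_def)

lemma fejer_ge: "\<bar>y\<bar> \<le> 1 \<Longrightarrow> 1 / 4 \<le> fejer y"
proof -
  assume y: "\<bar>y\<bar> \<le> 1"
  show "1 / 4 \<le> fejer y"
  proof (cases "y = 0")
    case False
    have "\<bar>cos y - (1 - y\<^sup>2 / 2)\<bar> \<le> \<bar>y\<bar> ^ 4 / 24"
    proof -
      have "\<bar>Re (iexp y - (\<Sum>k\<le>3. (\<i> * y) ^ k / fact k))\<bar> \<le> \<bar>y\<bar> ^ 4 / 24"
        using iexp_approx1[of y 3] by (intro order_trans[OF abs_Re_le_cmod]) (simp add: eval_nat_numeral fact_numeral)
      moreover have "Re (iexp y - (\<Sum>k\<le>3. (\<i> * y) ^ k / fact k)) = cos y - (1 - y\<^sup>2 / 2)"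
        by (simp add: eval_nat_numeral power2_eq_square cis_conv_exp[symmetric])
      ultimately show ?thesis by simp
    qed
    moreover have "\<bar>y\<bar> ^ 4 \<le> y\<^sup>2"
      using power_decreasing[of 2 4 "\<bar>y\<bar>"] y by simp
    ultimately have "y\<^sup>2 / 4 \<le> 1 - cos y"
      using zero_le_power2[of y] by linarith
    then show ?thesis using False by (simp add: fejer_def field_simps)
  qed (simp add: fejer_def)
qed

lemma integrable_inverse_square: "integrable lborel (\<lambda>y::real. inverse (1 + y\<^sup>2))"
  using integrable_inverse_1_plus_square by (simp add: set_integrable_def)

lemma fejer_integrable: "integrable lborel fejer"
proof (rule Bochner_Integration.integrable_bound[OF integrable_mult_right[OF integrable_inverse_square, of 3]])
  show "AE y in lborel. norm (fejer y) \<le> norm (3 * inverse (1 + y\<^sup>2))"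
    using fejer_le fejer_nonneg by (intro AE_I2) (simp add: divide_inverse abs_of_nonneg)
qed simp

text \<open>The addition formula turns \<open>fejer y * cos (\<eta> * y)\<close> into half the
  second difference, in the parameter \<open>a\<close> with step 1, of
  \<open>(1 - cos (a * y)) / y^2\<close>. By scaling, that function has an integral proportional to
  \<open>|a|\<close>, whose second difference at \<open>\<eta>\<close> vanishes away from the kink
  at 0.\<close>

lemma fejer_cos_integral:
  assumes "1 \<le> \<bar>\<eta>\<bar>" shows "(LINT y|lborel. fejer y * cos (\<eta> * y)) = 0"
proof -
  define u where "u a y = a\<^sup>2 * fejer (a * y)" for a y
  have u_int: "integrable lborel (u a)" and u: "(LINT y|lborel. u a y) = \<bar>a\<bar> * (LINT y|lborel. fejer y)" for a
  proof -
    show "integrable lborel (u a)"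
      using lborel_integrable_real_affine[OF fejer_integrable, of a 0] by (cases "a = 0") (auto simp: u_def[abs_def])
    show "(LINT y|lborel. u a y) = \<bar>a\<bar> * (LINT y|lborel. fejer y)"
    proof (cases "a = 0")
      case False
      then show ?thesis
        using lborel_integral_real_affine[OF False, of fejer 0] by (simp add: u_def power2_eq_square abs_mult_self_eq)
    qed (simp add: u_def)
  qed
  have u_val: "u a y = (1 - cos (a * y)) / y\<^sup>2" if "y \<noteq> 0" for a y
    using that by (simp add: u_def fejer_def power_mult_distrib)
  have eq: "fejer y * cos (\<eta> * y) = - u \<eta> y + u (\<eta> + 1) y / 2 + u (\<eta> - 1) y / 2" if "y \<noteq> 0" for y
  proof -
    have "cos y * cos (\<eta> * y) = (cos ((\<eta> + 1) * y) + cos ((\<eta> - 1) * y)) / 2"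
      by (simp add: distrib_right left_diff_distrib cos_add cos_diff)
    then have "fejer y * cos (\<eta> * y) = (cos (\<eta> * y) - (cos ((\<eta> + 1) * y) + cos ((\<eta> - 1) * y)) / 2) / y\<^sup>2"
      using that by (simp add: fejer_def left_diff_distrib)
    also have "\<dots> = - u \<eta> y + u (\<eta> + 1) y / 2 + u (\<eta> - 1) y / 2"
      unfolding u_val[OF that] using that by (simp add: divide_simps)
    finally show ?thesis .
  qed
  have "(LINT y|lborel. fejer y * cos (\<eta> * y)) = (LINT y|lborel. - u \<eta> y + u (\<eta> + 1) y / 2 + u (\<eta> - 1) y / 2)"
  proof (rule integral_cong_AE)
    show "AE y in lborel. fejer y * cos (\<eta> * y) = - u \<eta> y + u (\<eta> + 1) y / 2 + u (\<eta> - 1) y / 2"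
      using AE_lborel_singleton[of "0::real"] by eventually_elim (rule eq)
  qed (simp_all add: u_def)
  also have "\<dots> = (- \<bar>\<eta>\<bar> + \<bar>\<eta> + 1\<bar> / 2 + \<bar>\<eta> - 1\<bar> / 2) * (LINT y|lborel. fejer y)"
    using u_int by (simp add: u algebra_simps)
  also have "- \<bar>\<eta>\<bar> + \<bar>\<eta> + 1\<bar> / 2 + \<bar>\<eta> - 1\<bar> / 2 = 0" using assms by (auto simp: abs_if field_simps split: if_splits)
  finally show ?thesis by simp
qed

lemma fejer_fourier:
  assumes "1 \<le> \<bar>\<eta>\<bar>" shows "(LINT y|lborel. complex_of_real (fejer y) * cis (\<eta> * y)) = 0"
proof -
  have ic: "integrable lborel (\<lambda>y. fejer y * cos (\<eta> * y))" and isn: "integrable lborel (\<lambda>y. fejer y * sin (\<eta> * y))"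
    by (rule integrable_weight_bounded[OF fejer_integrable, of _ 1]; simp)+
  have "(LINT y|lborel. fejer y * sin (\<eta> * y)) = - (LINT y|lborel. fejer y * sin (\<eta> * y))"
    using lborel_integral_real_affine[of "-1" "\<lambda>y. fejer y * sin (\<eta> * y)" 0] by simp
  then have s: "(LINT y|lborel. fejer y * sin (\<eta> * y)) = 0" by simp
  have "complex_of_real (fejer y) * cis (\<eta> * y)
     = complex_of_real (fejer y * cos (\<eta> * y)) + \<i> * complex_of_real (fejer y * sin (\<eta> * y))" for y
    by (simp add: complex_eq_iff)
  then have "(LINT y|lborel. complex_of_real (fejer y) * cis (\<eta> * y))
     = complex_of_real (LINT y|lborel. fejer y * cos (\<eta> * y)) + \<i> * complex_of_real (LINT y|lborel. fejer y * sin (\<eta> * y))"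
    using ic isn by (simp del: of_real_mult)
  then show ?thesis using fejer_cos_integral[OF assms] s by simp
qed

lemma lborel_tensor:
  fixes u :: "'d::finite \<Rightarrow> real \<Rightarrow> 'b::{real_normed_field,banach,second_countable_topology}"
  assumes u: "\<And>i. integrable lborel (u i)"
  shows "integrable lborel (\<lambda>x::real^'d. \<Prod>i\<in>UNIV. u i (x $ i))"
    and "(LINT x::real^'d|lborel. (\<Prod>i\<in>UNIV. u i (x $ i))) = (\<Prod>i\<in>UNIV. (LINT y|lborel. u i y))"
proof -
  interpret product_sigma_finite "\<lambda>_::real^'d. lborel::real measure" ..
  have [measurable]: "u i \<in> borel_measurable borel" for i using u[of i] by auto
  \<comment> \<open>Lebesgue measure is available as a product over basis vectors, the integrand as
    a product over coordinates; \<open>idx\<close> matches the two.\<close>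
  define idx where "idx b = (THE i. b = axis i (1::real))" for b :: "real^'d"
  have idx [simp]: "idx (axis i 1) = i" for i unfolding idx_def by (simp add: axis_eq_axis)
  have basis: "(Basis :: (real^'d) set) = (\<lambda>i. axis i 1) ` UNIV" by (auto simp: Basis_vec_def)
  have inj: "inj (\<lambda>i::'d. axis i (1::real))" by (simp add: inj_on_def axis_eq_axis)
  let ?p = "\<lambda>f::real^'d \<Rightarrow> real. \<Sum>b\<in>Basis. f b *\<^sub>R b"
  have pm: "?p \<in> measurable (Pi\<^sub>M Basis (\<lambda>_. lborel)) borel" by measurable
  have comp: "(\<Prod>i\<in>UNIV. u i (?p f $ i)) = (\<Prod>b\<in>Basis. u (idx b) (f b))" for f :: "real^'d \<Rightarrow> real"
  proof -
    have "?p f $ i = f (axis i 1)" for i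
    proof -
      have "?p f $ i = ?p f \<bullet> axis i 1" by (simp add: inner_axis)
      also have "\<dots> = f (axis i 1)" by (rule inner_sum_left_Basis) (simp add: Basis_vec_def, blast)
      finally show ?thesis .
    qed
    then show ?thesis unfolding basis by (simp add: prod.reindex[OF inj])
  qed
  have bi: "integrable lborel (u (idx b))" for b :: "real^'d" by (rule u)
  have "integrable (Pi\<^sub>M Basis (\<lambda>_. lborel)) (\<lambda>f. \<Prod>i\<in>UNIV. u i (?p f $ i))"
    unfolding comp by (rule product_integrable_prod) (auto intro: bi)
  then show "integrable lborel (\<lambda>x::real^'d. \<Prod>i\<in>UNIV. u i (x $ i))"
    by (subst lborel_eq, subst integrable_distr_eq[OF pm]) simp_all
  have "(LINT x::real^'d|lborel. (\<Prod>i\<in>UNIV. u i (x $ i))) = (LINT f|Pi\<^sub>M Basis (\<lambda>_. lborel). (\<Prod>b\<in>Basis. u (idx b) (f b)))"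
    by (subst lborel_eq, subst integral_distr[OF pm]) (simp, simp only: comp)
  also have "\<dots> = (\<Prod>b\<in>Basis. (LINT y|lborel. u (idx b) y))"
    by (rule product_integral_prod) (auto intro: bi)
  also have "\<dots> = (\<Prod>i\<in>UNIV. (LINT y|lborel. u i y))"
    unfolding basis by (simp add: prod.reindex[OF inj])
  finally show "(LINT x::real^'d|lborel. (\<Prod>i\<in>UNIV. u i (x $ i))) = (\<Prod>i\<in>UNIV. (LINT y|lborel. u i y))" .
qed

lemma cis_sum_inner: "wave \<eta> x = (\<Prod>i\<in>UNIV. cis (2 * pi * \<eta> $ i * x $ i))"
  by (simp add: wave_def cis_sum[symmetric] inner_vec_def sum_distrib_left mult.assoc)

text \<open>
  The tensor Fejer kernel is band-limited and, up to a constant, stable under bounded translations: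
  \<open>w x \<le> V (x + u)\<close> with \<open>V\<close> integrable.
\<close>

lemma band_limited_weight:
  fixes S :: "(real^'d) set"
  assumes "bounded S"
  obtains w V :: "real^'d \<Rightarrow> real" and b
  where "integrable lborel w" "\<And>x. 0 \<le> w x" "\<And>x. x \<in> S \<Longrightarrow> 1 \<le> w x"
    "\<And>\<eta>. b \<le> norm \<eta> \<Longrightarrow> fourier_int w \<eta> = 0" "0 < b"
    "integrable lborel V" "\<And>x u. norm u \<le> sqrt CARD('d) \<Longrightarrow> w x \<le> V (x + u)"
proof -
  let ?d = "CARD('d)"
  obtain R where R: "1 \<le> R" "\<And>x. x \<in> S \<Longrightarrow> norm x \<le> R"
    using assms unfolding bounded_iff by (metis max.cobounded1 max.coboundedI2)
  \<comment> \<open>This scale maps the coordinates of points of \<open>S\<close> into [-1, 1],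
    where the kernel is at least \<open>1 / 4\<close>; hence the normalisation
    \<open>4 ^ ?d\<close>. Keeping it at most 1 prevents the later rescaling from lengthening
    translations.\<close>
  define \<epsilon> where "\<epsilon> = 1 / R"
  have \<epsilon>: "0 < \<epsilon>" "\<epsilon> \<le> 1" using R by (auto simp: \<epsilon>_def)
  define w where "w x = 4 ^ ?d * (\<Prod>i\<in>UNIV. fejer (\<epsilon> * x $ i))" for x :: "real^'d"
  \<comment> \<open>The product of the 3 in \<open>fejer_le\<close> and the factor
    \<open>2 * (1 + z^2)\<close> that a translation by \<open>z\<close> costs, where
    \<open>z^2\<close> is at most the dimension.\<close>
  define K where "K = 6 * (1 + real ?d)"
  define V where "V x = 4 ^ ?d * (\<Prod>i\<in>UNIV. K * inverse (1 + (\<epsilon> * x $ i)\<^sup>2))" for x :: "real^'d"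
  have k_int: "integrable lborel (\<lambda>y. fejer (\<epsilon> * y))"
    using lborel_integrable_real_affine[OF fejer_integrable, of \<epsilon> 0] \<epsilon> by simp
  show thesis
  proof (rule that[of w "real ?d" V])
    show "integrable lborel w"
      unfolding w_def by (intro integrable_mult_right lborel_tensor(1) k_int)
    show "0 \<le> w x" for x unfolding w_def by (intro mult_nonneg_nonneg prod_nonneg) (auto simp: fejer_nonneg)
    show "1 \<le> w x" if "x \<in> S" for x
    proof -
      have "1 / 4 \<le> fejer (\<epsilon> * x $ i)" for i
      proof (rule fejer_ge)
        have "\<bar>x $ i\<bar> \<le> R" using component_le_norm_cart[of x i] R(2)[OF that] by linarith
        then show "\<bar>\<epsilon> * x $ i\<bar> \<le> 1" using R by (simp add: \<epsilon>_def abs_mult field_simps)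
      qed
      then have "(\<Prod>i\<in>(UNIV::'d set). 1 / 4) \<le> (\<Prod>i\<in>UNIV. fejer (\<epsilon> * x $ i))" by (intro prod_mono) auto
      then have "(1 / 4) ^ ?d \<le> (\<Prod>i\<in>UNIV. fejer (\<epsilon> * x $ i))" by simp
      then have "4 ^ ?d * (1 / 4) ^ ?d \<le> w x" unfolding w_def by (intro mult_left_mono) auto
      then show ?thesis by (simp add: power_mult_distrib[symmetric])
    qed
    show "0 < real ?d" by simp
    show "fourier_int w \<eta> = 0" if "real ?d \<le> norm \<eta>" for \<eta> :: "real^'d"
    proof -
      \<comment> \<open>If all coordinates were smaller than 1 in absolute value, the l1 norm would
        lie below the dimension; this explains the band radius. One coordinate beyond 1 gives a
        vanishing factor of the tensor product.\<close>
      obtain i where i: "1 \<le> \<bar>\<eta> $ i\<bar>"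
      proof (rule ccontr)
        assume "\<not> thesis"
        then have "\<bar>\<eta> $ i\<bar> < 1" for i using that not_le by blast
        then have "(\<Sum>i\<in>UNIV. \<bar>\<eta> $ i\<bar>) < (\<Sum>i\<in>(UNIV::'d set). 1)" by (intro sum_strict_mono) auto
        then show False using norm_le_l1_cart[of \<eta>] \<open>real ?d \<le> norm \<eta>\<close> by simp
      qed
      define v where "v j y = complex_of_real (fejer (\<epsilon> * y)) * cis (2 * pi * \<eta> $ j * y)" for j y
      have v: "integrable lborel (v j)" for j
        unfolding v_def
      proof (rule integrable_mult_bounded[OF k_int, of _ 1])
        show "(\<lambda>y. cis (2 * pi * \<eta> $ j * y)) \<in> borel_measurable lborel"
          by (rule measurable_compose[OF _ borel_measurable_cis]) simp
      qed simp
      have "complex_of_real (w x) * wave \<eta> x = 4 ^ ?d * (\<Prod>j\<in>UNIV. v j (x $ j))" for x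
        by (simp add: w_def v_def cis_sum_inner prod.distrib)
      then have "fourier_int w \<eta> = 4 ^ ?d * (\<Prod>j\<in>UNIV. (LINT y|lborel. v j y))"
        unfolding fourier_int_def by (simp add: lborel_tensor(1)[OF v] lborel_tensor(2)[OF v])
      moreover have "(LINT y|lborel. v i y) = 0"
      proof -
        have "1 \<le> \<bar>2 * pi * \<eta> $ i / \<epsilon>\<bar>"
        proof -
          have "1 * 1 \<le> (2 * pi) * \<bar>\<eta> $ i\<bar>" using i pi_ge_two by (intro mult_mono) auto
          then have "1 * \<epsilon> \<le> 2 * pi * \<bar>\<eta> $ i\<bar>" using \<epsilon> by linarith
          then show ?thesis using \<epsilon> by (simp add: abs_mult field_simps)
        qed
        from fejer_fourier[OF this] have "0 = \<bar>\<epsilon>\<bar> *\<^sub>R (LINT y|lborel. v i y)"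
          using lborel_integral_real_affine[of \<epsilon> "\<lambda>y. complex_of_real (fejer y) * cis (2 * pi * \<eta> $ i / \<epsilon> * y)" 0] \<epsilon>
          by (simp add: v_def mult.assoc)
        then show ?thesis using \<epsilon> by simp
      qed
      ultimately show ?thesis by (auto simp: prod_zero_iff)
    qed
    have i_int: "integrable lborel (\<lambda>y. K * inverse (1 + (\<epsilon> * y)\<^sup>2))"
      using lborel_integrable_real_affine[OF integrable_inverse_square, of \<epsilon> 0] \<epsilon> by (intro integrable_mult_right) simp
    show "integrable lborel V"
      unfolding V_def by (intro integrable_mult_right lborel_tensor(1) i_int)
    show "w x \<le> V (x + u)" if "norm u \<le> sqrt ?d" for x u :: "real^'d"
    proof -
      have "fejer (\<epsilon> * x $ i) \<le> K * inverse (1 + (\<epsilon> * (x + u) $ i)\<^sup>2)" for i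
      proof -
        define y z where "y = \<epsilon> * x $ i" and "z = \<epsilon> * u $ i"
        have "\<bar>z\<bar> \<le> 1 * norm u" unfolding z_def abs_mult using \<epsilon> component_le_norm_cart[of u i] by (intro mult_mono) auto
        then have "z\<^sup>2 \<le> (sqrt ?d)\<^sup>2" using that power_mono[of "\<bar>z\<bar>" "sqrt ?d" 2] by simp
        then have z: "z\<^sup>2 \<le> real ?d" by simp
        have "(y + z)\<^sup>2 \<le> 2 * y\<^sup>2 + 2 * z\<^sup>2" using sum_squares_bound[of y z] by (simp add: power2_sum)
        then have "1 + (y + z)\<^sup>2 \<le> 2 * (1 + z\<^sup>2) * (1 + y\<^sup>2)"
        proof -
          have "2 * (1 + z\<^sup>2) * (1 + y\<^sup>2) = 2 + 2 * y\<^sup>2 + 2 * z\<^sup>2 + 2 * (z\<^sup>2 * y\<^sup>2)"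
            by (simp add: algebra_simps)
          moreover have "0 \<le> z\<^sup>2 * y\<^sup>2" by simp
          ultimately show ?thesis using \<open>(y + z)\<^sup>2 \<le> 2 * y\<^sup>2 + 2 * z\<^sup>2\<close> by linarith
        qed
        also have "\<dots> \<le> 2 * (1 + real ?d) * (1 + y\<^sup>2)" using z by (intro mult_right_mono) auto
        finally have "1 + (y + z)\<^sup>2 \<le> 2 * (1 + real ?d) * (1 + y\<^sup>2)" .
        moreover have "K * (1 + y\<^sup>2) = 3 * (2 * (1 + real ?d) * (1 + y\<^sup>2))" by (simp add: K_def algebra_simps)
        ultimately have "3 * (1 + (y + z)\<^sup>2) \<le> K * (1 + y\<^sup>2)"
          using mult_left_mono[of "1 + (y + z)\<^sup>2" "2 * (1 + real ?d) * (1 + y\<^sup>2)" 3] by (simp only:)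
        moreover have "0 < 1 + y\<^sup>2" "0 < 1 + (y + z)\<^sup>2" by (simp_all add: add_pos_nonneg)
        ultimately have "3 / (1 + y\<^sup>2) \<le> K * inverse (1 + (y + z)\<^sup>2)" by (simp add: field_simps)
        then show ?thesis using fejer_le[of y] by (simp add: y_def z_def distrib_left)
      qed
      then show ?thesis unfolding w_def V_def
        by (intro mult_left_mono prod_mono) (auto simp: fejer_nonneg)
    qed
  qed
qed

section \<open>Averages of periodic functions\<close>

lemma unit_cube_borel [measurable]: "unit_cube \<in> sets borel"
proof -
  have "unit_cube = {x::real^'d. \<forall>i\<in>UNIV. 0 \<le> x $ i \<and> x $ i < 1}" by (simp add: unit_cube_def)
  also have "\<dots> \<in> sets borel" by measurable
  finally show ?thesis .
qed

lemma int_vectors_countable: "countable (int_vectors :: (real^'d) set)"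
proof -
  have sub: "int_vectors \<subseteq> range (\<lambda>g::'d \<Rightarrow> int. \<chi> i. real_of_int (g i))"
  proof
    fix \<xi> :: "real^'d" assume "\<xi> \<in> int_vectors"
    then have "\<forall>i. \<exists>k. \<xi> $ i = real_of_int k" by (auto simp: int_vectors_def Ints_def)
    then obtain g where "\<forall>i. \<xi> $ i = real_of_int (g i)" by metis
    then show "\<xi> \<in> range (\<lambda>g::'d \<Rightarrow> int. \<chi> i. real_of_int (g i))"
      by (intro image_eqI[of _ _ g]) (auto simp: vec_eq_iff)
  qed
  have "countable (UNIV :: ('d \<Rightarrow> int) set)" by (rule countableI_type)
  then show ?thesis by (intro countable_subset[OF sub] countable_image)
qed

lemma int_vectors_closed:
  "0 \<in> int_vectors" "\<xi> \<in> int_vectors \<Longrightarrow> - \<xi> \<in> int_vectors"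
  "\<xi> \<in> int_vectors \<Longrightarrow> \<zeta> \<in> int_vectors \<Longrightarrow> \<xi> + \<zeta> \<in> int_vectors"
  by (auto simp: int_vectors_def)

lemma norm_int_vector_ge: "\<xi> \<in> int_vectors \<Longrightarrow> \<xi> \<noteq> 0 \<Longrightarrow> 1 \<le> norm \<xi>"
proof -
  assume \<xi>: "\<xi> \<in> int_vectors" "\<xi> \<noteq> 0"
  then obtain i where "\<xi> $ i \<noteq> 0" by (auto simp: vec_eq_iff)
  moreover have "\<xi> $ i \<in> \<int>" using \<xi> by (simp add: int_vectors_def)
  ultimately have "1 \<le> \<bar>\<xi> $ i\<bar>" by (rule Ints_nonzero_abs_ge1[rotated])
  then show ?thesis using component_le_norm_cart[of \<xi> i] by linarith
qed

definition floor_vec :: "real^'d \<Rightarrow> real^'d" where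
  "floor_vec x = (\<chi> i. of_int \<lfloor>x $ i\<rfloor>)"

lemma floor_vec_int: "floor_vec x \<in> int_vectors"
  by (simp add: floor_vec_def int_vectors_def)

lemma unit_cube_translate_iff: "m \<in> int_vectors \<Longrightarrow> x - m \<in> unit_cube \<longleftrightarrow> m = floor_vec x"
proof
  assume m: "m \<in> int_vectors" and "x - m \<in> unit_cube"
  show "m = floor_vec x" unfolding vec_eq_iff
  proof
    fix i
    obtain k where k: "m $ i = of_int k" using m by (auto simp: int_vectors_def Ints_def)
    have "0 \<le> x $ i - m $ i" "x $ i - m $ i < 1" using \<open>x - m \<in> unit_cube\<close> by (auto simp: unit_cube_def)
    then have "\<lfloor>x $ i\<rfloor> = k" unfolding k by (intro floor_unique) auto
    then show "m $ i = floor_vec x $ i" by (simp add: floor_vec_def k)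
  qed
next
  assume m: "m = floor_vec x"
  have "0 \<le> (x - m) $ i \<and> (x - m) $ i < 1" for i
    using floor_correct[of "x $ i"] by (simp add: m floor_vec_def) linarith
  then show "x - m \<in> unit_cube" unfolding unit_cube_def by blast
qed

lemma floor_vec_measurable [measurable]: "floor_vec \<in> borel_measurable borel"
proof -
  have comp: "(\<lambda>x::real^'d. x $ i) \<in> borel_measurable borel" for i
    by (intro borel_measurable_continuous_onI continuous_intros)
  have "(\<lambda>x::real^'d. floor_vec x \<bullet> b) \<in> borel_measurable borel" if b: "b \<in> Basis" for b
  proof -
    obtain i where "b = axis i 1" using b by (auto simp: Basis_vec_def)
    then have "(\<lambda>x. floor_vec x \<bullet> b) = (\<lambda>x. of_int \<lfloor>x $ i\<rfloor>)"
      by (simp add: fun_eq_iff inner_axis floor_vec_def)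
    then show ?thesis using measurable_compose[OF comp borel_measurable_real_floor] by simp
  qed
  then show ?thesis by (subst borel_measurable_euclidean_space) blast
qed

lemma periodic_int_vectors:
  fixes f :: "real^'d \<Rightarrow> 'a"
  assumes per: "\<And>x i. f (x + axis i 1) = f x" and m: "m \<in> int_vectors"
  shows "f (x + m) = f x"
proof -
  have nat: "f (x + real n *\<^sub>R axis i 1) = f x" for n x i
  proof (induction n)
    case (Suc n)
    have "f (x + real (Suc n) *\<^sub>R axis i 1) = f ((x + real n *\<^sub>R axis i 1) + axis i 1)"
      by (simp add: algebra_simps)
    then show ?case using Suc per by simp
  qed simp
  have int: "f (x + of_int k *\<^sub>R axis i 1) = f x" for k x i
  proof (cases "0 \<le> k")
    case True
    then show ?thesis using nat[of x "nat k" i] by simp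
  next
    case False
    have "f ((x + of_int k *\<^sub>R axis i 1) + real (nat (- k)) *\<^sub>R axis i 1) = f (x + of_int k *\<^sub>R axis i 1)"
      by (rule nat)
    then show ?thesis using False by (simp add: scaleR_add_left[symmetric] add.assoc)
  qed
  have J: "f (x + (\<Sum>i\<in>J. m $ i *\<^sub>R axis i 1)) = f x" if "finite J" for J
    using that
  proof (induction J arbitrary: x)
    case (insert j J)
    obtain k where k: "m $ j = of_int k" using m by (auto simp: int_vectors_def Ints_def)
    have "f (x + (\<Sum>i\<in>insert j J. m $ i *\<^sub>R axis i 1)) = f ((x + of_int k *\<^sub>R axis j 1) + (\<Sum>i\<in>J. m $ i *\<^sub>R axis i 1))"
      using insert.hyps by (simp add: k add.assoc)
    then show ?case using insert.IH int by simp
  qed simp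
  have "(\<Sum>i\<in>UNIV. m $ i *\<^sub>R axis i 1) = m"
    by (auto simp: vec_eq_iff axis_def if_distrib cong: if_cong)
  then show ?thesis using J[of UNIV] by simp
qed

lemma nn_integral_translate:
  fixes H :: "real^'d \<Rightarrow> ennreal"
  assumes [measurable]: "H \<in> borel_measurable borel"
  shows "(\<integral>\<^sup>+x. H (x + u) \<partial>lborel) = (\<integral>\<^sup>+x. H x \<partial>lborel)"
  by (subst (2) lborel_distr_plus[of u, symmetric], subst nn_integral_distr) (simp_all add: add.commute)

lemma indicator_lattice_sum:
  "(\<integral>\<^sup>+m. indicator unit_cube (v - m) \<partial>count_space int_vectors) = (1::ennreal)"
proof -
  have "(\<integral>\<^sup>+m. indicator unit_cube (v - m) \<partial>count_space int_vectors)
      = (\<integral>\<^sup>+m. indicator {floor_vec v} m \<partial>count_space int_vectors)"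
    by (rule nn_integral_cong) (simp add: indicator_def unit_cube_translate_iff)
  also have "\<dots> = emeasure (count_space int_vectors) {floor_vec v}"
    by (rule nn_integral_indicator) (simp add: floor_vec_int)
  also have "\<dots> = 1" by (simp add: floor_vec_int emeasure_count_space_finite)
  finally show ?thesis .
qed

text \<open>Unfolding over the lattice: insert the partition of unity formed by the integral
  translates of the cube, shift each piece by its lattice vector, which \<open>H\<close> does not
  notice, and sum the translates of the other cube to 1.\<close>

lemma nn_integral_periodic_translate:
  fixes H :: "real^'d \<Rightarrow> ennreal"
  assumes H [measurable]: "H \<in> borel_measurable borel"
    and per: "\<And>x m. m \<in> int_vectors \<Longrightarrow> H (x + m) = H x"
  shows "(\<integral>\<^sup>+v. H (z + v) * indicator unit_cube v \<partial>lborel) = (\<integral>\<^sup>+v. H v * indicator unit_cube v \<partial>lborel)"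
proof -
  let ?c = "indicator unit_cube :: real^'d \<Rightarrow> ennreal"
  let ?Z = "count_space (int_vectors :: (real^'d) set)"
  have "(\<integral>\<^sup>+v. H (z + v) * ?c v \<partial>lborel) = (\<integral>\<^sup>+v. (H v * ?c (v - z)) \<partial>lborel)"
    using nn_integral_translate[of "\<lambda>v. H v * ?c (v - z)" z] by (simp add: add.commute)
  also have "\<dots> = (\<integral>\<^sup>+v. (\<integral>\<^sup>+m. H v * ?c (v - z) * ?c (v - m) \<partial>?Z) \<partial>lborel)"
    by (simp add: nn_integral_cmult indicator_lattice_sum)
  also have "\<dots> = (\<integral>\<^sup>+m. (\<integral>\<^sup>+v. H v * ?c (v - z) * ?c (v - m) \<partial>lborel) \<partial>?Z)"
    by (rule nn_integral_count_space_nn_integral[OF int_vectors_countable]) simp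
  also have "\<dots> = (\<integral>\<^sup>+m. (\<integral>\<^sup>+v. H v * ?c v * ?c (v - z + m) \<partial>lborel) \<partial>?Z)"
  proof (rule nn_integral_cong)
    fix m assume "m \<in> space ?Z"
    then have m: "m \<in> int_vectors" by simp
    have "(\<integral>\<^sup>+v. H v * ?c (v - z) * ?c (v - m) \<partial>lborel)
        = (\<integral>\<^sup>+v. H (v + m) * ?c (v + m - z) * ?c (v + m - m) \<partial>lborel)"
      by (subst nn_integral_translate[of "\<lambda>v. H v * ?c (v - z) * ?c (v - m)" m, symmetric]) simp_all
    also have "\<dots> = (\<integral>\<^sup>+v. H v * ?c v * ?c (v - z + m) \<partial>lborel)"
      by (simp add: per[OF m] mult_ac algebra_simps)
    finally show "(\<integral>\<^sup>+v. H v * ?c (v - z) * ?c (v - m) \<partial>lborel) = (\<integral>\<^sup>+v. H v * ?c v * ?c (v - z + m) \<partial>lborel)" .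
  qed
  also have "\<dots> = (\<integral>\<^sup>+v. (\<integral>\<^sup>+m. H v * ?c v * ?c (v - z + m) \<partial>?Z) \<partial>lborel)"
    by (rule nn_integral_count_space_nn_integral[OF int_vectors_countable, symmetric]) simp
  also have "\<dots> = (\<integral>\<^sup>+v. H v * ?c v \<partial>lborel)"
  proof -
    have bij: "bij_betw uminus int_vectors (int_vectors :: (real^'d) set)"
      by (rule bij_betwI[of _ _ _ uminus]) (auto intro: int_vectors_closed)
    have "(\<integral>\<^sup>+m. ?c (y + m) \<partial>?Z) = 1" for y
      using nn_integral_bij_count_space[OF bij, of "\<lambda>m. ?c (y - m)"] indicator_lattice_sum[of y] by simp
    then show ?thesis by (simp add: nn_integral_cmult)
  qed
  finally show ?thesis .
qed

lemma emeasure_unit_cube: "emeasure lborel (unit_cube :: (real^'d) set) = 1"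
proof -
  have eq: "(\<lambda>x::real^'d. \<Prod>b\<in>Basis. indicator {0..<1} (x \<bullet> b) :: ennreal) = indicator unit_cube"
  proof
    fix x :: "real^'d"
    have basis: "(Basis :: (real^'d) set) = (\<lambda>i. axis i 1) ` UNIV" by (auto simp: Basis_vec_def)
    have iff: "x \<in> unit_cube \<longleftrightarrow> (\<forall>b\<in>Basis. x \<bullet> b \<in> {0..<1})"
      unfolding basis by (simp add: unit_cube_def inner_axis)
    show "(\<Prod>b\<in>Basis. indicator {0..<1} (x \<bullet> b)) = (indicator unit_cube x :: ennreal)"
    proof (cases "x \<in> unit_cube")
      case True
      then have "(\<Prod>b\<in>Basis. indicator {0..<1} (x \<bullet> b)) = (\<Prod>b\<in>(Basis :: (real^'d) set). 1 :: ennreal)"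
        using iff by (intro prod.cong refl) (simp only: indicator_simps)
      then show ?thesis using True by simp
    next
      case False
      then obtain b where "b \<in> Basis" "x \<bullet> b \<notin> {0..<1}" using iff by blast
      then have "(\<Prod>b\<in>Basis. indicator {0..<1} (x \<bullet> b)) = (0 :: ennreal)"
        by (intro prod_zero) (auto intro!: bexI[of _ b])
      then show ?thesis using False by simp
    qed
  qed
  have "emeasure lborel (unit_cube :: (real^'d) set) = integral\<^sup>N lborel (\<lambda>x::real^'d. (\<Prod>b\<in>Basis. indicator {0..<1} (x \<bullet> b)))"
    unfolding eq by simp
  also have "\<dots> = 1" by (subst nn_integral_lborel_prod) simp_all
  finally show ?thesis .
qed

lemma norm_unit_cube: "v \<in> unit_cube \<Longrightarrow> norm v \<le> sqrt CARD('d)" for v :: "real^'d"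
proof -
  assume "v \<in> unit_cube"
  then have "(v $ i)\<^sup>2 \<le> 1" for i by (simp add: unit_cube_def power_le_one less_imp_le)
  then have "(\<Sum>i\<in>UNIV. (v $ i)\<^sup>2) \<le> (\<Sum>i\<in>(UNIV::'d set). 1)" by (intro sum_mono)
  then show ?thesis by (simp add: norm_vec_def L2_set_def)
qed

text \<open>
  Every translate of \<open>w\<close> by \<open>A\<^sup>-\<^sup>k v\<close> with \<open>v\<close> in the unit cube lies below \<open>V\<close>, so averaging over
  \<open>v\<close> makes the left-hand side see only the mean of \<open>H\<close>.
\<close>

lemma (in expanding_matrix) periodic_weight_bound:
  fixes H w V :: "real^'d \<Rightarrow> ennreal"
  assumes [measurable]: "H \<in> borel_measurable borel" "w \<in> borel_measurable borel" "V \<in> borel_measurable borel"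
    and per: "\<And>x m. m \<in> int_vectors \<Longrightarrow> H (x + m) = H x"
    and wV: "\<And>x u. norm u \<le> sqrt CARD('d) \<Longrightarrow> w x \<le> V (x + u)"
  shows "(\<integral>\<^sup>+x. w x * H (matrix_power A k *v x) \<partial>lborel)
     \<le> (\<integral>\<^sup>+x. V x \<partial>lborel) * (\<integral>\<^sup>+v. H v * indicator unit_cube v \<partial>lborel)"
proof -
  have [measurable]: "(\<lambda>x. H (matrix_power A k *v x)) \<in> borel_measurable borel"
    by (rule measurable_compose[OF mult_vector_measurable]) simp
  have [measurable]: "(\<lambda>(v, y). H (matrix_power A k *v y + v)) \<in> borel_measurable (borel \<Otimes>\<^sub>M borel)"
  proof -
    have "(\<lambda>p::(real^'d) \<times> (real^'d). matrix_power A k *v snd p + fst p) \<in> borel_measurable (borel \<Otimes>\<^sub>M borel)"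
      by (intro borel_measurable_add measurable_compose[OF measurable_snd mult_vector_measurable]) simp_all
    from measurable_compose[OF this assms(1)] show ?thesis by (simp add: case_prod_unfold)
  qed
  let ?c = "indicator unit_cube :: real^'d \<Rightarrow> ennreal"
  let ?L = "\<integral>\<^sup>+x. w x * H (matrix_power A k *v x) \<partial>lborel"
  have shift: "?L \<le> (\<integral>\<^sup>+y. V y * H (matrix_power A k *v y + v) \<partial>lborel)" if v: "v \<in> unit_cube" for v
  proof -
    obtain u where u: "v = matrix_power A k *v u" "norm u \<le> norm v" using column_inverse_ex by blast
    have "?L \<le> (\<integral>\<^sup>+x. V (x + (- u)) * H (matrix_power A k *v (x + (- u)) + v) \<partial>lborel)"
    proof (rule nn_integral_mono)
      fix x
      have "matrix_power A k *v (x + (- u)) + v = matrix_power A k *v x"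
        unfolding u(1) by (simp add: matrix_vector_mult_diff_distrib)
      moreover have "w x \<le> V (x + (- u))" using u(2) norm_unit_cube[OF v] by (intro wV) simp
      ultimately show "w x * H (matrix_power A k *v x) \<le> V (x + (- u)) * H (matrix_power A k *v (x + (- u)) + v)"
        by (simp add: mult_right_mono)
    qed
    also have "\<dots> = (\<integral>\<^sup>+y. V y * H (matrix_power A k *v y + v) \<partial>lborel)"
      by (rule nn_integral_translate) measurable
    finally show ?thesis .
  qed
  have "?L = (\<integral>\<^sup>+v. ?L * ?c v \<partial>lborel)"
    by (simp add: nn_integral_cmult emeasure_unit_cube)
  also have "\<dots> \<le> (\<integral>\<^sup>+v. (\<integral>\<^sup>+y. V y * H (matrix_power A k *v y + v) * ?c v \<partial>lborel) \<partial>lborel)"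
    using shift by (intro nn_integral_mono) (auto simp: indicator_def)
  also have "\<dots> = (\<integral>\<^sup>+y. (\<integral>\<^sup>+v. V y * H (matrix_power A k *v y + v) * ?c v \<partial>lborel) \<partial>lborel)"
    by (rule pair_sigma_finite.Fubini'[of lborel lborel]) (auto simp: pair_sigma_finite_def lborel.sigma_finite_measure_axioms)
  also have "\<dots> = (\<integral>\<^sup>+y. V y * (\<integral>\<^sup>+v. H v * ?c v \<partial>lborel) \<partial>lborel)"
    by (simp add: mult.assoc nn_integral_cmult nn_integral_periodic_translate[OF assms(1) per])
  also have "\<dots> = (\<integral>\<^sup>+x. V x \<partial>lborel) * (\<integral>\<^sup>+v. H v * ?c v \<partial>lborel)"
    by (rule nn_integral_multc) simp
  finally show ?thesis .
qed

abbreviation cube :: "real^'d \<Rightarrow> real" where "cube \<equiv> indicator unit_cube"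

lemma cube_integrable: "integrable lborel (cube :: real^'d \<Rightarrow> real)"
  by (rule integrable_real_indicator) (simp_all add: emeasure_unit_cube)

lemma cube_integral: "(LINT x::real^'d|lborel. cube x) = 1"
  by (simp add: emeasure_unit_cube measure_def)

section \<open>Orthogonality of integral waves on the cube\<close>

lemma wave_int_periodic:
  assumes "\<xi> \<in> int_vectors" "m \<in> int_vectors" shows "wave \<xi> (x + m) = wave \<xi> x"
proof -
  have "\<xi> \<bullet> m \<in> \<int>" using assms unfolding inner_vec_def int_vectors_def by (auto intro!: Ints_sum Ints_mult)
  then have "wave \<xi> m = 1" by (simp add: wave_def cis_multiple_2pi)
  then show ?thesis by (simp add: wave_add_right)
qed

text \<open>Translation by \<open>z\<close> preserves the integral over the cube but reverses the
  sign of \<open>h\<close>. Invariance is known for nonnegative integrals, so it is applied to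
  \<open>2 + h\<close> and compared with \<open>2 - h\<close>.\<close>

lemma antiperiodic_integral_zero:
  fixes h :: "real^'d \<Rightarrow> real"
  assumes h [measurable]: "h \<in> borel_measurable borel" and bnd: "\<And>x. \<bar>h x\<bar> \<le> 1"
    and per: "\<And>x m. m \<in> int_vectors \<Longrightarrow> h (x + m) = h x" and anti: "\<And>x. h (z + x) = - h x"
  shows "(LINT x|lborel. cube x * h x) = 0"
proof -
  have int: "integrable lborel (\<lambda>x. cube x * h x)" by (rule integrable_weight_bounded[OF cube_integrable _ bnd]) simp
  have pos: "0 \<le> 2 + h x" "0 \<le> 2 - h x" for x using bnd[of x] by auto
  have eq: "(\<integral>\<^sup>+x. ennreal (2 + s * h x) * indicator unit_cube x \<partial>lborel) = ennreal (LINT x|lborel. cube x * (2 + s * h x))"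
    if "s = 1 \<or> s = -1" for s
  proof -
    have "(\<integral>\<^sup>+x. ennreal (2 + s * h x) * indicator unit_cube x \<partial>lborel) = (\<integral>\<^sup>+x. ennreal (cube x * (2 + s * h x)) \<partial>lborel)"
      by (intro nn_integral_cong) (auto simp: indicator_def)
    also have "\<dots> = ennreal (LINT x|lborel. cube x * (2 + s * h x))"
    proof (rule nn_integral_eq_integral)
      have lin: "(\<lambda>x. cube x * (2 + s * h x)) = (\<lambda>x. 2 * cube x + s * (cube x * h x))"
        by (simp add: fun_eq_iff distrib_left mult.left_commute mult.commute)
      show "integrable lborel (\<lambda>x. cube x * (2 + s * h x))"
        unfolding lin by (intro Bochner_Integration.integrable_add integrable_mult_right int cube_integrable)
    qed (use pos that in \<open>auto intro!: AE_I2\<close>)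
    finally show ?thesis .
  qed
  have lin: "(LINT x|lborel. cube x * (2 + s * h x)) = 2 + s * (LINT x|lborel. cube x * h x)" for s
  proof -
    have "(LINT x|lborel. cube x * (2 + s * h x)) = (LINT x|lborel. 2 * cube x + s * (cube x * h x))"
      by (simp add: distrib_left mult.left_commute mult.commute)
    also have "\<dots> = 2 * (LINT x::real^'d|lborel. cube x) + s * (LINT x|lborel. cube x * h x)"
      by (subst Bochner_Integration.integral_add) (simp_all add: int cube_integrable del: integral_indicator)
    finally show ?thesis unfolding cube_integral by simp
  qed
  have "(\<integral>\<^sup>+x. ennreal (2 + h (z + x)) * indicator unit_cube x \<partial>lborel) = (\<integral>\<^sup>+x. ennreal (2 + h x) * indicator unit_cube x \<partial>lborel)"
    by (rule nn_integral_periodic_translate[of "\<lambda>x. ennreal (2 + h x)"]) (simp_all add: per)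
  then have "ennreal (LINT x|lborel. cube x * (2 + (-1) * h x)) = ennreal (LINT x|lborel. cube x * (2 + 1 * h x))"
    unfolding eq[OF disjI1[OF refl], symmetric] eq[OF disjI2[OF refl], symmetric] by (simp add: anti)
  moreover have "0 \<le> (LINT x|lborel. cube x * (2 + (-1) * h x))" "0 \<le> (LINT x|lborel. cube x * (2 + 1 * h x))"
    using pos by (auto intro!: Bochner_Integration.integral_nonneg)
  ultimately have "(LINT x|lborel. cube x * (2 + (-1) * h x)) = (LINT x|lborel. cube x * (2 + 1 * h x))"
    by (simp only: ennreal_inj)
  then show ?thesis unfolding lin by simp
qed

text \<open>For a nonzero frequency, translation by half a period \<open>z\<close> flips the sign of
  the wave, and the previous lemma applies to its real and imaginary parts.\<close>

lemma fourier_int_cube: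
  assumes \<xi>: "\<xi> \<in> int_vectors" shows "fourier_int cube \<xi> = of_bool (\<xi> = 0)"
proof (cases "\<xi> = 0")
  case True then show ?thesis unfolding fourier_int_def by (simp add: emeasure_unit_cube measure_def)
next
  case False
  define z where "z = (1 / (2 * (norm \<xi>)\<^sup>2)) *\<^sub>R \<xi>"
  have "\<xi> \<bullet> z = 1 / 2" using False by (simp add: z_def dot_square_norm)
  then have "2 * pi * (\<xi> \<bullet> z) = pi" by simp
  then have "wave \<xi> z = - 1" unfolding wave_def by (metis cis_pi)
  then have z: "wave \<xi> (z + x) = - wave \<xi> x" for x by (simp add: wave_add_right)
  have re: "(LINT x|lborel. cube x * Re (wave \<xi> x)) = 0"
    by (rule antiperiodic_integral_zero[of _ z])
       (auto simp: wave_int_periodic[OF \<xi>] z intro: order_trans[OF abs_Re_le_cmod])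
  have im: "(LINT x|lborel. cube x * Im (wave \<xi> x)) = 0"
    by (rule antiperiodic_integral_zero[of _ z])
       (auto simp: wave_int_periodic[OF \<xi>] z intro: order_trans[OF abs_Im_le_cmod])
  have int: "integrable lborel (\<lambda>x. complex_of_real (cube x) * wave \<xi> x)" by (rule integrable_wave[OF cube_integrable])
  have "Re (fourier_int cube \<xi>) = 0" unfolding fourier_int_def using integral_Re[OF int] re by simp
  moreover have "Im (fourier_int cube \<xi>) = 0" unfolding fourier_int_def using integral_Im[OF int] im by simp
  ultimately show ?thesis using False by (simp add: complex_eq_iff)
qed

lemma freq_box_finite: "finite (freq_box a :: (real^'d) set)"
proof (rule finite_subset)
  show "freq_box a \<subseteq> (\<lambda>g. \<chi> i. g i) ` (Pi\<^sub>E (UNIV :: 'd set) (\<lambda>_. {k \<in> \<int>. \<bar>k\<bar> \<le> a}))"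
  proof
    fix \<xi> :: "real^'d" assume "\<xi> \<in> freq_box a"
    then show "\<xi> \<in> (\<lambda>g. \<chi> i. g i) ` (Pi\<^sub>E (UNIV :: 'd set) (\<lambda>_. {k \<in> \<int>. \<bar>k\<bar> \<le> a}))"
      by (intro image_eqI[of _ _ "\<lambda>i. \<xi> $ i"]) (auto simp: freq_box_def int_vectors_def vec_eq_iff)
  qed
  show "finite ((\<lambda>g. \<chi> i. g i) ` (Pi\<^sub>E (UNIV :: 'd set) (\<lambda>_. {k \<in> \<int>. \<bar>k\<bar> \<le> a})))"
    by (intro finite_imageI finite_PiE finite_abs_int_segment) simp
qed

lemma freq_box_props:
  "\<xi> \<in> freq_box a \<Longrightarrow> \<xi> \<in> int_vectors" "\<xi> \<in> freq_box a \<Longrightarrow> \<xi> \<noteq> 0"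
  "\<xi> \<in> freq_box a \<Longrightarrow> - \<xi> \<in> freq_box a" "a \<le> b \<Longrightarrow> freq_box a \<subseteq> freq_box b"
  by (auto simp: freq_box_def intro: int_vectors_closed) (meson order_trans)

lemma norm_freq_box_le: "\<xi> \<in> freq_box a \<Longrightarrow> norm \<xi> \<le> real CARD('d) * a" for \<xi> :: "real^'d"
proof -
  assume "\<xi> \<in> freq_box a"
  then have "(\<Sum>i\<in>UNIV. \<bar>\<xi> $ i\<bar>) \<le> (\<Sum>i\<in>(UNIV :: 'd set). a)" by (intro sum_mono) (simp add: freq_box_def)
  then show ?thesis using norm_le_l1_cart[of \<xi>] by simp
qed

section \<open>Fourier series of periodic functions\<close>

locale periodic_L2 =
  fixes f :: "real^'d \<Rightarrow> real"
  assumes f_borel [measurable]: "f \<in> borel_measurable borel"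
    and f_periodic_axis: "\<And>x i. f (x + axis i 1) = f x"
    and f_square_integrable: "integrable lborel (\<lambda>x. cube x * (f x)\<^sup>2)"
    and f_mean: "(LINT x|lborel. cube x * f x) = 0"
begin

lemma f_periodic: "m \<in> int_vectors \<Longrightarrow> f (x + m) = f x"
  by (rule periodic_int_vectors[OF f_periodic_axis])

definition fc :: "real^'d \<Rightarrow> complex" where
  "fc \<xi> = (LINT x|lborel. complex_of_real (cube x * f x) * wave (- \<xi>) x)"

lemma f_integrable: "integrable lborel (\<lambda>x. cube x * f x)"
  using weighted_product_integrable[of "\<lambda>_. 1" lborel f cube] cube_integrable f_square_integrable by simp

lemma fourier_coeff_eq: "fourier_coeff f \<xi> = fc \<xi>"
proof -
  have "exp (- 2 * complex_of_real pi * \<i> * complex_of_real (\<xi> \<bullet> x)) = wave (- \<xi>) x" for x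
    by (simp add: wave_def cis_conv_exp mult_ac)
  then have "fourier_coeff f \<xi> = (LINT x|lebesgue. complex_of_real (cube x * f x) * wave (- \<xi>) x)"
    unfolding fourier_coeff_def set_lebesgue_integral_def
    by (intro Bochner_Integration.integral_cong refl) (simp add: scaleR_conv_of_real)
  also have "\<dots> = fc \<xi>"
    unfolding fc_def by (rule integral_completion) simp
  finally show ?thesis .
qed

lemma fc_uminus: "fc (- \<xi>) = cnj (fc \<xi>)"
proof -
  have "cnj (fc \<xi>) = (LINT x|lborel. cnj (complex_of_real (cube x * f x) * wave (- \<xi>) x))"
    unfolding fc_def by (rule Bochner_Integration.integral_cnj[symmetric])
  then show ?thesis unfolding fc_def by (simp add: cnj_wave)
qed

lemma fc_zero: "fc 0 = 0"
  unfolding fc_def using f_mean by (simp del: of_real_mult)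

lemma fc_mult_uminus: "fc \<xi> * fc (- \<xi>) = complex_of_real ((norm (fc \<xi>))\<^sup>2)"
  by (simp only: fc_uminus complex_norm_square)

text \<open>Coefficients at opposite frequencies are conjugate, so a set closed under negation makes
  the partial sum real-valued; \<open>fsum\<close> then loses nothing by taking real parts.\<close>

definition symmetric_freqs :: "(real^'d) set \<Rightarrow> bool" where
  "symmetric_freqs S \<longleftrightarrow> finite S \<and> S \<subseteq> int_vectors \<and> (\<forall>\<xi>\<in>S. - \<xi> \<in> S)"

definition fsum :: "(real^'d) set \<Rightarrow> real^'d \<Rightarrow> real" where
  "fsum S x = Re (trig_poly fc (\<lambda>\<xi>. \<xi>) S x)"

lemma fsum_measurable [measurable]: "fsum S \<in> borel_measurable borel"
  unfolding fsum_def[abs_def] by measurable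

lemma fsum_complex:
  assumes "symmetric_freqs S"
  shows "trig_poly fc (\<lambda>\<xi>. \<xi>) S x = complex_of_real (fsum S x)"
proof -
  have "cnj (trig_poly fc (\<lambda>\<xi>. \<xi>) S x) = (\<Sum>\<xi>\<in>S. fc (- \<xi>) * wave (- \<xi>) x)"
    by (simp add: trig_poly_def fc_uminus cnj_wave)
  also have "\<dots> = trig_poly fc (\<lambda>\<xi>. \<xi>) S x"
    unfolding trig_poly_def
    by (rule sum.reindex_bij_witness[of _ uminus uminus]) (use assms in \<open>auto simp: symmetric_freqs_def\<close>)
  finally have "Im (trig_poly fc (\<lambda>\<xi>. \<xi>) S x) = 0" by (simp add: complex_eq_iff)
  then show ?thesis by (simp add: fsum_def complex_eq_iff)
qed

lemma fsum_bound: "\<bar>fsum S x\<bar> \<le> (\<Sum>\<xi>\<in>S. norm (fc \<xi>))"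
  unfolding fsum_def by (rule order_trans[OF abs_Re_le_cmod norm_trig_poly_le])

lemma fsum_periodic:
  assumes "symmetric_freqs S" "m \<in> int_vectors" shows "fsum S (x + m) = fsum S x"
proof -
  have "trig_poly fc (\<lambda>\<xi>. \<xi>) S (x + m) = trig_poly fc (\<lambda>\<xi>. \<xi>) S x"
    unfolding trig_poly_def
    by (rule sum.cong[OF refl]) (use assms in \<open>auto simp: symmetric_freqs_def wave_int_periodic subset_iff\<close>)
  then show ?thesis by (simp add: fsum_def)
qed

lemma fsum_diff:
  assumes "symmetric_freqs S" "symmetric_freqs T" "T \<subseteq> S"
  shows "symmetric_freqs (S - T)" "fsum S x - fsum T x = fsum (S - T) x"
proof -
  have "- \<xi> \<notin> T" if "\<xi> \<notin> T" for \<xi>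
    using that assms(2) unfolding symmetric_freqs_def by (metis minus_minus)
  then show "symmetric_freqs (S - T)" using assms unfolding symmetric_freqs_def by auto
  have "trig_poly fc (\<lambda>\<xi>. \<xi>) S x = trig_poly fc (\<lambda>\<xi>. \<xi>) (S - T) x + trig_poly fc (\<lambda>\<xi>. \<xi>) T x"
    unfolding trig_poly_def using assms by (intro sum.subset_diff) (auto simp: symmetric_freqs_def)
  then show "fsum S x - fsum T x = fsum (S - T) x" by (simp add: fsum_def)
qed

definition resid :: "(real^'d) set \<Rightarrow> real^'d \<Rightarrow> real" where
  "resid S x = f x - fsum S x"

lemma resid_measurable [measurable]: "resid S \<in> borel_measurable borel"
  unfolding resid_def[abs_def] by measurable

lemma fsum_square_integrable: "integrable lborel (\<lambda>x. cube x * (fsum S x)\<^sup>2)"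
proof (rule integrable_weight_bounded[OF cube_integrable])
  show "\<bar>(fsum S x)\<^sup>2\<bar> \<le> (\<Sum>\<xi>\<in>S. norm (fc \<xi>))\<^sup>2" for x using power_mono[OF fsum_bound[of S x], of 2] by simp
qed simp

lemma f_fsum_integrable: "integrable lborel (\<lambda>x. cube x * (f x * fsum S x))"
  by (rule weighted_product_integrable[OF _ _ _ _ f_square_integrable fsum_square_integrable]) simp_all

lemma resid_square_expand:
  "cube x * (resid S x)\<^sup>2 = cube x * (f x)\<^sup>2 - 2 * (cube x * (f x * fsum S x)) + cube x * (fsum S x)\<^sup>2"
  by (simp add: resid_def power2_eq_square algebra_simps)

lemma resid_square_integrable: "integrable lborel (\<lambda>x. cube x * (resid S x)\<^sup>2)"
  unfolding resid_square_expand using f_square_integrable f_fsum_integrable fsum_square_integrable by simp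

text \<open>By Parseval this is the part of the squared norm of \<open>f\<close> not captured by the
  frequencies in \<open>S\<close>; for the empty set it is the full squared norm.\<close>

definition energy :: "(real^'d) set \<Rightarrow> real" where
  "energy S = (LINT x|lborel. cube x * (resid S x)\<^sup>2)"

lemma energy_nonneg: "0 \<le> energy S"
  unfolding energy_def by (intro Bochner_Integration.integral_nonneg) simp

lemma fsum_energy:
  assumes S: "symmetric_freqs S"
  shows "(LINT x|lborel. cube x * (fsum S x)\<^sup>2) = (\<Sum>\<xi>\<in>S. (norm (fc \<xi>))\<^sup>2)"
proof -
  have fin: "finite S" and sub: "S \<subseteq> int_vectors" and sy: "\<And>\<xi>. \<xi> \<in> S \<Longrightarrow> - \<xi> \<in> S"
    using S by (auto simp: symmetric_freqs_def)
  have "complex_of_real (LINT x|lborel. cube x * (fsum S x)\<^sup>2)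
      = (LINT x|lborel. complex_of_real (cube x) * (trig_poly fc (\<lambda>\<xi>. \<xi>) S x * trig_poly fc (\<lambda>\<xi>. \<xi>) S x))"
    unfolding fsum_complex[OF S] by (subst integral_complex_of_real[symmetric]) (simp add: power2_eq_square)
  also have "\<dots> = (\<Sum>\<xi>\<in>S. \<Sum>\<zeta>\<in>S. fc \<xi> * fc \<zeta> * fourier_int cube (\<xi> + \<zeta>))"
    unfolding trig_poly_mult by (subst integral_trig_poly[OF cube_integrable]) (simp add: sum.cartesian_product case_prod_unfold)
  also have "\<dots> = (\<Sum>\<xi>\<in>S. fc \<xi> * fc (- \<xi>))"
  proof (rule sum.cong[OF refl])
    fix \<xi> assume \<xi>: "\<xi> \<in> S"
    have "(\<Sum>\<zeta>\<in>S. fc \<xi> * fc \<zeta> * fourier_int cube (\<xi> + \<zeta>)) = (\<Sum>\<zeta>\<in>S. if \<zeta> = - \<xi> then fc \<xi> * fc (- \<xi>) else 0)"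
    proof (rule sum.cong[OF refl])
      fix \<zeta> assume "\<zeta> \<in> S"
      then have "\<xi> + \<zeta> \<in> int_vectors" using \<xi> sub by (intro int_vectors_closed) auto
      from fourier_int_cube[OF this] show "fc \<xi> * fc \<zeta> * fourier_int cube (\<xi> + \<zeta>) = (if \<zeta> = - \<xi> then fc \<xi> * fc (- \<xi>) else 0)"
        by (auto simp: add_eq_0_iff)
    qed
    also have "\<dots> = fc \<xi> * fc (- \<xi>)" using fin sy[OF \<xi>] by (simp add: sum.delta)
    finally show "(\<Sum>\<zeta>\<in>S. fc \<xi> * fc \<zeta> * fourier_int cube (\<xi> + \<zeta>)) = fc \<xi> * fc (- \<xi>)" .
  qed
  also have "\<dots> = complex_of_real (\<Sum>\<xi>\<in>S. (norm (fc \<xi>))\<^sup>2)" by (simp only: fc_mult_uminus of_real_sum)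
  finally show ?thesis by (simp only: of_real_eq_iff)
qed

lemma f_fsum_inner:
  assumes S: "symmetric_freqs S"
  shows "(LINT x|lborel. cube x * (f x * fsum S x)) = (\<Sum>\<xi>\<in>S. (norm (fc \<xi>))\<^sup>2)"
proof -
  have "complex_of_real (LINT x|lborel. cube x * (f x * fsum S x))
      = (LINT x|lborel. complex_of_real (cube x * f x) * trig_poly fc (\<lambda>\<xi>. \<xi>) S x)"
    unfolding fsum_complex[OF S] by (subst integral_complex_of_real[symmetric]) (simp add: mult.assoc)
  also have "\<dots> = (\<Sum>\<xi>\<in>S. fc \<xi> * fourier_int (\<lambda>x. cube x * f x) \<xi>)"
    by (rule integral_trig_poly[OF f_integrable])
  also have "\<dots> = (\<Sum>\<xi>\<in>S. fc \<xi> * fc (- \<xi>))" by (simp add: fourier_int_def fc_def)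
  also have "\<dots> = complex_of_real (\<Sum>\<xi>\<in>S. (norm (fc \<xi>))\<^sup>2)" by (simp only: fc_mult_uminus of_real_sum)
  finally show ?thesis by (simp only: of_real_eq_iff)
qed

lemma energy_eq:
  assumes "symmetric_freqs S"
  shows "energy S = (LINT x|lborel. cube x * (f x)\<^sup>2) - (\<Sum>\<xi>\<in>S. (norm (fc \<xi>))\<^sup>2)"
  unfolding energy_def resid_square_expand
  using f_square_integrable f_fsum_integrable[of S] fsum_square_integrable[of S]
  by (simp add: f_fsum_inner[OF assms] fsum_energy[OF assms])

lemma energy_mono:
  assumes "symmetric_freqs S" "symmetric_freqs T" "T \<subseteq> S" shows "energy S \<le> energy T"
proof -
  have "(\<Sum>\<xi>\<in>T. (norm (fc \<xi>))\<^sup>2) \<le> (\<Sum>\<xi>\<in>S. (norm (fc \<xi>))\<^sup>2)"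
    using assms by (intro sum_mono2) (auto simp: symmetric_freqs_def)
  then show ?thesis using assms by (simp add: energy_eq)
qed

lemma energy_diff:
  assumes "symmetric_freqs S" "symmetric_freqs T" "T \<subseteq> S"
  shows "(\<Sum>\<xi>\<in>S - T. (norm (fc \<xi>))\<^sup>2) \<le> energy T"
proof -
  have "(\<Sum>\<xi>\<in>S. (norm (fc \<xi>))\<^sup>2) = (\<Sum>\<xi>\<in>S - T. (norm (fc \<xi>))\<^sup>2) + (\<Sum>\<xi>\<in>T. (norm (fc \<xi>))\<^sup>2)"
    using assms by (intro sum.subset_diff) (auto simp: symmetric_freqs_def)
  then show ?thesis using energy_eq[OF assms(1)] energy_eq[OF assms(2)] energy_nonneg[of S] by linarith
qed

lemma symmetric_freq_box: "symmetric_freqs (freq_box a)"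
  unfolding symmetric_freqs_def using freq_box_finite freq_box_props by blast

definition eps :: "nat \<Rightarrow> real" where "eps m = sqrt (energy (freq_box (2 ^ m)))"

lemma eps_nonneg: "0 \<le> eps m"
  by (simp add: eps_def energy_nonneg)

lemma eps_antimono: "m \<le> n \<Longrightarrow> eps n \<le> eps m"
  unfolding eps_def by (intro real_sqrt_le_mono energy_mono symmetric_freq_box freq_box_props(4)) (simp add: power_increasing)

lemma fourier_partial_sum_eq: "fourier_partial_sum f a x = complex_of_real (fsum (freq_box a) x)"
proof -
  have "exp (2 * complex_of_real pi * \<i> * complex_of_real (\<xi> \<bullet> x)) = wave \<xi> x" for \<xi>
    by (simp add: wave_def cis_conv_exp mult_ac)
  then show ?thesis
    unfolding fourier_partial_sum_def fsum_complex[OF symmetric_freq_box, symmetric] trig_poly_def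
    by (simp add: fourier_coeff_eq)
qed

lemma L2_norm_cube_eq:
  "L2_norm_cube (\<lambda>x. complex_of_real (f x) - fourier_partial_sum f (2 ^ m) x) = eps m"
proof -
  have "(LINT x:unit_cube|lebesgue. (cmod (complex_of_real (f x) - fourier_partial_sum f (2 ^ m) x))\<^sup>2)
      = (LINT x|lebesgue. cube x * (resid (freq_box (2 ^ m)) x)\<^sup>2)"
    unfolding set_lebesgue_integral_def fourier_partial_sum_eq of_real_diff[symmetric] norm_of_real resid_def by simp
  also have "\<dots> = energy (freq_box (2 ^ m))"
    unfolding energy_def by (rule integral_completion) simp
  finally show ?thesis by (simp add: L2_norm_cube_def eps_def)
qed

text \<open>Bessel's inequality beyond the frequencies of \<open>T\<close>. Since \<open>G\<close>
  need not be symmetric, it is first enlarged by its negatives, which can only increase the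
  sum.\<close>

lemma coeff_energy:
  assumes G: "finite G" "G \<subseteq> int_vectors" and T: "symmetric_freqs T" and disj: "G \<inter> T = {}"
  shows "(\<Sum>\<xi>\<in>G. (norm (fc \<xi>))\<^sup>2) \<le> energy T"
proof -
  define S where "S = G \<union> uminus ` G \<union> T"
  have S: "symmetric_freqs S"
    using G T unfolding S_def symmetric_freqs_def by (auto intro: int_vectors_closed)
  have "(\<Sum>\<xi>\<in>G. (norm (fc \<xi>))\<^sup>2) \<le> (\<Sum>\<xi>\<in>S - T. (norm (fc \<xi>))\<^sup>2)"
    by (rule sum_mono2) (use S disj in \<open>auto simp: S_def symmetric_freqs_def\<close>)
  also have "\<dots> \<le> energy T" by (rule energy_diff[OF S T]) (simp add: S_def)
  finally show ?thesis .
qed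

lemma symmetric_empty: "symmetric_freqs {}"
  by (simp add: symmetric_freqs_def)

end

section \<open>Approximation by trigonometric polynomials\<close>

locale gap_system = expanding_matrix A q + periodic_L2 f
  for A :: "real^'d^'d" and q :: real and f :: "real^'d \<Rightarrow> real" +
  fixes w V :: "real^'d \<Rightarrow> real" and b :: real
  assumes w_integrable: "integrable lborel w" and w_nonneg: "\<And>x. 0 \<le> w x"
    and w_band: "\<And>\<eta>. b \<le> norm \<eta> \<Longrightarrow> fourier_int w \<eta> = 0" and b_pos: "0 < b"
    and V_integrable: "integrable lborel V"
    and w_le_V: "\<And>x u. norm u \<le> sqrt CARD('d) \<Longrightarrow> w x \<le> V (x + u)"
    and eps_summable: "summable eps"
begin

lemma w_borel [measurable]: "w \<in> borel_measurable borel" and V_borel [measurable]: "V \<in> borel_measurable borel"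
  using w_integrable V_integrable by auto

lemma V_nonneg: "0 \<le> V x"
  using w_le_V[of 0 x] w_nonneg[of x] by simp

definition Vi :: real where "Vi = (LINT x|lborel. V x)"

lemma Vi_nonneg: "0 \<le> Vi"
  unfolding Vi_def by (intro Bochner_Integration.integral_nonneg V_nonneg)

definition periodic :: "(real^'d \<Rightarrow> real) \<Rightarrow> bool" where
  "periodic u \<longleftrightarrow> (\<forall>x m. m \<in> int_vectors \<longrightarrow> u (x + m) = u x)"

text \<open>Square integrability on the cube carries over to the weighted orbit with a constant
  independent of \<open>k\<close>, although \<open>A^k\<close> does not preserve the
  lattice.\<close>

lemma weighted_bound:
  assumes [measurable]: "u \<in> borel_measurable borel" and per: "periodic u"
    and int: "integrable lborel (\<lambda>x. cube x * (u x)\<^sup>2)"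
  shows "integrable lborel (\<lambda>x. w x * (u (matrix_power A k *v x))\<^sup>2)"
    and "(LINT x|lborel. w x * (u (matrix_power A k *v x))\<^sup>2) \<le> Vi * (LINT x|lborel. cube x * (u x)\<^sup>2)"
proof -
  have [measurable]: "(\<lambda>x. u (matrix_power A k *v x)) \<in> borel_measurable borel"
    by (rule measurable_compose[OF mult_vector_measurable assms(1)])
  define E where "E = (LINT x|lborel. cube x * (u x)\<^sup>2)"
  have E: "0 \<le> E" unfolding E_def by (intro Bochner_Integration.integral_nonneg) simp
  have "(\<integral>\<^sup>+x. ennreal (w x * (u (matrix_power A k *v x))\<^sup>2) \<partial>lborel)
      = (\<integral>\<^sup>+x. ennreal (w x) * ennreal ((u (matrix_power A k *v x))\<^sup>2) \<partial>lborel)"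
    by (simp add: ennreal_mult w_nonneg)
  also have "\<dots> \<le> (\<integral>\<^sup>+x. ennreal (V x) \<partial>lborel) * (\<integral>\<^sup>+v. ennreal ((u v)\<^sup>2) * indicator unit_cube v \<partial>lborel)"
    by (rule periodic_weight_bound) (use per w_le_V in \<open>auto simp: periodic_def intro: ennreal_leI\<close>)
  also have "(\<integral>\<^sup>+v. ennreal ((u v)\<^sup>2) * indicator unit_cube v \<partial>lborel) = (\<integral>\<^sup>+v. ennreal (cube v * (u v)\<^sup>2) \<partial>lborel)"
    by (intro nn_integral_cong) (simp add: indicator_def)
  also have "\<dots> = ennreal E" unfolding E_def by (rule nn_integral_eq_integral[OF int]) simp
  also have "(\<integral>\<^sup>+x. ennreal (V x) \<partial>lborel) = ennreal Vi"
    unfolding Vi_def by (rule nn_integral_eq_integral[OF V_integrable]) (simp add: V_nonneg)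
  finally have le: "(\<integral>\<^sup>+x. ennreal (w x * (u (matrix_power A k *v x))\<^sup>2) \<partial>lborel) \<le> ennreal (Vi * E)"
    by (simp add: ennreal_mult Vi_nonneg E)
  show "integrable lborel (\<lambda>x. w x * (u (matrix_power A k *v x))\<^sup>2)"
  proof (rule integrableI_bounded)
    have "(\<integral>\<^sup>+x. ennreal (norm (w x * (u (matrix_power A k *v x))\<^sup>2)) \<partial>lborel)
        = (\<integral>\<^sup>+x. ennreal (w x * (u (matrix_power A k *v x))\<^sup>2) \<partial>lborel)"
      by (simp add: w_nonneg abs_mult)
    also have "\<dots> \<le> ennreal (Vi * E)" by (rule le)
    also have "\<dots> < \<infinity>" by simp
    finally show "(\<integral>\<^sup>+x. ennreal (norm (w x * (u (matrix_power A k *v x))\<^sup>2)) \<partial>lborel) < \<infinity>" .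
  qed simp
  show "(LINT x|lborel. w x * (u (matrix_power A k *v x))\<^sup>2) \<le> Vi * (LINT x|lborel. cube x * (u x)\<^sup>2)"
    using le Vi_nonneg E unfolding E_def[symmetric]
    by (subst integral_eq_nn_integral) (auto simp: w_nonneg intro!: enn2real_leI)
qed

section \<open>Correlations of periodic functions along the orbit\<close>

definition corr :: "(real^'d \<Rightarrow> real) \<Rightarrow> (real^'d \<Rightarrow> real) \<Rightarrow> nat \<Rightarrow> nat \<Rightarrow> real" where
  "corr u v k l = (LINT x|lborel. w x * (u (matrix_power A k *v x) * v (matrix_power A l *v x)))"

definition admissible :: "(real^'d \<Rightarrow> real) \<Rightarrow> bool" where
  "admissible u \<longleftrightarrow> u \<in> borel_measurable borel \<and> periodic u \<and> integrable lborel (\<lambda>x. cube x * (u x)\<^sup>2)"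

definition L2c :: "(real^'d \<Rightarrow> real) \<Rightarrow> real" where
  "L2c u = sqrt (LINT x|lborel. cube x * (u x)\<^sup>2)"

lemma comp_borel: "u \<in> borel_measurable borel \<Longrightarrow> (\<lambda>x. u (matrix_power A k *v x)) \<in> borel_measurable borel"
  by (rule measurable_compose[OF mult_vector_measurable])

lemma corr_integrable:
  assumes "admissible u" "admissible v"
  shows "integrable lborel (\<lambda>x. w x * (u (matrix_power A k *v x) * v (matrix_power A l *v x)))"
  by (rule weighted_product_integrable[OF _ _ _ w_nonneg])
     (use assms in \<open>auto simp: admissible_def intro!: comp_borel weighted_bound\<close>)

lemma corr_bound:
  assumes "admissible u" "admissible v" shows "\<bar>corr u v k l\<bar> \<le> Vi * L2c u * L2c v"
proof -
  have "\<bar>corr u v k l\<bar> \<le> sqrt (LINT x|lborel. w x * (u (matrix_power A k *v x))\<^sup>2)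
      * sqrt (LINT x|lborel. w x * (v (matrix_power A l *v x))\<^sup>2)"
    unfolding corr_def by (rule weighted_Cauchy_Schwarz[OF _ _ _ w_nonneg])
      (use assms in \<open>auto simp: admissible_def intro!: comp_borel weighted_bound\<close>)
  also have "\<dots> \<le> (sqrt Vi * L2c u) * (sqrt Vi * L2c v)"
    unfolding L2c_def real_sqrt_mult[symmetric]
    by (intro mult_mono real_sqrt_le_mono weighted_bound(2) real_sqrt_ge_zero mult_nonneg_nonneg Vi_nonneg
         Bochner_Integration.integral_nonneg)
       (use assms w_nonneg in \<open>auto simp: admissible_def\<close>)
  also have "\<dots> = Vi * L2c u * L2c v" using Vi_nonneg by (simp add: mult_ac)
  finally show ?thesis .
qed

lemma corr_add_left:
  assumes "admissible u" "admissible u'" "admissible v"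
  shows "corr (\<lambda>x. u x + u' x) v k l = corr u v k l + corr u' v k l"
  unfolding corr_def distrib_right distrib_left
  by (rule Bochner_Integration.integral_add) (intro corr_integrable assms)+

lemma corr_add_right:
  assumes "admissible u" "admissible v" "admissible v'"
  shows "corr u (\<lambda>x. v x + v' x) k l = corr u v k l + corr u v' k l"
  unfolding corr_def distrib_left
  by (rule Bochner_Integration.integral_add) (intro corr_integrable assms)+

lemma admissible_fsum: "symmetric_freqs S \<Longrightarrow> admissible (fsum S)"
  unfolding admissible_def periodic_def using fsum_periodic fsum_square_integrable fsum_measurable by blast

lemma admissible_resid: "symmetric_freqs S \<Longrightarrow> admissible (resid S)"
  unfolding admissible_def periodic_def
  using fsum_periodic f_periodic resid_square_integrable resid_measurable by (simp add: resid_def)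

lemma L2c_resid: "L2c (resid (freq_box (2 ^ m))) = eps m"
  by (simp add: L2c_def eps_def energy_def)

text \<open>The later function needs only nonzero integral frequencies, which have norm at least 1
  and so reach \<open>q ^ n\<close>; they may be arbitrarily large and numerous. Only the earlier
  one has to be bounded by \<open>B\<close>. Every combined frequency then lies outside the band of
  \<open>w\<close>.\<close>

lemma corr_fsum_zero:
  assumes S: "symmetric_freqs S" "0 \<notin> S" and T: "symmetric_freqs T"
    and T_bound: "\<And>\<zeta>. \<zeta> \<in> T \<Longrightarrow> norm \<zeta> \<le> B" and gap: "B + b \<le> q ^ n"
  shows "corr (fsum S) (fsum T) (l + n) l = 0"
proof -
  have "complex_of_real (corr (fsum S) (fsum T) (l + n) l)
     = (LINT x|lborel. complex_of_real (w x) * (trig_poly fc (\<lambda>\<xi>. \<xi>) S (matrix_power A (l + n) *v x)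
          * trig_poly fc (\<lambda>\<xi>. \<xi>) T (matrix_power A l *v x)))"
    unfolding fsum_complex[OF S(1)] fsum_complex[OF T] corr_def
    by (subst integral_complex_of_real[symmetric]) simp
  also have "\<dots> = (\<Sum>\<xi>\<in>S. \<Sum>\<zeta>\<in>T. fc \<xi> * fc \<zeta> * fourier_int w (\<xi> v* matrix_power A (l + n) + \<zeta> v* matrix_power A l))"
    unfolding trig_poly_mult_vector trig_poly_mult
    by (subst integral_trig_poly[OF w_integrable]) (simp add: sum.cartesian_product case_prod_unfold)
  also have "\<dots> = 0"
  proof (intro sum.neutral ballI)
    fix \<xi> \<zeta> assume \<xi>: "\<xi> \<in> S" and \<zeta>: "\<zeta> \<in> T"
    have "1 \<le> norm \<xi>" using S \<xi> by (intro norm_int_vector_ge) (auto simp: symmetric_freqs_def)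
    then have "q ^ n \<le> q ^ n * norm \<xi>" using q_power_ge_1[of n] mult_left_mono[of 1 "norm \<xi>" "q ^ n"] by simp
    also have "\<dots> \<le> norm (\<xi> v* matrix_power A n)" by (rule row_expands_power)
    also have "\<dots> \<le> norm (\<xi> v* matrix_power A n + \<zeta>) + norm \<zeta>"
      using norm_triangle_ineq[of "\<xi> v* matrix_power A n + \<zeta>" "- \<zeta>"] by simp
    finally have "b \<le> norm (\<xi> v* matrix_power A n + \<zeta>)" using T_bound[OF \<zeta>] gap by linarith
    also have "\<dots> \<le> norm ((\<xi> v* matrix_power A n + \<zeta>) v* matrix_power A l)" by (rule norm_row_ge)
    also have "(\<xi> v* matrix_power A n + \<zeta>) v* matrix_power A l = \<xi> v* matrix_power A (l + n) + \<zeta> v* matrix_power A l"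
      unfolding add.commute[of l n] matrix_power_add by (simp add: vector_matrix_left_distrib vector_matrix_mul_assoc)
    finally show "fc \<xi> * fc \<zeta> * fourier_int w (\<xi> v* matrix_power A (l + n) + \<zeta> v* matrix_power A l) = 0"
      by (simp add: w_band)
  qed
  finally show ?thesis by simp
qed

lemma eps_tendsto_0: "eps \<longlonglongrightarrow> 0"
  by (rule summable_LIMSEQ_zero[OF eps_summable])

abbreviation box :: "nat \<Rightarrow> (real^'d) set" where "box m \<equiv> freq_box (2 ^ m)"

lemma box_mono: "m \<le> n \<Longrightarrow> box m \<subseteq> box n"
  by (rule freq_box_props(4)) (simp add: power_increasing)

text \<open>The earlier residual is split at \<open>box m\<close>. Its lower part \<open>?h\<close>
  is exactly orthogonal to the later residual: this holds for each finite section of the latter, and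
  the error of the section at level \<open>j\<close> is of order \<open>eps j\<close>. The upper
  part has norm \<open>eps m\<close>, and Cauchy-Schwarz supplies the bound.\<close>

lemma corr_resid_bound:
  assumes gap: "real CARD('d) * 2 ^ m + b \<le> q ^ n" and Mm: "M \<le> m"
  shows "\<bar>corr (resid (box M)) (resid (box M)) (l + n) l\<bar> \<le> Vi * eps M * eps m"
proof -
  let ?h = "fsum (box m - box M)"
  have sM: "symmetric_freqs (box M)" and sm: "symmetric_freqs (box m)" by (rule symmetric_freq_box)+
  note d = fsum_diff[OF sm sM box_mono[OF Mm]]
  have ah: "admissible ?h" by (rule admissible_fsum[OF d(1)])
  have aM: "admissible (resid (box M))" and am: "admissible (resid (box m))" by (rule admissible_resid, rule symmetric_freq_box)+
  have zero: "corr (resid (box M)) ?h (l + n) l = 0"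
  proof -
    have bound: "\<bar>corr (resid (box M)) ?h (l + n) l\<bar> \<le> Vi * eps j * L2c ?h" if j: "M \<le> j" for j
    proof -
      have sj: "symmetric_freqs (box j)" by (rule symmetric_freq_box)
      note dj = fsum_diff[OF sj sM box_mono[OF j]]
      have "resid (box M) = (\<lambda>x. resid (box j) x + fsum (box j - box M) x)"
        by (simp add: fun_eq_iff resid_def dj(2)[symmetric])
      then have "corr (resid (box M)) ?h (l + n) l
          = corr (resid (box j)) ?h (l + n) l + corr (fsum (box j - box M)) ?h (l + n) l"
        using corr_add_left[OF admissible_resid[OF sj] admissible_fsum[OF dj(1)] ah] by simp
      also have "corr (fsum (box j - box M)) ?h (l + n) l = 0"
      proof (rule corr_fsum_zero[OF dj(1) _ d(1) _ gap])
        show "0 \<notin> box j - box M" using freq_box_props(2)[of 0 "2 ^ j"] by blast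
        show "norm \<zeta> \<le> real CARD('d) * 2 ^ m" if "\<zeta> \<in> box m - box M" for \<zeta> :: "real^'d"
          using that by (intro norm_freq_box_le) simp
      qed
      finally have "\<bar>corr (resid (box M)) ?h (l + n) l\<bar> = \<bar>corr (resid (box j)) ?h (l + n) l\<bar>" by simp
      also have "\<dots> \<le> Vi * L2c (resid (box j)) * L2c ?h" by (rule corr_bound[OF admissible_resid[OF sj] ah])
      finally show ?thesis by (simp add: L2c_resid)
    qed
    have "(\<lambda>j. Vi * eps j * L2c ?h) \<longlonglongrightarrow> Vi * 0 * L2c ?h" by (intro tendsto_intros eps_tendsto_0)
    then have "\<bar>corr (resid (box M)) ?h (l + n) l\<bar> \<le> Vi * 0 * L2c ?h"
      by (rule LIMSEQ_le_const) (intro exI[of _ M] allI impI bound)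
    then show ?thesis by simp
  qed
  have "resid (box M) = (\<lambda>x. ?h x + resid (box m) x)"
    by (simp add: fun_eq_iff resid_def d(2)[symmetric])
  then have "corr (resid (box M)) (resid (box M)) (l + n) l
      = corr (resid (box M)) ?h (l + n) l + corr (resid (box M)) (resid (box m)) (l + n) l"
    using corr_add_right[OF aM ah am] by simp
  also have "\<bar>\<dots>\<bar> = \<bar>corr (resid (box M)) (resid (box m)) (l + n) l\<bar>" by (simp add: zero)
  also have "\<dots> \<le> Vi * L2c (resid (box M)) * L2c (resid (box m))" by (rule corr_bound[OF aM am])
  finally show ?thesis by (simp add: L2c_resid)
qed

text \<open>Every \<open>s\<close> further steps at least double \<open>q ^ n\<close> and thus
  permit one more dyadic frequency level; \<open>n0\<close> absorbs the dimension and the band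
  radius.\<close>

lemma gap_parameters:
  "\<exists>s>0. \<exists>n0. \<forall>n\<ge>n0. real CARD('d) * 2 ^ ((n - n0) div s) + b \<le> q ^ n"
proof -
  obtain s where s: "2 < q ^ s" using real_arch_pow[OF q_gt_1] by blast
  obtain n0 where n0: "real CARD('d) + b < q ^ n0" using real_arch_pow[OF q_gt_1] by blast
  have "0 < s" using s by (cases s) auto
  moreover have "real CARD('d) * 2 ^ ((n - n0) div s) + b \<le> q ^ n" if "n0 \<le> n" for n
  proof -
    define k where "k = (n - n0) div s"
    have "(2::real) ^ k \<le> (q ^ s) ^ k" using s by (intro power_mono) auto
    also have "\<dots> \<le> q ^ (n - n0)"
      unfolding power_mult[symmetric] using q_gt_1 by (intro power_increasing) (auto simp: k_def)
    finally have k: "2 ^ k \<le> q ^ (n - n0)" .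
    have "real CARD('d) * 2 ^ k + b \<le> real CARD('d) * q ^ (n - n0) + b * q ^ (n - n0)"
      using k b_pos q_power_ge_1[of "n - n0"] mult_left_mono[OF q_power_ge_1[of "n - n0"], of b]
      by (intro add_mono mult_left_mono) auto
    also have "\<dots> = (real CARD('d) + b) * q ^ (n - n0)" by (simp add: distrib_right)
    also have "\<dots> \<le> q ^ n0 * q ^ (n - n0)" using n0 q_gt_1 by (intro mult_right_mono) auto
    also have "\<dots> = q ^ n" using that by (simp add: power_add[symmetric])
    finally show ?thesis by (simp add: k_def)
  qed
  ultimately show ?thesis by blast
qed

text \<open>Each value is repeated \<open>s\<close> times, so the partial sums are at most
  \<open>s\<close> times the original sum.\<close>

lemma summable_div:
  fixes a :: "nat \<Rightarrow> real"
  assumes "summable a" "\<And>n. 0 \<le> a n" "0 < s" shows "summable (\<lambda>n. a (n div s))"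
proof (rule bounded_imp_summable)
  fix n
  have "(\<Sum>k\<le>n. a (k div s)) \<le> (\<Sum>k<Suc n * s. a (k div s))"
  proof (rule sum_mono2)
    have "Suc n * 1 \<le> Suc n * s" using assms(3) by (intro mult_le_mono2) simp
    then show "{..n} \<subseteq> {..<Suc n * s}" by auto
  qed (use assms(2) in auto)
  also have "\<dots> = (\<Sum>j<Suc n. \<Sum>k\<in>{j * s..<j * s + s}. a (k div s))"
    by (rule sum.nat_group[symmetric])
  also have "\<dots> = (\<Sum>j<Suc n. real s * a j)"
  proof (rule sum.cong[OF refl])
    fix j
    have "(\<Sum>k\<in>{j * s..<j * s + s}. a (k div s)) = (\<Sum>k\<in>{j * s..<j * s + s}. a j)"
      by (rule sum.cong[OF refl]) (use \<open>0 < s\<close> in \<open>auto intro!: arg_cong[of _ _ a] div_nat_eqI simp: mult.commute\<close>)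
    then show "(\<Sum>k\<in>{j * s..<j * s + s}. a (k div s)) = real s * a j" by simp
  qed
  also have "\<dots> \<le> real s * suminf a"
    unfolding sum_distrib_left[symmetric] using assms by (intro mult_left_mono sum_le_suminf) auto
  finally show "(\<Sum>k\<le>n. a (k div s)) \<le> real s * suminf a" .
qed (use assms in auto)

text \<open>One factor \<open>eps M\<close> is retained from each covariance, and the other factor
  is summed over the lag. This linear gain in \<open>eps M\<close>, with \<open>K\<close> free of
  both \<open>M\<close> and \<open>N\<close>, makes the approximation uniform in time.\<close>

proposition resid_second_moment:
  "\<exists>K\<ge>0. \<forall>M N. (LINT x|lborel. w x * (\<Sum>k<N. resid (box M) (matrix_power A (Suc k) *v x))\<^sup>2) \<le> real N * (K * eps M)"
proof -
  obtain n0 s where s: "0 < s" and gap: "\<And>n. n0 \<le> n \<Longrightarrow> real CARD('d) * 2 ^ ((n - n0) div s) + b \<le> q ^ n"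
    using gap_parameters by blast
  \<comment> \<open>A summable bound in the lag \<open>n\<close>. Lags below \<open>n0\<close> offer
    no frequency gap and receive the largest value \<open>eps 0\<close>.\<close>
  define \<beta> where "\<beta> n = (if n < n0 then eps 0 else eps ((n - n0) div s))" for n
  have \<beta>: "0 \<le> \<beta> n" for n by (simp add: \<beta>_def eps_nonneg)
  have sum_\<beta>: "summable \<beta>"
  proof -
    have "summable (\<lambda>n. \<beta> (n + n0))"
      using summable_div[OF eps_summable eps_nonneg s] by (simp add: \<beta>_def)
    then show ?thesis by (simp only: summable_iff_shift)
  qed
  define K where "K = Vi * (2 * suminf \<beta>)"
  have K: "0 \<le> K" unfolding K_def using Vi_nonneg suminf_nonneg[OF sum_\<beta> \<beta>] by simp
  have main: "(LINT x|lborel. w x * (\<Sum>k<N. resid (box M) (matrix_power A (Suc k) *v x))\<^sup>2) \<le> real N * (K * eps M)" for M N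
  proof -
    let ?r = "resid (box M)"
    have a: "admissible ?r" by (rule admissible_resid[OF symmetric_freq_box])
    have bound: "corr ?r ?r (l + n) l \<le> Vi * eps M * \<beta> n" for l n
    proof -
      have triv: "\<bar>corr ?r ?r (l + n) l\<bar> \<le> Vi * eps M * eps M" using corr_bound[OF a a, of "l + n" l] by (simp add: L2c_resid)
      have "\<bar>corr ?r ?r (l + n) l\<bar> \<le> Vi * eps M * \<beta> n"
      \<comment> \<open>If the level permitted by the lag is still below \<open>M\<close>, splitting
        is of no use; plain Cauchy-Schwarz gives the square of \<open>eps M\<close>, and one of
        these factors is at most \<open>\<beta> n\<close> by monotonicity.\<close>
      proof (cases "n < n0 \<or> (n - n0) div s < M")
        case True
        then have "eps M \<le> \<beta> n" using eps_antimono[of 0 M] eps_antimono[of "(n - n0) div s" M] by (auto simp: \<beta>_def)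
        then have "Vi * eps M * eps M \<le> Vi * eps M * \<beta> n" using Vi_nonneg eps_nonneg by (intro mult_left_mono) auto
        then show ?thesis using triv by linarith
      next
        case False
        then show ?thesis using corr_resid_bound[OF gap, of n M l] by (simp add: \<beta>_def)
      qed
      then show ?thesis by linarith
    qed
    define X where "X k x = ?r (matrix_power A (Suc k) *v x)" for k x
    have int: "integrable lborel (\<lambda>x. w x * (X k x * X l x))" for k l
      unfolding X_def by (rule corr_integrable[OF a a])
    have "(LINT x|lborel. w x * (\<Sum>k<N. X k x)\<^sup>2)
        = (LINT x|lborel. (\<Sum>m<N. w x * (X m x * X m x) + 2 * (\<Sum>k<m. w x * (X k x * X m x))))"
      by (simp only: square_sum_by_max sum_distrib_left distrib_left mult.left_commute[of "w x" 2 for x])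
    also have "\<dots> = (\<Sum>m<N. (LINT x|lborel. w x * (X m x * X m x)) + 2 * (\<Sum>k<m. (LINT x|lborel. w x * (X k x * X m x))))"
      by (simp add: Bochner_Integration.integral_sum Bochner_Integration.integral_add int)
    also have "\<dots> \<le> (\<Sum>m<N. K * eps M)"
    proof (rule sum_mono)
      fix m
      have c: "(LINT x|lborel. w x * (X k x * X m x)) \<le> Vi * eps M * \<beta> (m - k)" if "k \<le> m" for k
      proof -
        have "(LINT x|lborel. w x * (X k x * X m x)) = corr ?r ?r (Suc k + (m - k)) (Suc k)"
          unfolding corr_def X_def using that by (simp add: mult.commute)
        then show ?thesis using bound[of "Suc k" "m - k"] by simp
      qed
      have "(LINT x|lborel. w x * (X m x * X m x)) + 2 * (\<Sum>k<m. (LINT x|lborel. w x * (X k x * X m x)))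
         \<le> Vi * eps M * \<beta> 0 + 2 * (\<Sum>k<m. Vi * eps M * \<beta> (m - k))"
        using c[of m] by (intro add_mono mult_left_mono sum_mono c) auto
      also have "(\<Sum>k<m. Vi * eps M * \<beta> (m - k)) = Vi * eps M * (\<Sum>n<m. \<beta> (Suc n))"
        unfolding sum_distrib_left[symmetric] using sum.nat_diff_reindex[of "\<lambda>n. \<beta> (Suc n)" m] by (simp add: Suc_diff_Suc)
      also have "Vi * eps M * \<beta> 0 + 2 * (Vi * eps M * (\<Sum>n<m. \<beta> (Suc n)))
          = Vi * eps M * (\<beta> 0 + 2 * (\<Sum>n<m. \<beta> (Suc n)))" by (simp add: algebra_simps)
      also have "\<dots> \<le> Vi * eps M * (2 * suminf \<beta>)"
      proof (rule mult_left_mono)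
        have "\<beta> 0 + (\<Sum>n<m. \<beta> (Suc n)) = (\<Sum>n<Suc m. \<beta> n)" by (rule sum.lessThan_Suc_shift[symmetric])
        also have "\<dots> \<le> suminf \<beta>" by (rule sum_le_suminf[OF sum_\<beta>]) (auto simp: \<beta>)
        finally show "\<beta> 0 + 2 * (\<Sum>n<m. \<beta> (Suc n)) \<le> 2 * suminf \<beta>" using \<beta>[of 0] by linarith
      qed (use Vi_nonneg eps_nonneg in simp)
      also have "\<dots> = K * eps M" by (simp add: K_def)
      finally show "(LINT x|lborel. w x * (X m x * X m x)) + 2 * (\<Sum>k<m. (LINT x|lborel. w x * (X k x * X m x))) \<le> K * eps M" .
    qed
    finally show ?thesis by (simp add: X_def)
  qed
  then show ?thesis using K by blast
qed

section \<open>Absolute convergence of the variance series\<close>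

definition pair_coeff :: "nat \<Rightarrow> (real^'d) \<times> (real^'d) \<Rightarrow> complex" where
  "pair_coeff n p = fc (fst p) * fc (snd p) * of_bool (fst p + snd p v* matrix_power A n = 0)"

text \<open>The cancellation condition determines either frequency from the other, as
  \<open>A^n\<close> is injective on rows. The double sum therefore runs along a graph, and
  Cauchy-Schwarz bounds it by the energies of the two projections; by \<open>out\<close>, the first
  one avoids \<open>T\<close>.\<close>

lemma pair_sum_bound:
  assumes F: "finite F" "F \<subseteq> int_vectors \<times> int_vectors" and T: "symmetric_freqs T"
    and out: "\<And>\<xi> \<zeta>. \<zeta> \<in> int_vectors \<Longrightarrow> \<zeta> \<noteq> 0 \<Longrightarrow> \<xi> = - (\<zeta> v* matrix_power A n) \<Longrightarrow> \<xi> \<notin> T"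
  shows "(\<Sum>p\<in>F. norm (pair_coeff n p)) \<le> sqrt (energy T) * sqrt (energy {})"
proof -
  define F' where "F' = {p \<in> F. fst p + snd p v* matrix_power A n = 0 \<and> snd p \<noteq> 0}"
  have F': "finite F'" "F' \<subseteq> int_vectors \<times> int_vectors" using F by (auto simp: F'_def)
  have F'_eq: "fst p = - (snd p v* matrix_power A n)" "snd p \<noteq> 0" "snd p \<in> int_vectors" if "p \<in> F'" for p
    using that F' by (auto simp: F'_def eq_neg_iff_add_eq_0)
  have inj1: "inj_on fst F'"
  proof (rule inj_onI)
    fix p p' assume p: "p \<in> F'" "p' \<in> F'" "fst p = fst p'"
    then have "(snd p - snd p') v* matrix_power A n = 0"
      using F'_eq(1)[OF p(1)] F'_eq(1)[OF p(2)] by (simp add: vector_matrix_mult_diff_distrib)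
    then show "p = p'" using p(3) by (simp add: row_eq_0_iff prod_eq_iff)
  qed
  have inj2: "inj_on snd F'"
    by (rule inj_onI) (simp add: prod_eq_iff F'_eq(1))
  have "(\<Sum>p\<in>F. norm (pair_coeff n p)) = (\<Sum>p\<in>F'. norm (fc (fst p)) * norm (fc (snd p)))"
  proof (rule sum.mono_neutral_cong_right)
    show "\<forall>p\<in>F - F'. norm (pair_coeff n p) = 0"
      by (auto simp: F'_def pair_coeff_def fc_zero)
  qed (use F in \<open>auto simp: F'_def pair_coeff_def norm_mult\<close>)
  also have "\<dots> = (\<Sum>p\<in>F'. \<bar>norm (fc (fst p))\<bar> * \<bar>norm (fc (snd p))\<bar>)" by simp
  also have "\<dots> \<le> L2_set (\<lambda>p. norm (fc (fst p))) F' * L2_set (\<lambda>p. norm (fc (snd p))) F'"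
    by (rule L2_set_mult_ineq)
  also have "\<dots> \<le> sqrt (energy T) * sqrt (energy {})"
  proof (rule mult_mono)
    have "(\<Sum>p\<in>F'. (norm (fc (fst p)))\<^sup>2) = (\<Sum>\<xi>\<in>fst ` F'. (norm (fc \<xi>))\<^sup>2)"
      by (simp add: sum.reindex[OF inj1])
    also have "\<dots> \<le> energy T"
    proof (rule coeff_energy[OF _ _ T])
      show "fst ` F' \<inter> T = {}" using out F'_eq by blast
    qed (use F' in auto)
    finally show "L2_set (\<lambda>p. norm (fc (fst p))) F' \<le> sqrt (energy T)"
      unfolding L2_set_def by (rule real_sqrt_le_mono)
    have "(\<Sum>p\<in>F'. (norm (fc (snd p)))\<^sup>2) = (\<Sum>\<xi>\<in>snd ` F'. (norm (fc \<xi>))\<^sup>2)"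
      by (simp add: sum.reindex[OF inj2])
    also have "\<dots> \<le> energy {}"
      by (rule coeff_energy[OF _ _ symmetric_empty]) (use F' in auto)
    finally show "L2_set (\<lambda>p. norm (fc (snd p))) F' \<le> sqrt (energy {})"
      unfolding L2_set_def by (rule real_sqrt_le_mono)
  qed (auto simp: energy_nonneg)
  finally show ?thesis .
qed

text \<open>For large \<open>n\<close> the first frequency of a cancelling pair has norm at least
  \<open>q ^ n\<close>. It thus lies outside a box whose level is proportional to \<open>n\<close>,
  and the tail \<open>eps\<close> at that level is summable.\<close>

lemma pair_coeff_bound:
  "\<exists>\<gamma>. summable \<gamma> \<and> (\<forall>n F. finite F \<longrightarrow> F \<subseteq> int_vectors \<times> int_vectors \<longrightarrow> (\<Sum>p\<in>F. norm (pair_coeff n p)) \<le> \<gamma> n)"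
proof -
  obtain s n0 where s: "0 < s" and gap: "\<And>n. n0 \<le> n \<Longrightarrow> real CARD('d) * 2 ^ ((n - n0) div s) + b \<le> q ^ n"
    using gap_parameters by blast
  define E where "E = sqrt (energy {})"
  define \<gamma> where "\<gamma> n = (if n < n0 then E else eps ((n - n0) div s)) * E" for n
  have "summable (\<lambda>n. \<gamma> (n + n0))"
    using summable_mult2[OF summable_div[OF eps_summable eps_nonneg s], of E] by (simp add: \<gamma>_def)
  then have "summable \<gamma>" by (simp only: summable_iff_shift)
  moreover have "(\<Sum>p\<in>F. norm (pair_coeff n p)) \<le> \<gamma> n" if F: "finite F" "F \<subseteq> int_vectors \<times> int_vectors" for n F
  proof (cases "n < n0")
    case True
    then show ?thesis using pair_sum_bound[OF F symmetric_empty, of n] by (simp add: \<gamma>_def E_def)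
  next
    case False
    have "(\<Sum>p\<in>F. norm (pair_coeff n p)) \<le> sqrt (energy (box ((n - n0) div s))) * sqrt (energy {})"
    proof (rule pair_sum_bound[OF F symmetric_freq_box])
      fix \<xi> \<zeta> :: "real^'d" assume \<zeta>: "\<zeta> \<in> int_vectors" "\<zeta> \<noteq> 0" and \<xi>: "\<xi> = - (\<zeta> v* matrix_power A n)"
      have "q ^ n * 1 \<le> q ^ n * norm \<zeta>"
        using norm_int_vector_ge[OF \<zeta>] q_power_ge_1[of n] by (intro mult_left_mono) auto
      also have "\<dots> \<le> norm \<xi>" unfolding \<xi> using row_expands_power[of n \<zeta>] by simp
      finally have "real CARD('d) * 2 ^ ((n - n0) div s) < norm \<xi>"
        using gap[of n] False b_pos by simp
      then show "\<xi> \<notin> box ((n - n0) div s)" using norm_freq_box_le[of \<xi> "2 ^ ((n - n0) div s)"] by auto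
    qed
    then show ?thesis using False by (simp add: \<gamma>_def E_def eps_def)
  qed
  ultimately show ?thesis by blast
qed

definition pair_sum :: "nat \<Rightarrow> complex" where
  "pair_sum n = infsum (pair_coeff n) (int_vectors \<times> int_vectors)"

lemma pair_abs_summable: "(\<lambda>p. norm (pair_coeff n p)) summable_on (int_vectors \<times> int_vectors)"
proof -
  obtain \<gamma> where "\<And>n F. finite F \<Longrightarrow> F \<subseteq> int_vectors \<times> int_vectors \<Longrightarrow> (\<Sum>p\<in>F. norm (pair_coeff n p)) \<le> \<gamma> n"
    using pair_coeff_bound by blast
  then have "bdd_above (sum (\<lambda>p. norm (pair_coeff n p)) ` {F. F \<subseteq> int_vectors \<times> int_vectors \<and> finite F})"
    by (intro bdd_aboveI2[of _ _ "\<gamma> n"]) auto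
  then show ?thesis by (simp only: abs_summable_iff_bdd_above)
qed

text \<open>Allows an unordered sum to be evaluated along dyadic boxes. The boxes never contain 0,
  so the exhaustion is of the nonzero frequencies.\<close>

lemma box_pairs_filterlim:
  "filterlim (\<lambda>M. box M \<times> box M) (finite_subsets_at_top ((int_vectors - {0}) \<times> (int_vectors - {0}))) sequentially"
  unfolding filterlim_iff
proof (intro allI impI)
  fix P :: "((real^'d) \<times> (real^'d)) set \<Rightarrow> bool"
  assume "eventually P (finite_subsets_at_top ((int_vectors - {0}) \<times> (int_vectors - {0})))"
  then obtain X where X: "finite X" "X \<subseteq> (int_vectors - {0}) \<times> (int_vectors - {0})"
    and P: "\<And>Y. finite Y \<Longrightarrow> X \<subseteq> Y \<Longrightarrow> Y \<subseteq> (int_vectors - {0}) \<times> (int_vectors - {0}) \<Longrightarrow> P Y"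
    unfolding eventually_finite_subsets_at_top by metis
  have ev: "eventually (\<lambda>M. \<xi> \<in> box M) sequentially" if \<xi>: "\<xi> \<in> int_vectors - {0}" for \<xi> :: "real^'d"
  proof -
    obtain M0 where M0: "norm \<xi> < 2 ^ M0" using real_arch_pow[of 2 "norm \<xi>"] by auto
    have "\<xi> \<in> box M0"
      using \<xi> M0 component_le_norm_cart[of \<xi>] by (auto simp: freq_box_def intro: order_trans[OF _ less_imp_le])
    then show ?thesis unfolding eventually_sequentially using box_mono by blast
  qed
  have "eventually (\<lambda>M. p \<in> box M \<times> box M) sequentially" if "p \<in> X" for p
  proof -
    have "fst p \<in> int_vectors - {0}" "snd p \<in> int_vectors - {0}"
      using subsetD[OF X(2) that] by (simp_all add: mem_Times_iff)
    from eventually_conj[OF ev[OF this(1)] ev[OF this(2)]] show ?thesis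
      by eventually_elim (simp add: mem_Times_iff)
  qed
  then have "eventually (\<lambda>M. \<forall>p\<in>X. p \<in> box M \<times> box M) sequentially"
    by (intro eventually_ball_finite X(1)) blast
  then show "eventually (\<lambda>M. P (box M \<times> box M)) sequentially"
  proof eventually_elim
    case (elim M)
    show ?case
    proof (rule P)
      have "box M \<subseteq> int_vectors - {0}" by (auto simp: freq_box_def)
      then show "box M \<times> box M \<subseteq> (int_vectors - {0}) \<times> (int_vectors - {0})" by (intro Sigma_mono)
      show "X \<subseteq> box M \<times> box M" using elim by blast
    qed (simp add: freq_box_finite)
  qed
qed

lemma pair_sum_limit: "(\<lambda>M. sum (pair_coeff n) (box M \<times> box M)) \<longlonglongrightarrow> pair_sum n"
proof -
  have "(pair_coeff n has_sum pair_sum n) (int_vectors \<times> int_vectors)"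
    unfolding pair_sum_def by (rule has_sum_infsum[OF abs_summable_summable[OF pair_abs_summable]])
  moreover have "(pair_coeff n has_sum pair_sum n) (int_vectors \<times> int_vectors)
      \<longleftrightarrow> (pair_coeff n has_sum pair_sum n) ((int_vectors - {0}) \<times> (int_vectors - {0}))"
    by (rule has_sum_cong_neutral) (auto simp: pair_coeff_def fc_zero)
  ultimately have "(pair_coeff n has_sum pair_sum n) ((int_vectors - {0}) \<times> (int_vectors - {0}))" by simp
  then show ?thesis unfolding has_sum_def by (rule filterlim_compose[OF _ box_pairs_filterlim])
qed

text \<open>Orbit sums begin with exponent 1, so the relevant polynomial is composed with
  \<open>A\<close> and has frequencies \<open>\<xi> v* A\<close>. Injectivity of \<open>A\<close> on
  rows removes this factor from the cancellation condition.\<close>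

lemma box_corr: "trig_corr fc (\<lambda>\<xi>. \<xi> v* A) (box M) A n = sum (pair_coeff n) (box M \<times> box M)"
proof -
  have "\<xi> v* A + (\<zeta> v* A) v* matrix_power A n = (\<xi> + \<zeta> v* matrix_power A n) v* matrix_power A 1" for \<xi> \<zeta>
  proof -
    have "A ** matrix_power A n = matrix_power A n ** A" using matrix_power_add[of A n 1] by simp
    then show ?thesis by (simp add: vector_matrix_left_distrib vector_matrix_mul_assoc)
  qed
  then have "\<xi> v* A + (\<zeta> v* A) v* matrix_power A n = 0 \<longleftrightarrow> \<xi> + \<zeta> v* matrix_power A n = 0" for \<xi> \<zeta>
    by (simp only: row_eq_0_iff)
  then show ?thesis
    unfolding trig_corr_def pair_coeff_def sum.cartesian_product by (simp only: case_prod_unfold)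
qed

text \<open>Tannery's theorem exchanges the growth of the boxes with the series over lags, dominated
  by \<open>\<gamma>\<close>. Lag 0 is kept apart because it is counted once and all others
  twice.\<close>

proposition limiting_variance_box:
  "(\<lambda>M. Re (trig_variance fc (\<lambda>\<xi>. \<xi> v* A) (box M) A)) \<longlonglongrightarrow> limiting_variance A f"
proof -
  obtain \<gamma> where \<gamma>: "summable \<gamma>" and b: "\<And>n F. finite F \<Longrightarrow> F \<subseteq> int_vectors \<times> int_vectors \<Longrightarrow> (\<Sum>p\<in>F. norm (pair_coeff n p)) \<le> \<gamma> n"
    using pair_coeff_bound by blast
  have box_b: "norm (sum (pair_coeff n) (box M \<times> box M)) \<le> \<gamma> n" for n M
    by (rule order_trans[OF norm_sum b]) (auto simp: freq_box_finite dest: freq_box_props(1))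
  have \<gamma>S: "summable (\<lambda>n. \<gamma> (Suc n))" using \<gamma> by (simp only: summable_Suc_iff)
  have "eventually (\<lambda>(k, M). norm (sum (pair_coeff (Suc k)) (box M \<times> box M)) \<le> \<gamma> (Suc k)) (at_top \<times>\<^sub>F sequentially)"
    by (intro always_eventually allI) (simp add: case_prod_unfold box_b)
  from tannerys_theorem[OF pair_sum_limit this \<gamma>S sequentially_bot]
  have ns: "summable (\<lambda>n. norm (pair_sum (Suc n)))"
    and lim: "(\<lambda>M. \<Sum>k. sum (pair_coeff (Suc k)) (box M \<times> box M)) \<longlonglongrightarrow> (\<Sum>k. pair_sum (Suc k))"
    by auto
  have "(\<lambda>M. trig_variance fc (\<lambda>\<xi>. \<xi> v* A) (box M) A) \<longlonglongrightarrow> pair_sum 0 + 2 * (\<Sum>k. pair_sum (Suc k))"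
    unfolding trig_variance_def box_corr by (intro tendsto_intros pair_sum_limit lim)
  moreover have "limiting_variance A f = Re (pair_sum 0 + 2 * (\<Sum>k. pair_sum (Suc k)))"
  proof -
    define t where "t l = (2 - of_bool (l = 0)) * pair_sum l" for l
    have inner: "(\<Sum>\<^sub>\<infinity>(\<xi>, \<xi>')\<in>int_vectors \<times> int_vectors.
        fourier_coeff f \<xi> * fourier_coeff f \<xi>' * of_bool (\<xi> + \<xi>' v* matrix_power A l = 0)) = pair_sum l" for l
      unfolding pair_sum_def fourier_coeff_eq pair_coeff_def[abs_def] case_prod_unfold ..
    have nt: "summable (\<lambda>l. norm (t l))"
    proof -
      have "summable (\<lambda>l. norm (t (Suc l)))"
        using summable_mult[OF ns, of 2] by (simp add: t_def norm_mult)
      then show ?thesis using summable_Suc_iff[of "\<lambda>l. norm (t l)"] by simp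
    qed
    have "infsum t UNIV = suminf t"
      by (rule infsumI, rule norm_summable_imp_has_sum[OF nt]) (intro summable_sums summable_norm_cancel[OF nt])
    also have "\<dots> = t 0 + (\<Sum>l. t (Suc l))"
      using suminf_split_head[OF summable_norm_cancel[OF nt]] by simp
    also have "(\<Sum>l. t (Suc l)) = 2 * (\<Sum>l. pair_sum (Suc l))"
      using suminf_mult[OF summable_norm_cancel[OF ns], of 2] by (simp add: t_def)
    finally show ?thesis unfolding limiting_variance_def inner by (simp add: t_def)
  qed
  ultimately show ?thesis by (simp only: tendsto_Re)
qed

end

section \<open>Convergence in distribution\<close>

lemma centered_normal_real_distribution:
  assumes "0 \<le> v" shows "real_distribution (centered_normal v)"
proof (cases "v = 0")
  case True
  have "real_distribution (return borel (0::real))"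
    by (intro real_distribution.intro prob_space_return real_distribution_axioms.intro) simp_all
  then show ?thesis using True by (simp add: centered_normal_def)
next
  case False
  then have "0 < sqrt v" using assms by simp
  then have "real_distribution (density lborel (normal_density 0 (sqrt v)))"
    by (intro real_distribution.intro prob_space_normal_density real_distribution_axioms.intro) simp_all
  then show ?thesis using False by (simp add: centered_normal_def)
qed

text \<open>The nondegenerate law is the image of the standard one under scaling by
  \<open>sqrt v\<close>; for \<open>v = 0\<close> the point mass at 0 has characteristic function
  1.\<close>

lemma centered_normal_char:
  assumes "0 \<le> v" shows "char (centered_normal v) t = complex_of_real (exp (- (t\<^sup>2 * v / 2)))"
proof (cases "v = 0")
  case True
  have "(\<lambda>x. iexp (t * x)) \<in> borel_measurable borel" by (intro borel_measurable_continuous_onI continuous_intros)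
  then show ?thesis using True unfolding char_def centered_normal_def by (simp add: integral_return)
next
  case False
  define \<sigma> where "\<sigma> = sqrt v"
  have \<sigma>: "0 < \<sigma>" "\<sigma>\<^sup>2 = v" using assms False by (auto simp: \<sigma>_def)
  interpret std: prob_space std_normal_distribution by (rule prob_space_normal_density) simp
  have "distributed std_normal_distribution lborel (\<lambda>x. x) (\<lambda>x. ennreal (std_normal_density x))"
    unfolding distributed_def by (auto intro!: measure_eqI simp: emeasure_distr)
  from std.normal_density_affine[OF this, of \<sigma> 0]
  have "distributed std_normal_distribution lborel (\<lambda>x. \<sigma> * x) (\<lambda>x. ennreal (normal_density 0 \<sigma> x))" using \<sigma> by simp
  then have eq: "centered_normal v = distr std_normal_distribution lborel (\<lambda>x. \<sigma> * x)"
    using False by (simp add: distributed_def centered_normal_def \<sigma>_def)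
  have "(\<lambda>x. iexp (t * x)) \<in> borel_measurable borel"
    by (intro borel_measurable_continuous_onI continuous_intros)
  then have m: "(\<lambda>x. iexp (t * x)) \<in> borel_measurable lborel" by simp
  have "char (centered_normal v) t = (CLINT x|std_normal_distribution. iexp (t * (\<sigma> * x)))"
    unfolding char_def eq by (subst integral_distr[OF _ m]) simp_all
  also have "\<dots> = char std_normal_distribution (t * \<sigma>)" by (simp add: char_def mult.assoc)
  also have "\<dots> = complex_of_real (exp (- (t\<^sup>2 * v / 2)))"
  proof -
    have "(t * \<sigma>)\<^sup>2 = t\<^sup>2 * v" by (simp add: power_mult_distrib \<sigma>(2))
    then show ?thesis by (simp only: char_std_normal_distribution minus_divide_left)
  qed
  finally show ?thesis .
qed

text \<open>The only possible atom is at 0 and occurs for variance 0, which is the reason for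
  excluding \<open>t = 0\<close> in that case.\<close>

lemma centered_normal_isCont_cdf:
  assumes "0 \<le> v" "t \<noteq> 0 \<or> 0 < v" shows "isCont (cdf (centered_normal v)) t"
proof -
  interpret real_distribution "centered_normal v" by (rule centered_normal_real_distribution[OF assms(1)])
  have "measure (centered_normal v) {t} = 0"
  proof (cases "v = 0")
    case True
    then show ?thesis using assms by (simp add: centered_normal_def measure_return)
  next
    case False
    have "{t} \<in> null_sets lborel" by (simp add: null_sets_def)
    then have "emeasure (centered_normal v) {t} = 0"
      using False by (simp add: centered_normal_def emeasure_density nn_integral_null_set)
    then show ?thesis by (simp add: measure_def)
  qed
  then show ?thesis by (simp add: isCont_cdf)
qed

text \<open>Lebesgue measure on \<open>\<Gamma>\<close>, normalised to a probability
  \<open>D\<close>, turns the hypothesis into convergence of characteristic functions, so Levy's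
  continuity theorem applies. A null set cannot be normalised and is treated separately.\<close>

lemma distribution_limit:
  fixes X :: "nat \<Rightarrow> 'a::euclidean_space \<Rightarrow> real"
  assumes \<Gamma> [measurable]: "\<Gamma> \<in> sets borel" and fin: "emeasure lborel \<Gamma> < \<infinity>"
    and X [measurable]: "\<And>N. X N \<in> borel_measurable borel" and v: "0 \<le> v"
    and lim: "\<And>t. (\<lambda>N. LINT x|lborel. complex_of_real (indicator \<Gamma> x) * cis (t * X N x))
       \<longlonglongrightarrow> complex_of_real (measure lborel \<Gamma> * exp (- (t\<^sup>2 * v / 2)))"
    and t: "t \<noteq> 0 \<or> 0 < v"
  shows "(\<lambda>N. measure lborel {x \<in> \<Gamma>. X N x \<le> t}) \<longlonglongrightarrow> measure lborel \<Gamma> * cdf (centered_normal v) t"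
proof (cases "measure lborel \<Gamma> = 0")
  case True
  have "measure lborel {x \<in> \<Gamma>. X N x \<le> t} = 0" for N
  proof -
    have "measure lborel {x \<in> \<Gamma>. X N x \<le> t} \<le> measure lborel \<Gamma>"
      by (rule measure_mono_fmeasurable) (use fin in \<open>auto simp: fmeasurable_def\<close>)
    then show ?thesis using True measure_nonneg[of lborel "{x \<in> \<Gamma>. X N x \<le> t}"] by linarith
  qed
  then show ?thesis using True by simp
next
  case False
  define m where "m = measure lborel \<Gamma>"
  have m: "0 < m" using False by (simp add: m_def zero_less_measure_iff)
  define D where "D = density lborel (\<lambda>x. ennreal (indicator \<Gamma> x / m))"
  have \<Gamma>_int: "integrable lborel (indicator \<Gamma> :: 'a \<Rightarrow> real)" using fin by (simp add: integrable_real_indicator)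
  have D_int: "(LINT x|D. h x) = (1 / m) *\<^sub>R (LINT x|lborel. indicator \<Gamma> x *\<^sub>R h x)"
    if [measurable]: "h \<in> borel_measurable borel" for h :: "'a \<Rightarrow> 'b::{banach,second_countable_topology}"
  proof -
    have "(LINT x|D. h x) = (LINT x|lborel. (indicator \<Gamma> x / m) *\<^sub>R h x)"
      unfolding D_def by (rule integral_density) (use m in auto)
    also have "\<dots> = (LINT x|lborel. (1 / m) *\<^sub>R (indicator \<Gamma> x *\<^sub>R h x))" by simp
    finally show ?thesis by (simp only: integral_scaleR_right)
  qed
  have "emeasure D (space D) = 1"
  proof -
    have "emeasure D (space D) = (\<integral>\<^sup>+x. ennreal (indicator \<Gamma> x / m) \<partial>lborel)"
      by (simp add: D_def emeasure_density)
    also have "\<dots> = ennreal (LINT x|lborel. indicator \<Gamma> x / m)"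
      by (rule nn_integral_eq_integral) (use \<Gamma>_int m in auto)
    also have "\<dots> = 1" using m by (simp add: m_def)
    finally show ?thesis .
  qed
  then interpret D: prob_space D by (rule prob_spaceI)
  have XD [measurable]: "X N \<in> borel_measurable D" for N by (simp add: D_def)
  have dist: "real_distribution (distr D borel (X N))" for N by (rule D.real_distribution_distr) simp
  have char: "char (distr D borel (X N)) s = (1 / complex_of_real m) * (LINT x|lborel. complex_of_real (indicator \<Gamma> x) * cis (s * X N x))" for N s
  proof -
    have mm: "(\<lambda>x. iexp (s * x)) \<in> borel_measurable borel" by (intro borel_measurable_continuous_onI continuous_intros)
    have "char (distr D borel (X N)) s = (LINT x|D. iexp (s * X N x))"
      unfolding char_def by (rule integral_distr[OF XD mm])
    also have "\<dots> = (1 / m) *\<^sub>R (LINT x|lborel. indicator \<Gamma> x *\<^sub>R iexp (s * X N x))"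
      by (rule D_int) (rule measurable_compose[OF X mm])
    finally show ?thesis by (simp add: scaleR_conv_of_real cis_conv_exp)
  qed
  have "weak_conv_m (\<lambda>N. distr D borel (X N)) (centered_normal v)"
  proof (rule levy_continuity[OF dist centered_normal_real_distribution[OF v]])
    fix s
    have "(\<lambda>N. char (distr D borel (X N)) s) \<longlonglongrightarrow> (1 / complex_of_real m) * complex_of_real (m * exp (- (s\<^sup>2 * v / 2)))"
      unfolding char m_def by (intro tendsto_mult_left lim)
    then show "(\<lambda>N. char (distr D borel (X N)) s) \<longlonglongrightarrow> char (centered_normal v) s"
      using m by (simp add: centered_normal_char[OF v])
  qed
  then have "(\<lambda>N. cdf (distr D borel (X N)) t) \<longlonglongrightarrow> cdf (centered_normal v) t"
    using centered_normal_isCont_cdf[OF v t] by (simp add: weak_conv_m_def weak_conv_def)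
  moreover have "cdf (distr D borel (X N)) t = measure lborel {x \<in> \<Gamma>. X N x \<le> t} / m" for N
  proof -
    have "cdf (distr D borel (X N)) t = measure D {x. X N x \<le> t}"
      unfolding cdf_def by (subst measure_distr) (auto simp: D_def vimage_def)
    also have "\<dots> = (LINT x|D. indicator {x. X N x \<le> t} x)" by (simp add: D_def)
    also have "\<dots> = (1 / m) * (LINT x|lborel. indicator \<Gamma> x * indicator {x. X N x \<le> t} x)"
      by (subst D_int) simp_all
    also have "(\<lambda>x. indicator \<Gamma> x * indicator {x. X N x \<le> t} x :: real) = indicator {x \<in> \<Gamma>. X N x \<le> t}"
      by (auto simp: fun_eq_iff indicator_def)
    finally show ?thesis by simp
  qed
  ultimately have "(\<lambda>N. measure lborel {x \<in> \<Gamma>. X N x \<le> t} / m) \<longlonglongrightarrow> cdf (centered_normal v) t" by simp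
  from tendsto_mult_left[OF this, of m] show ?thesis using m by (simp add: m_def[symmetric])
qed

lemma weighted_Minkowski:
  fixes u v w :: "'a \<Rightarrow> real"
  assumes meas: "u \<in> borel_measurable M" "v \<in> borel_measurable M" "w \<in> borel_measurable M"
    and w: "\<And>x. 0 \<le> w x"
    and u: "integrable M (\<lambda>x. w x * (u x)\<^sup>2)" and v: "integrable M (\<lambda>x. w x * (v x)\<^sup>2)"
  shows "sqrt (LINT x|M. w x * (u x + v x)\<^sup>2) \<le> sqrt (LINT x|M. w x * (u x)\<^sup>2) + sqrt (LINT x|M. w x * (v x)\<^sup>2)"
proof -
  define U V where "U = (LINT x|M. w x * (u x)\<^sup>2)" and "V = (LINT x|M. w x * (v x)\<^sup>2)"
  have UV: "0 \<le> U" "0 \<le> V" unfolding U_def V_def using w by (auto intro!: Bochner_Integration.integral_nonneg)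
  have uv: "integrable M (\<lambda>x. w x * (u x * v x))" by (rule weighted_product_integrable[OF meas w u v])
  have "(LINT x|M. w x * (u x + v x)\<^sup>2) = (LINT x|M. w x * (u x)\<^sup>2 + 2 * (w x * (u x * v x)) + w x * (v x)\<^sup>2)"
    by (rule Bochner_Integration.integral_cong) (auto simp: power2_eq_square algebra_simps)
  also have "\<dots> = U + 2 * (LINT x|M. w x * (u x * v x)) + V" using u v uv by (simp add: U_def V_def)
  also have "\<dots> \<le> U + 2 * (sqrt U * sqrt V) + V"
    using weighted_Cauchy_Schwarz[OF meas w u v] unfolding U_def V_def by linarith
  also have "\<dots> = (sqrt U + sqrt V)\<^sup>2" using UV by (simp add: power2_sum)
  finally show ?thesis unfolding U_def[symmetric] V_def[symmetric] using UV by (intro real_le_lsqrt) auto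
qed

locale clt_system = gap_system A q f w V b
  for A :: "real^'d^'d" and q :: real and f :: "real^'d \<Rightarrow> real" and w V :: "real^'d \<Rightarrow> real" and b :: real +
  assumes w_pos: "0 < (LINT x|lborel. w x)"
begin

definition S :: "nat \<Rightarrow> real^'d \<Rightarrow> real" where
  "S N x = (\<Sum>k<N. f (matrix_power A (Suc k) *v x))"

lemma S_borel [measurable]: "S N \<in> borel_measurable borel"
  unfolding S_def by (intro borel_measurable_sum comp_borel f_borel)

definition W :: real where "W = (LINT x|lborel. w x)"

text \<open>Outside the band the Fourier integral is 0; inside it \<open>b / norm \<eta>\<close>
  exceeds 1 and the trivial bound \<open>W\<close> is enough. A band-limited weight is therefore
  also admissible for trigonometric polynomials.\<close>

lemma w_test: "test_fun w (W * b)"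
proof -
  have "norm (fourier_int w \<eta>) \<le> W * b / norm \<eta>" if "\<eta> \<noteq> 0" for \<eta>
  proof (cases "b \<le> norm \<eta>")
    case True
    then show ?thesis using w_band w_pos b_pos by (simp add: W_def)
  next
    case False
    have "norm (fourier_int w \<eta>) \<le> W"
      using norm_fourier_int_le[OF w_integrable, of \<eta>] by (simp add: W_def w_nonneg)
    also have "\<dots> \<le> W * (b / norm \<eta>)"
      using False that w_pos by (intro mult_le_cancel_left1[THEN iffD2]) (auto simp: W_def field_simps)
    finally show ?thesis by simp
  qed
  then show ?thesis using w_integrable w_pos b_pos by (auto simp: test_fun_def W_def)
qed

text \<open>The additional \<open>A\<close> matches the start of the orbit sum at exponent
  1.\<close>

abbreviation approx :: "nat \<Rightarrow> nat \<Rightarrow> real^'d \<Rightarrow> real" where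
  "approx M N x \<equiv> (\<Sum>k<N. fsum (box M) (A *v (matrix_power A k *v x)))"

lemma box_trig_system:
  "trig_system A q fc (\<lambda>\<xi>. \<xi> v* A) (box M) (\<lambda>x. fsum (box M) (A *v x)) w (W * b)"
proof unfold_locales
  show "\<xi> v* A \<noteq> 0" if "\<xi> \<in> box M" for \<xi>
    using row_nonzero[OF freq_box_props(2)[OF that], of 1] by simp
  show "trig_poly fc (\<lambda>\<xi>. \<xi> v* A) (box M) x = complex_of_real (fsum (box M) (A *v x))" for x
    by (simp add: fsum_complex[OF symmetric_freq_box, symmetric] trig_poly_mult_vector)
qed (use freq_box_finite w_test w_nonneg w_pos in auto)

definition vbox :: "nat \<Rightarrow> real" where "vbox M = Re (trig_variance fc (\<lambda>\<xi>. \<xi> v* A) (box M) A)"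

lemma vbox_limit: "vbox \<longlonglongrightarrow> limiting_variance A f"
  unfolding vbox_def by (rule limiting_variance_box)

lemma approx_facts:
  shows vbox_nonneg: "0 \<le> vbox M"
    and approx_borel: "approx M N \<in> borel_measurable borel"
    and approx_integrable: "integrable lborel (\<lambda>x. w x * (approx M N x)\<^sup>2)"
    and approx_second_moment: "(\<lambda>N. (LINT x|lborel. w x * (approx M N x)\<^sup>2) / real N) \<longlonglongrightarrow> W * vbox M"
    and approx_clt: "integrable lborel \<psi> \<Longrightarrow> (\<And>x. \<bar>\<psi> x\<bar> \<le> w x) \<Longrightarrow>
      (\<lambda>N. LINT x|lborel. complex_of_real (\<psi> x) * cis (t / sqrt (real N) * approx M N x))
        \<longlonglongrightarrow> complex_of_real ((LINT x|lborel. \<psi> x) * exp (- (t\<^sup>2 * vbox M / 2)))"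
proof -
  interpret T: trig_system A q fc "\<lambda>\<xi>. \<xi> v* A" "box M" "\<lambda>x. fsum (box M) (A *v x)" w "W * b"
    by (rule box_trig_system)
  have v: "T.variance = vbox M" by (simp add: T.variance_def vbox_def)
  have p: "T.part_sum N = approx M N" for N by (simp add: fun_eq_iff T.part_sum_def)
  show "0 \<le> vbox M" using T.variance_nonneg v by simp
  show "approx M N \<in> borel_measurable borel" using T.part_sum_measurable[of N] unfolding p .
  show "integrable lborel (\<lambda>x. w x * (approx M N x)\<^sup>2)" using T.part_sum_square_integrable[of N] unfolding p .
  show "(\<lambda>N. (LINT x|lborel. w x * (approx M N x)\<^sup>2) / real N) \<longlonglongrightarrow> W * vbox M"
    using T.second_moment unfolding p v W_def .
  show "(\<lambda>N. LINT x|lborel. complex_of_real (\<psi> x) * cis (t / sqrt (real N) * approx M N x))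
        \<longlonglongrightarrow> complex_of_real ((LINT x|lborel. \<psi> x) * exp (- (t\<^sup>2 * vbox M / 2)))"
    if "integrable lborel \<psi>" "\<And>x. \<bar>\<psi> x\<bar> \<le> w x"
    using T.trig_clt[OF that, of t] unfolding p v .
qed

lemma S_minus_approx: "S N x - approx M N x = (\<Sum>k<N. resid (box M) (matrix_power A (Suc k) *v x))"
  by (simp add: S_def resid_def sum_subtractf matrix_vector_mul_assoc)

lemma resid_sum_integrable:
  "integrable lborel (\<lambda>x. w x * (\<Sum>k<N. resid (box M) (matrix_power A (Suc k) *v x))\<^sup>2)"
  unfolding power2_eq_square sum_product
  unfolding sum_distrib_left
  by (intro Bochner_Integration.integrable_sum corr_integrable admissible_resid symmetric_freq_box)

lemma S_square_integrable: "integrable lborel (\<lambda>x. w x * (S N x)\<^sup>2)"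
proof -
  have adm: "admissible f"
    unfolding admissible_def periodic_def using f_borel f_periodic f_square_integrable by blast
  show ?thesis
    unfolding S_def power2_eq_square sum_product
    unfolding sum_distrib_left
    by (intro Bochner_Integration.integrable_sum corr_integrable adm)
qed

definition \<sigma>2 :: real where "\<sigma>2 = limiting_variance A f"

lemma \<sigma>2_nonneg: "0 \<le> \<sigma>2"
  unfolding \<sigma>2_def by (rule LIMSEQ_le_const[OF vbox_limit]) (auto intro: vbox_nonneg)

text \<open>First \<open>N\<close>, then the cutoff \<open>M\<close> tends to infinity; the bound
  for the residual sums, divided by \<open>N\<close>, is uniform in \<open>N\<close> and vanishes
  with \<open>eps M\<close>.\<close>

lemma char_limit:
  assumes \<psi>: "integrable lborel \<psi>" and \<psi>w: "\<And>x. \<bar>\<psi> x\<bar> \<le> w x"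
  shows "(\<lambda>N. LINT x|lborel. complex_of_real (\<psi> x) * cis (t * (S N x / sqrt (real N))))
      \<longlonglongrightarrow> complex_of_real ((LINT x|lborel. \<psi> x) * exp (- (t\<^sup>2 * \<sigma>2 / 2)))"
proof -
  obtain K where K: "0 \<le> K" "\<And>M N. (LINT x|lborel. w x * (\<Sum>k<N. resid (box M) (matrix_power A (Suc k) *v x))\<^sup>2) \<le> real N * (K * eps M)"
    using resid_second_moment by blast
  show ?thesis
  proof (rule double_limit[where r = 0 and
        y = "\<lambda>M N. LINT x|lborel. complex_of_real (\<psi> x) * cis (t / sqrt (real N) * approx M N x)" and
        L = "\<lambda>M. complex_of_real ((LINT x|lborel. \<psi> x) * exp (- (t\<^sup>2 * vbox M / 2)))" and
        \<delta> = "\<lambda>M. sqrt W * sqrt (t\<^sup>2 * (K * eps M))"])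
    fix M
    show "(\<lambda>N. LINT x|lborel. complex_of_real (\<psi> x) * cis (t / sqrt (real N) * approx M N x))
        \<longlonglongrightarrow> complex_of_real ((LINT x|lborel. \<psi> x) * exp (- (t\<^sup>2 * vbox M / 2)))"
      by (rule approx_clt[OF \<psi> \<psi>w])
    show "eventually (\<lambda>N. norm ((LINT x|lborel. complex_of_real (\<psi> x) * cis (t * (S N x / sqrt (real N))))
       - (LINT x|lborel. complex_of_real (\<psi> x) * cis (t / sqrt (real N) * approx M N x))) \<le> sqrt W * sqrt (t\<^sup>2 * (K * eps M))) sequentially"
      using eventually_gt_at_top[of 0]
    proof eventually_elim
      case (elim N)
      have eq: "w x * (t * (S N x / sqrt (real N)) - t / sqrt (real N) * approx M N x)\<^sup>2
        = t\<^sup>2 / real N * (w x * (\<Sum>k<N. resid (box M) (matrix_power A (Suc k) *v x))\<^sup>2)" for x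
      proof -
        have "t * (S N x / sqrt (real N)) - t / sqrt (real N) * approx M N x = t / sqrt (real N) * (S N x - approx M N x)"
          by (simp add: right_diff_distrib)
        then show ?thesis unfolding S_minus_approx by (simp add: power_mult_distrib power_divide)
      qed
      have int: "integrable lborel (\<lambda>x. w x * (t * (S N x / sqrt (real N)) - t / sqrt (real N) * approx M N x)\<^sup>2)"
        unfolding eq by (intro integrable_mult_right resid_sum_integrable)
      have "norm ((LINT x|lborel. complex_of_real (\<psi> x) * cis (t * (S N x / sqrt (real N))))
         - (LINT x|lborel. complex_of_real (\<psi> x) * cis (t / sqrt (real N) * approx M N x)))
         \<le> sqrt (LINT x|lborel. w x) * sqrt (LINT x|lborel. w x * (t * (S N x / sqrt (real N)) - t / sqrt (real N) * approx M N x)\<^sup>2)"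
        by (rule norm_char_diff_le[OF \<psi> \<psi>w w_integrable _ _ int]) (use approx_borel[of M N] in simp_all)
      also have "\<dots> \<le> sqrt W * sqrt (t\<^sup>2 * (K * eps M))"
        unfolding W_def
      proof (intro mult_left_mono real_sqrt_le_mono)
        have "(LINT x|lborel. w x * (t * (S N x / sqrt (real N)) - t / sqrt (real N) * approx M N x)\<^sup>2)
           = t\<^sup>2 / real N * (LINT x|lborel. w x * (\<Sum>k<N. resid (box M) (matrix_power A (Suc k) *v x))\<^sup>2)"
          unfolding eq by simp
        also have "\<dots> \<le> t\<^sup>2 / real N * (real N * (K * eps M))" by (intro mult_left_mono K) simp
        also have "\<dots> = t\<^sup>2 * (K * eps M)" using elim by simp
        finally show "(LINT x|lborel. w x * (t * (S N x / sqrt (real N)) - t / sqrt (real N) * approx M N x)\<^sup>2) \<le> t\<^sup>2 * (K * eps M)" .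
      qed (use w_pos in simp)
      finally show ?case .
    qed
  next
    have "(\<lambda>M. sqrt W * sqrt (t\<^sup>2 * (K * eps M))) \<longlonglongrightarrow> sqrt W * sqrt (t\<^sup>2 * (K * 0))"
      by (intro tendsto_intros eps_tendsto_0)
    then show "(\<lambda>M. sqrt W * sqrt (t\<^sup>2 * (K * eps M))) \<longlonglongrightarrow> 0" by simp
    show "(\<lambda>M. complex_of_real ((LINT x|lborel. \<psi> x) * exp (- (t\<^sup>2 * vbox M / 2))))
       \<longlonglongrightarrow> complex_of_real ((LINT x|lborel. \<psi> x) * exp (- (t\<^sup>2 * \<sigma>2 / 2)))"
      unfolding \<sigma>2_def by (intro tendsto_intros vbox_limit) simp
  qed
qed

text \<open>The limit is taken for norms rather than their squares: by Minkowski the residual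
  changes the norm by at most its own, and squaring afterwards is continuous.\<close>

lemma total_second_moment: "(\<lambda>N. (LINT x|lborel. w x * (S N x)\<^sup>2) / real N) \<longlonglongrightarrow> W * \<sigma>2"
proof -
  obtain K where K: "0 \<le> K" "\<And>M N. (LINT x|lborel. w x * (\<Sum>k<N. resid (box M) (matrix_power A (Suc k) *v x))\<^sup>2) \<le> real N * (K * eps M)"
    using resid_second_moment by blast
  define n2 where "n2 u = sqrt (LINT x|lborel. w x * (u x)\<^sup>2)" for u :: "real^'d \<Rightarrow> real"
  have "(\<lambda>N. n2 (S N) / sqrt (real N)) \<longlonglongrightarrow> sqrt (W * \<sigma>2)"
  proof (rule double_limit[where r = 0 and y = "\<lambda>M N. n2 (approx M N) / sqrt (real N)" and
        L = "\<lambda>M. sqrt (W * vbox M)" and \<delta> = "\<lambda>M. sqrt (K * eps M)"])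
    fix M
    show "(\<lambda>N. n2 (approx M N) / sqrt (real N)) \<longlonglongrightarrow> sqrt (W * vbox M)"
      using tendsto_real_sqrt[OF approx_second_moment[of M]] by (simp add: n2_def real_sqrt_divide)
    show "eventually (\<lambda>N. norm (n2 (S N) / sqrt (real N) - n2 (approx M N) / sqrt (real N)) \<le> sqrt (K * eps M)) sequentially"
      using eventually_gt_at_top[of 0]
    proof eventually_elim
      case (elim N)
      define d where "d x = (\<Sum>k<N. resid (box M) (matrix_power A (Suc k) *v x))" for x
      have dx: "d x = S N x - approx M N x" for x by (simp only: d_def S_minus_approx)
      have d: "S N = (\<lambda>x. approx M N x + d x)" and ax: "approx M N x = S N x - d x" for x
        by (simp_all add: fun_eq_iff dx)
      have dm [measurable]: "d \<in> borel_measurable borel"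
        unfolding d_def by (intro borel_measurable_sum comp_borel resid_measurable)
      have di: "integrable lborel (\<lambda>x. w x * (d x)\<^sup>2)" unfolding d_def by (rule resid_sum_integrable)
      have am: "approx M N \<in> borel_measurable lborel" using approx_borel[of M N] by simp
      have 1: "n2 (S N) \<le> n2 (approx M N) + n2 d"
        unfolding n2_def by (subst d, rule weighted_Minkowski[OF am _ _ w_nonneg approx_integrable di]) simp_all
      have 2: "n2 (approx M N) \<le> n2 (S N) + n2 d"
        using weighted_Minkowski[of "S N" lborel "\<lambda>x. - d x" w] w_nonneg S_square_integrable[of N] di
        unfolding n2_def ax by simp
      have "n2 d \<le> sqrt (real N * (K * eps M))" unfolding n2_def d_def by (intro real_sqrt_le_mono K)
      then have "n2 d / sqrt (real N) \<le> sqrt (K * eps M)"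
        using elim by (simp add: real_sqrt_mult field_simps)
      moreover have "\<bar>n2 (S N) - n2 (approx M N)\<bar> \<le> n2 d" using 1 2 by linarith
      then have "\<bar>n2 (S N) - n2 (approx M N)\<bar> / sqrt (real N) \<le> n2 d / sqrt (real N)"
        by (rule divide_right_mono) simp
      ultimately show ?case by (simp add: diff_divide_distrib[symmetric])
    qed
  next
    have "(\<lambda>M. sqrt (K * eps M)) \<longlonglongrightarrow> sqrt (K * 0)" by (intro tendsto_intros eps_tendsto_0)
    then show "(\<lambda>M. sqrt (K * eps M)) \<longlonglongrightarrow> 0" by simp
    show "(\<lambda>M. sqrt (W * vbox M)) \<longlonglongrightarrow> sqrt (W * \<sigma>2)"
      unfolding \<sigma>2_def by (intro tendsto_intros vbox_limit)
  qed
  from tendsto_power[OF this, of 2]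
  have "(\<lambda>N. (n2 (S N) / sqrt (real N))\<^sup>2) \<longlonglongrightarrow> W * \<sigma>2"
    using w_pos \<sigma>2_nonneg by (simp add: W_def)
  moreover have "(n2 (S N) / sqrt (real N))\<^sup>2 = (LINT x|lborel. w x * (S N x)\<^sup>2) / real N" for N
  proof -
    have "0 \<le> (LINT x|lborel. w x * (S N x)\<^sup>2)" using w_nonneg by (intro Bochner_Integration.integral_nonneg) auto
    then show ?thesis by (simp add: n2_def power_divide)
  qed
  ultimately show ?thesis by simp
qed

lemma \<psi>_S_integrable:
  assumes \<psi>: "integrable lborel \<psi>" and \<psi>w: "\<And>x. 0 \<le> \<psi> x \<and> \<psi> x \<le> w x"
  shows "integrable lborel (\<lambda>x. \<psi> x * (S N x)\<^sup>2)"
proof (rule Bochner_Integration.integrable_bound[OF S_square_integrable[of N]])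
  have [measurable]: "\<psi> \<in> borel_measurable borel" using \<psi> by auto
  show "(\<lambda>x. \<psi> x * (S N x)\<^sup>2) \<in> borel_measurable lborel" by simp
  show "AE x in lborel. norm (\<psi> x * (S N x)\<^sup>2) \<le> norm (w x * (S N x)\<^sup>2)"
    using \<psi>w w_nonneg by (intro AE_I2) (simp add: abs_mult mult_right_mono)
qed

text \<open>Since \<open>1 - cos y \<le> y\<^sup>2 / 2\<close>, the second moment is bounded below by the characteristic function near 0.\<close>

lemma second_moment_lower:
  assumes \<psi>: "integrable lborel \<psi>" and \<psi>w: "\<And>x. 0 \<le> \<psi> x \<and> \<psi> x \<le> w x" and e: "0 < e"
  shows "eventually (\<lambda>N. (LINT x|lborel. \<psi> x) * \<sigma>2 - e \<le> (LINT x|lborel. \<psi> x * (S N x)\<^sup>2) / real N) sequentially"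
proof -
  define m where "m = (LINT x|lborel. \<psi> x)"
  have m: "0 \<le> m" unfolding m_def using \<psi>w by (intro Bochner_Integration.integral_nonneg) auto
  \<comment> \<open>\<open>s\<close> is the square of the frequency \<open>t\<close>. It is chosen
    so small that the quadratic term in the expansion of the Gaussian exponential costs at most
    \<open>e / 2\<close>; the summand 1 keeps the denominator positive.\<close>
  define s where "s = 2 * e / (\<sigma>2\<^sup>2 * m + 1)"
  have s: "0 < s" using e m by (auto simp: s_def intro!: divide_pos_pos add_nonneg_pos)
  have "s * (\<sigma>2\<^sup>2 * m) \<le> s * (\<sigma>2\<^sup>2 * m + 1)" using s by (intro mult_left_mono) auto
  also have "\<dots> = 2 * e"
  proof -
    have "0 < \<sigma>2\<^sup>2 * m + 1" using m by (intro add_nonneg_pos) auto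
    then show ?thesis by (simp add: s_def)
  qed
  finally have "s * (\<sigma>2\<^sup>2 * m) \<le> 2 * e" .
  then have se: "s * \<sigma>2\<^sup>2 * m / 4 \<le> e / 2" using mult.assoc[of s "\<sigma>2\<^sup>2" m] by linarith
  define t where "t = sqrt s"
  have t2: "t\<^sup>2 = s" using s by (simp add: t_def)
  have \<psi>b: "\<bar>\<psi> x\<bar> \<le> w x" for x using \<psi>w[of x] by simp
  have "(\<lambda>N. Re (LINT x|lborel. complex_of_real (\<psi> x) * cis (t * (S N x / sqrt (real N))))) \<longlonglongrightarrow> m * exp (- (s * \<sigma>2 / 2))"
    using tendsto_Re[OF char_limit[OF \<psi> \<psi>b, of t]] by (simp add: m_def t2)
  \<comment> \<open>The slack \<open>s * e / 4\<close> becomes the other \<open>e / 2\<close> once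
    the inequality is divided by \<open>s / 2\<close>.\<close>
  then have "eventually (\<lambda>N. Re (LINT x|lborel. complex_of_real (\<psi> x) * cis (t * (S N x / sqrt (real N))))
      < m * exp (- (s * \<sigma>2 / 2)) + s * e / 4) sequentially"
    by (rule order_tendstoD(2)) (use s e in auto)
  then show ?thesis using eventually_gt_at_top[of 0]
  proof eventually_elim
    case (elim N)
    define R where "R = Re (LINT x|lborel. complex_of_real (\<psi> x) * cis (t * (S N x / sqrt (real N))))"
    define Q where "Q = (LINT x|lborel. \<psi> x * (S N x)\<^sup>2) / real N"
    have ci: "integrable lborel (\<lambda>x. complex_of_real (\<psi> x) * cis (t * (S N x / sqrt (real N))))"
    proof (rule integrable_mult_bounded[OF \<psi>, of _ 1])
      show "(\<lambda>x. cis (t * (S N x / sqrt (real N)))) \<in> borel_measurable lborel"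
        by (rule measurable_compose[OF _ borel_measurable_cis]) simp
    qed simp
    have "R = (LINT x|lborel. \<psi> x * cos (t * (S N x / sqrt (real N))))"
      unfolding R_def using integral_Re[OF ci] by simp
    moreover have "integrable lborel (\<lambda>x. \<psi> x * cos (t * (S N x / sqrt (real N))))"
      using integrable_Re[OF ci] by simp
    ultimately have "m - R = (LINT x|lborel. \<psi> x - \<psi> x * cos (t * (S N x / sqrt (real N))))"
      using \<psi> by (simp add: m_def)
    also have "\<dots> \<le> (LINT x|lborel. s / 2 / real N * (\<psi> x * (S N x)\<^sup>2))"
    proof (rule integral_mono)
      show "integrable lborel (\<lambda>x. \<psi> x - \<psi> x * cos (t * (S N x / sqrt (real N))))"
        using \<psi> integrable_Re[OF ci] by simp
      show "integrable lborel (\<lambda>x. s / 2 / real N * (\<psi> x * (S N x)\<^sup>2))"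
        by (intro integrable_mult_right \<psi>_S_integrable[OF \<psi> \<psi>w])
      show "\<psi> x - \<psi> x * cos (t * (S N x / sqrt (real N))) \<le> s / 2 / real N * (\<psi> x * (S N x)\<^sup>2)" for x
      proof -
        have "1 - cos (t * (S N x / sqrt (real N))) \<le> (t * (S N x / sqrt (real N)))\<^sup>2 / 2"
          using cos_lower[of "t * (S N x / sqrt (real N))"] by simp
        also have "\<dots> = s / 2 / real N * (S N x)\<^sup>2"
          by (simp add: power_mult_distrib power_divide t2)
        finally have "\<psi> x * (1 - cos (t * (S N x / sqrt (real N)))) \<le> \<psi> x * (s / 2 / real N * (S N x)\<^sup>2)"
          using \<psi>w[of x] by (intro mult_left_mono) auto
        then show ?thesis by (simp add: right_diff_distrib mult_ac)
      qed
    qed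
    also have "\<dots> = s / 2 * Q" by (simp add: Q_def)
    finally have 1: "m - R \<le> s / 2 * Q" .
    have "m * exp (- (s * \<sigma>2 / 2)) \<le> m * (1 - s * \<sigma>2 / 2 + (s * \<sigma>2 / 2)\<^sup>2 / 2)"
      using exp_minus_le_quadratic[of "s * \<sigma>2 / 2"] s \<sigma>2_nonneg m by (intro mult_left_mono) auto
    also have "\<dots> = m - s / 2 * (m * \<sigma>2 - s * \<sigma>2\<^sup>2 * m / 4)"
      by (simp add: field_simps power2_eq_square)
    finally have "R < m - s / 2 * (m * \<sigma>2 - s * \<sigma>2\<^sup>2 * m / 4) + s * e / 4" using elim(1) by (simp add: R_def)
    moreover have "s / 2 * (y - e / 2) = s / 2 * y - s * e / 4" for y by (simp add: right_diff_distrib)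
    ultimately have "s / 2 * (m * \<sigma>2 - s * \<sigma>2\<^sup>2 * m / 4 - e / 2) \<le> s / 2 * Q"
      using 1 by (smt (verit))
    then have "m * \<sigma>2 - s * \<sigma>2\<^sup>2 * m / 4 - e / 2 \<le> Q" using s by simp
    then show "(LINT x|lborel. \<psi> x) * \<sigma>2 - e \<le> (LINT x|lborel. \<psi> x * (S N x)\<^sup>2) / real N"
      unfolding m_def[symmetric] Q_def[symmetric] using se by linarith
  qed
qed

proposition second_moment_limit:
  assumes \<psi>: "integrable lborel \<psi>" and \<psi>w: "\<And>x. 0 \<le> \<psi> x \<and> \<psi> x \<le> w x"
  shows "(\<lambda>N. (LINT x|lborel. \<psi> x * (S N x)\<^sup>2) / real N) \<longlonglongrightarrow> (LINT x|lborel. \<psi> x) * \<sigma>2"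
proof (rule tendstoI)
  fix e :: real assume e: "0 < e"
  define \<phi> where "\<phi> x = w x - \<psi> x" for x
  have \<phi>: "integrable lborel \<phi>" "\<And>x. 0 \<le> \<phi> x \<and> \<phi> x \<le> w x"
    using \<psi> \<psi>w w_integrable by (auto simp: \<phi>_def[abs_def])
  have int: "(LINT x|lborel. \<phi> x) = W - (LINT x|lborel. \<psi> x)"
    using \<psi> w_integrable by (simp add: \<phi>_def W_def)
  have split: "(LINT x|lborel. w x * (S N x)\<^sup>2) / real N
     = (LINT x|lborel. \<psi> x * (S N x)\<^sup>2) / real N + (LINT x|lborel. \<phi> x * (S N x)\<^sup>2) / real N" for N
  proof -
    have "(LINT x|lborel. w x * (S N x)\<^sup>2) = (LINT x|lborel. \<psi> x * (S N x)\<^sup>2 + \<phi> x * (S N x)\<^sup>2)"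
      by (simp add: \<phi>_def left_diff_distrib)
    also have "\<dots> = (LINT x|lborel. \<psi> x * (S N x)\<^sup>2) + (LINT x|lborel. \<phi> x * (S N x)\<^sup>2)"
      by (rule Bochner_Integration.integral_add[OF \<psi>_S_integrable[OF \<psi> \<psi>w] \<psi>_S_integrable[OF \<phi>]])
    finally show ?thesis by (simp add: add_divide_distrib)
  qed
  \<comment> \<open>The upper estimate is the total moment minus the lower estimate for
    \<open>\<phi>\<close>, so two errors \<open>e / 4\<close> add up there.\<close>
  have e4: "0 < e / 4" using e by simp
  show "eventually (\<lambda>N. dist ((LINT x|lborel. \<psi> x * (S N x)\<^sup>2) / real N) ((LINT x|lborel. \<psi> x) * \<sigma>2) < e) sequentially"
    using tendstoD[OF total_second_moment e4] second_moment_lower[OF \<psi> \<psi>w e4] second_moment_lower[OF \<phi> e4]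
  proof eventually_elim
    case (elim N)
    then show ?case using e unfolding split int left_diff_distrib dist_real_def by linarith
  qed
qed

theorem clt_borel:
  assumes \<Gamma> [measurable]: "\<Gamma> \<in> sets borel" and fin: "emeasure lborel \<Gamma> < \<infinity>" and \<Gamma>w: "\<And>x. indicator \<Gamma> x \<le> w x"
  shows "(\<lambda>N. LINT x|lborel. indicator \<Gamma> x * (S N x / sqrt (real N))\<^sup>2) \<longlonglongrightarrow> measure lborel \<Gamma> * limiting_variance A f"
    and "t \<noteq> 0 \<or> 0 < limiting_variance A f \<Longrightarrow>
      (\<lambda>N. measure lborel {x \<in> \<Gamma>. S N x / sqrt (real N) \<le> t})
        \<longlonglongrightarrow> measure lborel \<Gamma> * cdf (centered_normal (limiting_variance A f)) t"
proof -
  have int: "integrable lborel (indicator \<Gamma> :: _ \<Rightarrow> real)" using fin by (simp add: integrable_real_indicator)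
  have i: "(LINT x|lborel. indicator \<Gamma> x) = measure lborel \<Gamma>" by simp
  have "(LINT x|lborel. indicator \<Gamma> x * (S N x / sqrt (real N))\<^sup>2) = (LINT x|lborel. indicator \<Gamma> x * (S N x)\<^sup>2) / real N" for N
    by (simp add: power_divide)
  then show "(\<lambda>N. LINT x|lborel. indicator \<Gamma> x * (S N x / sqrt (real N))\<^sup>2) \<longlonglongrightarrow> measure lborel \<Gamma> * limiting_variance A f"
    using second_moment_limit[OF int] \<Gamma>w unfolding i \<sigma>2_def by simp
  have lim: "(\<lambda>N. LINT x|lborel. complex_of_real (indicator \<Gamma> x) * cis (s * (S N x / sqrt (real N))))
      \<longlonglongrightarrow> complex_of_real (measure lborel \<Gamma> * exp (- (s\<^sup>2 * limiting_variance A f / 2)))" for s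
    using char_limit[OF int, of s] \<Gamma>w unfolding i \<sigma>2_def by simp
  show "(\<lambda>N. measure lborel {x \<in> \<Gamma>. S N x / sqrt (real N) \<le> t})
        \<longlonglongrightarrow> measure lborel \<Gamma> * cdf (centered_normal (limiting_variance A f)) t"
    if "t \<noteq> 0 \<or> 0 < limiting_variance A f"
    by (rule distribution_limit[OF \<Gamma> fin _ \<sigma>2_nonneg[unfolded \<sigma>2_def] lim that]) simp
qed

end

section \<open>Passage to Borel functions\<close>

text \<open>By completeness of Lebesgue measure, a function agreeing almost everywhere with a Borel
  function is itself measurable; no separate argument is then required for the orbit sums of
  \<open>f\<close>.\<close>

lemma lebesgue_AE_eq_borel:
  fixes g h :: "'a::euclidean_space \<Rightarrow> 'b::{banach, second_countable_topology}"
  assumes g: "g \<in> borel_measurable borel" and ae: "AE x in lebesgue. h x = g x"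
  shows "h \<in> borel_measurable lebesgue" "integral\<^sup>L lebesgue h = integral\<^sup>L lborel g"
    "integrable lebesgue h \<longleftrightarrow> integrable lborel g"
proof -
  have gl: "g \<in> borel_measurable lebesgue" using g by (intro measurable_completion) simp
  show h: "h \<in> borel_measurable lebesgue"
  proof (rule measurableI)
    fix B :: "'b set" assume B: "B \<in> sets borel"
    show "h -` B \<inter> space lebesgue \<in> sets lebesgue"
    proof (rule completion.in_sets_AE)
      show "AE x in lebesgue. x \<in> g -` B \<inter> space lebesgue \<longleftrightarrow> x \<in> h -` B \<inter> space lebesgue"
        using ae by eventually_elim simp
      show "g -` B \<inter> space lebesgue \<in> sets lebesgue" by (rule measurable_sets[OF gl B])
    qed simp
  qed simp
  show "integral\<^sup>L lebesgue h = integral\<^sup>L lborel g"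
    using integral_cong_AE[OF h gl ae] integral_completion[of g lborel] g by simp
  show "integrable lebesgue h \<longleftrightarrow> integrable lborel g"
    using integrable_cong_AE[OF h gl ae] integrable_completion[of g lborel] g by simp
qed

lemma floor_vec_add: "m \<in> int_vectors \<Longrightarrow> floor_vec (x + m) = floor_vec x + m"
proof -
  assume m: "m \<in> int_vectors"
  have "\<lfloor>(x + m) $ i\<rfloor> = \<lfloor>x $ i\<rfloor> + \<lfloor>m $ i\<rfloor> \<and> of_int \<lfloor>m $ i\<rfloor> = m $ i" for i
  proof -
    obtain k where "m $ i = of_int k" using m by (auto simp: int_vectors_def Ints_def)
    then show ?thesis by simp
  qed
  then show ?thesis by (simp add: vec_eq_iff floor_vec_def)
qed

lemma axis_int_vector: "axis i 1 \<in> int_vectors"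
  by (auto simp: int_vectors_def axis_def)

text \<open>A Borel version of \<open>f\<close> may fail to be periodic on a null set. Evaluating it
  at the fractional part of \<open>x\<close> restores periodicity, and the new exceptional set is
  covered by countably many integral translates of the old one.\<close>

lemma periodic_borel_version:
  fixes f :: "real^'d \<Rightarrow> real"
  assumes f: "f \<in> borel_measurable lebesgue" and per: "\<And>x i. f (x + axis i 1) = f x"
  obtains g where "g \<in> borel_measurable borel" "\<And>x i. g (x + axis i 1) = g x" "negligible {x. f x \<noteq> g x}"
proof -
  obtain h where h: "h \<in> borel_measurable lborel" "AE x in lborel. f x = h x"
    using completion_ex_borel_measurable_real[OF f] by blast
  have "{x. f x \<noteq> h x} \<in> null_sets lebesgue"
    using AE_completion[OF h(2)] by (simp add: completion.AE_iff_null_sets)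
  then have neg: "negligible {x. f x \<noteq> h x}" by (simp add: negligible_iff_null_sets)
  define g where "g x = h (x - floor_vec x)" for x
  have fv: "(\<lambda>x. x - floor_vec x) \<in> borel_measurable borel" by simp
  have "g \<in> borel_measurable borel"
    unfolding g_def[abs_def] using measurable_compose[OF fv, of h borel] h(1) by simp
  moreover have "g (x + axis i 1) = g x" for x i
    unfolding g_def floor_vec_add[OF axis_int_vector] by (simp add: algebra_simps)
  moreover have "negligible {x. f x \<noteq> g x}"
  proof -
    have sub: "{x. f x \<noteq> g x} \<subseteq> (\<Union>m\<in>int_vectors. (+) m ` {x. f x \<noteq> h x})"
    proof
      fix x assume "x \<in> {x. f x \<noteq> g x}"
      moreover have "f (x - floor_vec x) = f x"
        using periodic_int_vectors[of f, OF per floor_vec_int, of "x - floor_vec x" x] by simp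
      ultimately have "x - floor_vec x \<in> {x. f x \<noteq> h x}" by (simp add: g_def)
      then show "x \<in> (\<Union>m\<in>int_vectors. (+) m ` {x. f x \<noteq> h x})"
        using floor_vec_int[of x] by (intro UN_I[of "floor_vec x"] image_eqI[of _ _ "x - floor_vec x"]) auto
    qed
    have "(\<Union>m\<in>int_vectors. (+) m ` {x. f x \<noteq> h x}) \<in> null_sets lebesgue"
      by (rule null_sets_UN'[OF int_vectors_countable])
         (simp add: negligible_iff_null_sets[symmetric] negligible_translation[OF neg])
    then show ?thesis using negligible_subset[OF _ sub] by (simp add: negligible_iff_null_sets)
  qed
  ultimately show thesis by (rule that)
qed

text \<open>Ensures that changing \<open>f\<close> on a null set changes each
  \<open>f(A^k x)\<close> only on a null set: the preimage is contained in a linear image under the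
  inverse matrix.\<close>

lemma (in expanding_matrix) negligible_preimage:
  assumes "negligible Z" "0 < k" shows "negligible {x. matrix_power A k *v x \<in> Z}"
proof -
  interpret k: expanding_matrix "matrix_power A k" "q ^ k" by (rule power_expanding[OF assms(2)])
  have "{x. matrix_power A k *v x \<in> Z} \<subseteq> (\<lambda>y. k.inv_matrix *v y) ` Z"
  proof
    fix x assume "x \<in> {x. matrix_power A k *v x \<in> Z}"
    moreover have "x = k.inv_matrix *v (matrix_power A k *v x)" by (simp add: matrix_vector_mul_assoc k.inv_matrix)
    ultimately show "x \<in> (\<lambda>y. k.inv_matrix *v y) ` Z" by blast
  qed
  moreover have "negligible ((\<lambda>y. k.inv_matrix *v y) ` Z)"
    by (rule negligible_differentiable_image_negligible[OF order_refl assms(1)])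
       (rule linear_imp_differentiable_on[OF matrix_vector_mul_linear])
  ultimately show ?thesis by (rule negligible_subset[rotated])
qed

lemma negligible_AE: "negligible {x. \<not> P x} \<Longrightarrow> AE x in lebesgue. P x"
  by (simp add: completion.AE_iff_null_sets negligible_iff_null_sets)

theorem theorem1p1:
  fixes A :: "real^'d^'d" and f :: "real^'d \<Rightarrow> real" and \<Gamma> :: "(real^'d) set"
  assumes "expanding A"
    and "f \<in> borel_measurable lebesgue"
    and "set_integrable lebesgue unit_cube (\<lambda>x. (f x)\<^sup>2)"
    and "\<And>x i. f (x + axis i 1) = f x"
    and "(LINT x:unit_cube|lebesgue. f x) = 0"
    and "summable (\<lambda>m::nat. L2_norm_cube
           (\<lambda>x. complex_of_real (f x) - fourier_partial_sum f (2 ^ Suc m) x))"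
    and "\<Gamma> \<in> sets lebesgue" and "bounded \<Gamma>"
  shows "((\<lambda>N::nat. LINT x:\<Gamma>|lebesgue.
             (1 / sqrt (real N) * (\<Sum>k=1..N. f (matrix_power A k *v x)))\<^sup>2)
           \<longlonglongrightarrow> measure lebesgue \<Gamma> * limiting_variance A f) \<and>
         (\<forall>t::real. t \<noteq> 0 \<longrightarrow>
           (\<lambda>N::nat. measure lebesgue
              {x \<in> \<Gamma>. 1 / sqrt (real N) * (\<Sum>k=1..N. f (matrix_power A k *v x)) \<le> t})
           \<longlonglongrightarrow> measure lebesgue \<Gamma> * cdf (centered_normal (limiting_variance A f)) t) \<and>
         (limiting_variance A f > 0 \<longrightarrow>
           (\<lambda>N::nat. measure lebesgue
              {x \<in> \<Gamma>. 1 / sqrt (real N) * (\<Sum>k=1..N. f (matrix_power A k *v x)) \<le> 0})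
           \<longlonglongrightarrow> measure lebesgue \<Gamma> * cdf (centered_normal (limiting_variance A f)) 0)"
proof -
  obtain q where "1 < q" "\<And>x. q * norm x \<le> norm (A *v x)"
    using assms(1) unfolding expanding_def by blast
  then interpret expanding_matrix A q by unfold_locales
  obtain g where g [measurable]: "g \<in> borel_measurable borel" and g_per: "\<And>x i. g (x + axis i 1) = g x"
    and neg: "negligible {x. f x \<noteq> g x}"
    using periodic_borel_version[OF assms(2,4)] by blast
  have fg: "AE x in lebesgue. f x = g x" using neg by (intro negligible_AE) simp
  have cube_borel: "(\<lambda>x. cube x * (g x)\<^sup>2) \<in> borel_measurable borel" "(\<lambda>x. cube x * g x) \<in> borel_measurable borel"
    by measurable
  interpret g: periodic_L2 g
  proof
    have "AE x in lebesgue. indicator unit_cube x *\<^sub>R (f x)\<^sup>2 = cube x * (g x)\<^sup>2" using fg by eventually_elim simp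
    from lebesgue_AE_eq_borel(3)[OF cube_borel(1) this]
    show "integrable lborel (\<lambda>x. cube x * (g x)\<^sup>2)" using assms(3) by (simp add: set_integrable_def)
    have "AE x in lebesgue. indicator unit_cube x *\<^sub>R f x = cube x * g x" using fg by eventually_elim simp
    from lebesgue_AE_eq_borel(2)[OF cube_borel(2) this]
    show "(LINT x|lborel. cube x * g x) = 0" using assms(5) by (simp add: set_lebesgue_integral_def)
  qed (fact g g_per)+
  have coeff: "fourier_coeff f = fourier_coeff g"
  proof
    fix \<xi> :: "real^'d"
    define e where "e x = exp (- 2 * complex_of_real pi * \<i> * complex_of_real (\<xi> \<bullet> x))" for x :: "real^'d"
    have [measurable]: "e \<in> borel_measurable borel"
      unfolding e_def by (intro borel_measurable_continuous_onI continuous_intros)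
    have b: "(\<lambda>x. indicator unit_cube x *\<^sub>R (complex_of_real (g x) * e x)) \<in> borel_measurable borel" by measurable
    have 1: "AE x in lebesgue. indicator unit_cube x *\<^sub>R (complex_of_real (f x) * e x) = indicator unit_cube x *\<^sub>R (complex_of_real (g x) * e x)"
      using fg by eventually_elim simp
    have 2: "AE x in lebesgue. indicator unit_cube x *\<^sub>R (complex_of_real (g x) * e x) = indicator unit_cube x *\<^sub>R (complex_of_real (g x) * e x)"
      by simp
    show "fourier_coeff f \<xi> = fourier_coeff g \<xi>"
      unfolding fourier_coeff_def set_lebesgue_integral_def e_def[symmetric]
      using lebesgue_AE_eq_borel(2)[OF b 1] lebesgue_AE_eq_borel(2)[OF b 2] by simp
  qed
  have psum: "fourier_partial_sum f = fourier_partial_sum g"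
    by (simp add: fun_eq_iff fourier_partial_sum_def coeff)
  have var: "limiting_variance A f = limiting_variance A g"
    by (simp add: limiting_variance_def coeff)
  have norm_eq: "L2_norm_cube (\<lambda>x. complex_of_real (f x) - fourier_partial_sum f a x)
      = L2_norm_cube (\<lambda>x. complex_of_real (g x) - fourier_partial_sum g a x)" for a
  proof -
    let ?h = "\<lambda>u x. indicator unit_cube x *\<^sub>R (cmod (complex_of_real (u x) - fourier_partial_sum g a x))\<^sup>2"
    have b: "?h g \<in> borel_measurable borel" unfolding g.fourier_partial_sum_eq by measurable
    have 1: "AE x in lebesgue. ?h f x = ?h g x" using fg by eventually_elim simp
    have 2: "AE x in lebesgue. ?h g x = ?h g x" by simp
    show ?thesis
      unfolding L2_norm_cube_def set_lebesgue_integral_def psum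
      using lebesgue_AE_eq_borel(2)[OF b 1] lebesgue_AE_eq_borel(2)[OF b 2] by simp
  qed
  \<comment> \<open>The hypothesis starts at exponent 1 while \<open>eps\<close> starts at 0; one
    term does not affect summability.\<close>
  have "summable (\<lambda>m. g.eps (Suc m))" using assms(6) unfolding norm_eq g.L2_norm_cube_eq .
  then have eps: "summable g.eps" by (simp only: summable_Suc_iff)
  \<comment> \<open>Adjoining the cube gives the weight positive mass even when
    \<open>\<Gamma>\<close> is a null set.\<close>
  have "bounded (\<Gamma> \<union> unit_cube)"
    using assms(8) norm_unit_cube unfolding bounded_Un by (auto intro: boundedI)
  then obtain w V b where w: "integrable lborel w" "\<And>x. 0 \<le> w x" "\<And>x. x \<in> \<Gamma> \<union> unit_cube \<Longrightarrow> 1 \<le> w x"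
    "\<And>\<eta>. b \<le> norm \<eta> \<Longrightarrow> fourier_int w \<eta> = 0" "0 < b"
    "integrable lborel V" "\<And>x u. norm u \<le> sqrt CARD('d) \<Longrightarrow> w x \<le> V (x + u)"
    by (rule band_limited_weight) metis
  have cw: "cube x \<le> w x" for x using w(2,3)[of x] by (auto simp: indicator_def)
  have "(LINT x::real^'d|lborel. cube x) \<le> (LINT x|lborel. w x)"
    by (rule Bochner_Integration.integral_mono[OF cube_integrable w(1) cw])
  then have w_pos: "0 < (LINT x|lborel. w x)" unfolding cube_integral by simp
  interpret G: clt_system A q g w V b
    by unfold_locales (use w eps w_pos in auto)
  obtain G N N' where G: "\<Gamma> = G \<union> N" "N \<subseteq> N'" "N' \<in> null_sets lborel" "G \<in> sets lborel"
    using assms(7) by (rule sets_completionE)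
  have G_borel [measurable]: "G \<in> sets borel" using G(4) by simp
  have "bounded G" using assms(8) G(1) bounded_subset by blast
  then have G_fin: "emeasure lborel G < \<infinity>" by (rule emeasure_bounded_finite)
  have Gw: "indicator G x \<le> w x" for x using w(2,3)[of x] G(1) by (simp add: indicator_def)
  have "AE x in lborel. x \<notin> N'" by (rule AE_not_in[OF G(3)])
  then have \<Gamma>G: "AE x in lebesgue. x \<in> \<Gamma> \<longleftrightarrow> x \<in> G"
    using AE_completion[of "\<lambda>x. x \<notin> N'" lborel] G(1,2) by (auto elim: eventually_mono)
  define X where "X M x = 1 / sqrt (real M) * (\<Sum>k=1..M. f (matrix_power A k *v x))" for M x
  have XS: "AE x in lebesgue. X M x = G.S M x / sqrt (real M)" for M
  proof -
    have "AE x in lebesgue. \<forall>k\<in>{1..M}. f (matrix_power A k *v x) = g (matrix_power A k *v x)"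
    proof (rule AE_finite_allI)
      fix k assume "k \<in> {1..M}"
      then have "negligible {x. matrix_power A k *v x \<in> {x. f x \<noteq> g x}}" by (intro negligible_preimage neg) simp
      then show "AE x in lebesgue. f (matrix_power A k *v x) = g (matrix_power A k *v x)"
        by (intro negligible_AE) simp
    qed simp
    then show ?thesis
    proof eventually_elim
      case (elim x)
      then have "(\<Sum>k=1..M. f (matrix_power A k *v x)) = (\<Sum>k=1..M. g (matrix_power A k *v x))" by (intro sum.cong) auto
      also have "\<dots> = G.S M x" unfolding G.S_def by (simp only: One_nat_def sum.atLeast1_atMost_eq)
      finally show ?case by (simp add: X_def)
    qed
  qed
  have m\<Gamma>: "measure lebesgue \<Gamma> = measure lborel G"
  proof -
    have "measure lebesgue \<Gamma> = measure lebesgue G"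
      by (rule measure_eq_AE[OF \<Gamma>G assms(7)]) (simp add: sets_completionI_sets)
    then show ?thesis by simp
  qed
  have moment: "(LINT x:\<Gamma>|lebesgue. (X M x)\<^sup>2) = (LINT x|lborel. indicator G x * (G.S M x / sqrt (real M))\<^sup>2)" for M
    unfolding set_lebesgue_integral_def
  proof (rule lebesgue_AE_eq_borel(2))
    show "(\<lambda>x. indicator G x * (G.S M x / sqrt (real M))\<^sup>2) \<in> borel_measurable borel" by measurable
    show "AE x in lebesgue. indicator \<Gamma> x *\<^sub>R (X M x)\<^sup>2 = indicator G x * (G.S M x / sqrt (real M))\<^sup>2"
      using \<Gamma>G XS[of M] by eventually_elim (simp add: indicator_def)
  qed
  have dist: "measure lebesgue {x \<in> \<Gamma>. X M x \<le> t} = measure lborel {x \<in> G. G.S M x / sqrt (real M) \<le> t}" for M t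
  proof -
    have ae: "AE x in lebesgue. x \<in> {x \<in> G. G.S M x / sqrt (real M) \<le> t} \<longleftrightarrow> x \<in> {x \<in> \<Gamma>. X M x \<le> t}"
      using \<Gamma>G XS[of M] by eventually_elim simp
    have B: "{x \<in> G. G.S M x / sqrt (real M) \<le> t} \<in> sets lborel" by simp
    then have B': "{x \<in> G. G.S M x / sqrt (real M) \<le> t} \<in> sets lebesgue" by (rule sets_completionI_sets)
    have "{x \<in> \<Gamma>. X M x \<le> t} \<in> sets lebesgue" by (rule completion.in_sets_AE[OF ae B']) simp
    from measure_eq_AE[OF ae B' this] show ?thesis using B by simp
  qed
  have main: "(\<lambda>M. measure lebesgue {x \<in> \<Gamma>. X M x \<le> t}) \<longlonglongrightarrow> measure lebesgue \<Gamma> * cdf (centered_normal (limiting_variance A f)) t"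
    if "t \<noteq> 0 \<or> 0 < limiting_variance A f" for t
    unfolding dist m\<Gamma> var by (rule G.clt_borel(2)[OF G_borel G_fin Gw]) (use that var in simp)
  have "(\<lambda>M. LINT x:\<Gamma>|lebesgue. (X M x)\<^sup>2) \<longlonglongrightarrow> measure lebesgue \<Gamma> * limiting_variance A f"
    unfolding moment m\<Gamma> var by (rule G.clt_borel(1)[OF G_borel G_fin Gw])
  then show ?thesis using main unfolding X_def by blast
qed

end
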